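(* Let $\mathcal{C}\subseteq\mathbb{F}_{q^m}^n$ be a Gabidulin rank-metric code of dimension $k$, and let $\beta_{i,j}$ denote the $\mathbb{N}$-graded Betti numbers of the Stanley–Reisner ring of the independence complex of the matroid $Cl(\mathcal{M}_\mathcal{C})^*$. Then: (a) for $1\le r\le k$, $d_r=\min\{j:\beta_{r,[j]}\neq0\}$; (b) $\beta_{r,s}=0$ for all $s\le\frac{q^n-1}{q-1}$ which are not of the form $[j]$ for some $j$.
   Context: $q$ is a prime power, $\mathcal{E}=\mathbb{F}_q^n$. A Gabidulin code is an $\mathbb{F}_{q^m}$-linear subspace $\mathcal{C}\subseteq\mathbb{F}_{q^m}^n$ of dimension $k$. Fixing an $\mathbb{F}_q$-basis of $\mathbb{F}_{q^m}$, $c=(c_1,\dots,c_n)$ is represented by the $m\times n$ matrix over $\mathbb{F}_q$ whose $j$-th column is the coordinate vector of $c_j$; $Rsupp(c)$ is its row space in $\mathbb{F}_q^n$; for a subcode $D$, $Rsupp(D)$ is the $\mathbb{F}_q$-span of all $Rsupp(d)$, $d\in D$. The $r$-th generalized rank weight is $d_r=\min\{\dim_{\mathbb{F}_q}Rsupp(D): D\subseteq\mathcal{C}$ an $\mathbb{F}_{q^m}$-subspace with $\dim D=r\}$. $\mathcal{C}(X)=\{c\in\mathcal{C}:Rsupp(c)\subseteq X\}$; $\mathcal{M}_\mathcal{C}=(\mathcal{E},\rho_\mathcal{C})$ is the $q$-matroid with $\rho_\mathcal{C}(X)=k-\dim_{\mathbb{F}_{q^m}}\mathcal{C}(X^\perp)$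 ($X^\perp$ orthogonal complement for the standard dot product). $Cl(\mathcal{M}_\mathcal{C})$ is the matroid on the set $P(\mathcal{E})$ of $1$-dimensional subspaces of $\mathcal{E}$ with rank $\mathbf{r}(S)=\rho_\mathcal{C}(\langle S\rangle)$; $Cl(\mathcal{M}_\mathcal{C})^*$ its dual matroid ($\mathbf{r}^*(Y)=|Y|+\mathbf{r}(P(\mathcal{E})\setminus Y)-\mathbf{r}(P(\mathcal{E}))$). The Stanley–Reisner ring of a matroid on $E$ is $\mathbb{K}[x_e:e\in E]/I$, $I$ generated by $\prod_{e\in\sigma}x_e$ for dependent $\sigma$; $\beta_{i,j}$ are the $\mathbb{N}$-graded Betti numbers of its minimal free resolution. $[j]=q^{n-1}+q^{n-2}+\cdots+q^{n-j}$. *)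

theory Defs
  imports "HOL-Analysis.Analysis" "HOL-Library.Poly_Mapping"
begin

subsection \<open>Rank-metric codes\<close>

text \<open>The extension of finite fields is a pair of field types together with an embedding
  \<open>h\<close> of the small field into the large one; \<open>n\<close> and \<open>m\<close> are the cardinalities of the
  index types \<open>'n\<close> and \<open>'m\<close>.\<close>

definition field_embedding :: "('q::field \<Rightarrow> 'l::field) \<Rightarrow> bool" where
  "field_embedding h \<longleftrightarrow>
     h 1 = 1 \<and> (\<forall>x y. h (x + y) = h x + h y) \<and> (\<forall>x y. h (x * y) = h x * h y)"

definition ext_scale :: "('q::field \<Rightarrow> 'l::field) \<Rightarrow> 'q \<Rightarrow> 'l \<Rightarrow> 'l" where
  "ext_scale h a x = h a * x"

definition ext_basis :: "('q::field \<Rightarrow> 'l::field) \<Rightarrow> ('m::finite \<Rightarrow> 'l) \<Rightarrow> bool" where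
  "ext_basis h b \<longleftrightarrow>
     inj b \<and> \<not> module.dependent (ext_scale h) (range b) \<and> module.span (ext_scale h) (range b) = UNIV"

definition code_matrix ::
  "('q::field \<Rightarrow> 'l::field) \<Rightarrow> ('m::finite \<Rightarrow> 'l) \<Rightarrow> 'l ^ 'n::finite \<Rightarrow> 'q ^ 'n ^ 'm" where
  "code_matrix h b c = (\<chi> i j. module.representation (ext_scale h) (range b) (c $ j) (b i))"

definition Rsupp ::
  "('q::field \<Rightarrow> 'l::field) \<Rightarrow> ('m::finite \<Rightarrow> 'l) \<Rightarrow> 'l ^ 'n::finite \<Rightarrow> ('q ^ 'n) set" where
  "Rsupp h b c = vec.span (rows (code_matrix h b c))"

definition Rsupp_code ::
  "('q::field \<Rightarrow> 'l::field) \<Rightarrow> ('m::finite \<Rightarrow> 'l) \<Rightarrow> ('l ^ 'n::finite) set \<Rightarrow> ('q ^ 'n) set" where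
  "Rsupp_code h b D = vec.span (\<Union>d\<in>D. Rsupp h b d)"

text \<open>The field types being finite, the set below is finite; it is nonempty for
  \<open>r \<le> vec.dim C\<close>.\<close>

definition gen_rank_weight ::
  "('q::{field,finite} \<Rightarrow> 'l::{field,finite}) \<Rightarrow> ('m::finite \<Rightarrow> 'l) \<Rightarrow> ('l ^ 'n::finite) set
     \<Rightarrow> nat \<Rightarrow> nat" where
  "gen_rank_weight h b C r =
     Min {vec.dim (Rsupp_code h b D) | D. vec.subspace D \<and> D \<subseteq> C \<and> vec.dim D = r}"

subsection \<open>The q-matroid of a code and its classical matroid\<close>

definition orth_compl :: "('q::field ^ 'n::finite) set \<Rightarrow> ('q ^ 'n) set" where
  "orth_compl X = {y. \<forall>x\<in>X. scalar_product x y = 0}"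

definition supported_subcode ::
  "('q::field \<Rightarrow> 'l::field) \<Rightarrow> ('m::finite \<Rightarrow> 'l) \<Rightarrow> ('l ^ 'n::finite) set \<Rightarrow> ('q ^ 'n) set
     \<Rightarrow> ('l ^ 'n) set" where
  "supported_subcode h b C X = {c \<in> C. Rsupp h b c \<subseteq> X}"

definition qmatroid_rank ::
  "('q::field \<Rightarrow> 'l::field) \<Rightarrow> ('m::finite \<Rightarrow> 'l) \<Rightarrow> ('l ^ 'n::finite) set \<Rightarrow> ('q ^ 'n) set \<Rightarrow> nat" where
  "qmatroid_rank h b C X = vec.dim C - vec.dim (supported_subcode h b C (orth_compl X))"

typedef (overloaded) ('q::field, 'n::finite) proj_point =
  "{U :: ('q ^ 'n) set. vec.subspace U \<and> vec.dim U = 1}"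
proof -
  have "(1 :: 'q ^ 'n) \<noteq> 0"
    by (simp add: vec_eq_iff)
  then have "vec.dim (vec.span {1 :: 'q ^ 'n}) = 1"
    by (simp add: vec.dim_span_eq_card_independent vec.independent_insert)
  then show ?thesis
    using vec.subspace_span by blast
qed

instance proj_point :: ("{field,finite}", finite) finite
proof
  have "inj (Rep_proj_point :: ('a, 'b) proj_point \<Rightarrow> _)"
    by (simp add: inj_def Rep_proj_point_inject)
  then show "finite (UNIV :: ('a, 'b) proj_point set)"
    by (rule finite_imageD[rotated]) (rule finite_subset[OF subset_UNIV], simp)
qed

text \<open>A matroid on (all of) a finite type is given by its rank function.\<close>

definition Cl_rank :: "(('q::field ^ 'n::finite) set \<Rightarrow> nat) \<Rightarrow> ('q, 'n) proj_point set \<Rightarrow> nat" where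
  "Cl_rank \<rho> S = \<rho> (vec.span (\<Union>p\<in>S. Rep_proj_point p))"

text \<open>The subtraction is not truncated, since
  \<open>r UNIV \<le> r Y + r (- Y) \<le> card Y + r (- Y)\<close> in a matroid.\<close>

definition dual_rank :: "('e::finite set \<Rightarrow> nat) \<Rightarrow> 'e set \<Rightarrow> nat" where
  "dual_rank r Y = card Y + r (UNIV - Y) - r UNIV"

definition indep_complex :: "('e::finite set \<Rightarrow> nat) \<Rightarrow> 'e set set" where
  "indep_complex r = {\<sigma>. r \<sigma> = card \<sigma>}"

subsection \<open>Stanley--Reisner ideals\<close>

text \<open>Polynomials over \<open>'k\<close> in variables indexed by \<open>'e\<close>.\<close>

type_synonym ('e, 'k) mvpoly = "('e \<Rightarrow>\<^sub>0 nat) \<Rightarrow>\<^sub>0 'k"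

definition mvar :: "'e \<Rightarrow> ('e, 'k::comm_ring_1) mvpoly" where
  "mvar e = Poly_Mapping.single (Poly_Mapping.single e 1) 1"

definition mdegree :: "('e \<Rightarrow>\<^sub>0 nat) \<Rightarrow> nat" where
  "mdegree t = (\<Sum>e\<in>Poly_Mapping.keys t. Poly_Mapping.lookup t e)"

text \<open>The span over the polynomial ring, regarded as a module over itself, is the generated ideal.\<close>

definition stanley_reisner_ideal :: "'e::finite set set \<Rightarrow> ('e, 'k::field) mvpoly set" where
  "stanley_reisner_ideal \<Delta> = module.span (*) {\<Prod>e\<in>\<sigma>. mvar e | \<sigma>. \<sigma> \<notin> \<Delta>}"

subsection \<open>Minimal graded free resolutions and Betti numbers\<close>

text \<open>With \<open>S\<close> the polynomial ring, a record \<open>F\<close> describes a sequence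
  \<open>\<dots> \<rightarrow> F\<^sub>2 \<rightarrow> F\<^sub>1 \<rightarrow> F\<^sub>0 \<rightarrow> S/I\<close> of graded free modules of finite rank.
  The module \<open>F\<^sub>i\<close> is the direct sum of the \<open>S(-bdeg F i a)\<close> over \<open>a < frank F i\<close>, that is, its
  \<open>a\<close>-th basis element has degree \<open>bdeg F i a\<close>. The matrix of \<open>F\<^sub>i\<^sub>+\<^sub>1 \<rightarrow> F\<^sub>i\<close> has the entry
  \<open>dmat F i a b\<close> in row \<open>a\<close> and column \<open>b\<close>, and \<open>augm F a\<close> represents in \<open>S\<close> the image of
  the \<open>a\<close>-th basis element of \<open>F\<^sub>0\<close>. Entries outside the index range are irrelevant.\<close>

record (overloaded) ('e, 'k) free_complex =
  frank :: "nat \<Rightarrow> nat"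
  bdeg :: "nat \<Rightarrow> nat \<Rightarrow> nat"
  dmat :: "nat \<Rightarrow> nat \<Rightarrow> nat \<Rightarrow> ('e, 'k) mvpoly"
  augm :: "nat \<Rightarrow> ('e, 'k) mvpoly"

definition free_mod :: "('e, 'k::field) free_complex \<Rightarrow> nat \<Rightarrow> (nat \<Rightarrow> ('e, 'k) mvpoly) set" where
  "free_mod F i = {v. \<forall>a\<ge>frank F i. v a = 0}"

definition diff_map ::
  "('e, 'k::field) free_complex \<Rightarrow> nat \<Rightarrow> (nat \<Rightarrow> ('e, 'k) mvpoly) \<Rightarrow> nat \<Rightarrow> ('e, 'k) mvpoly" where
  "diff_map F i v = (\<lambda>a. if a < frank F i then \<Sum>b<frank F (Suc i). dmat F i a b * v b else 0)"

definition aug_map ::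
  "('e, 'k::field) free_complex \<Rightarrow> (nat \<Rightarrow> ('e, 'k) mvpoly) \<Rightarrow> ('e, 'k) mvpoly" where
  "aug_map F v = (\<Sum>a<frank F 0. augm F a * v a)"

text \<open>All maps preserve degrees.\<close>

definition graded_complex :: "('e, 'k::field) free_complex \<Rightarrow> bool" where
  "graded_complex F \<longleftrightarrow>
     (\<forall>a<frank F 0. \<forall>t\<in>Poly_Mapping.keys (augm F a). mdegree t = bdeg F 0 a) \<and>
     (\<forall>i. \<forall>a<frank F i. \<forall>b<frank F (Suc i). \<forall>t\<in>Poly_Mapping.keys (dmat F i a b).
        bdeg F i a + mdegree t = bdeg F (Suc i) b)"

definition exact_complex :: "('e, 'k::field) mvpoly set \<Rightarrow> ('e, 'k) free_complex \<Rightarrow> bool" where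
  "exact_complex I F \<longleftrightarrow>
     (\<forall>p. \<exists>v\<in>free_mod F 0. p - aug_map F v \<in> I) \<and>
     {v \<in> free_mod F 0. aug_map F v \<in> I} = diff_map F 0 ` free_mod F 1 \<and>
     (\<forall>i. {v \<in> free_mod F (Suc i). diff_map F i v = (\<lambda>_. 0)}
            = diff_map F (Suc i) ` free_mod F (Suc (Suc i)))"

text \<open>The image of \<open>F\<^sub>i\<^sub>+\<^sub>1\<close> lies in \<open>\<mm> F\<^sub>i\<close> for the ideal \<open>\<mm>\<close> generated by the
  variables: no matrix entry has a constant term.\<close>

definition minimal_complex :: "('e, 'k::field) free_complex \<Rightarrow> bool" where
  "minimal_complex F \<longleftrightarrow>
     (\<forall>i. \<forall>a<frank F i. \<forall>b<frank F (Suc i). Poly_Mapping.lookup (dmat F i a b) 0 = 0)"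

definition minimal_graded_free_resolution ::
  "('e, 'k::field) mvpoly set \<Rightarrow> ('e, 'k) free_complex \<Rightarrow> bool" where
  "minimal_graded_free_resolution I F \<longleftrightarrow>
     graded_complex F \<and> exact_complex I F \<and> minimal_complex F"

definition betti :: "('e, 'k::field) free_complex \<Rightarrow> nat \<Rightarrow> nat \<Rightarrow> nat" where
  "betti F i j = card {a. a < frank F i \<and> bdeg F i a = j}"

subsection \<open>The numbers \<open>[j]\<close>\<close>

text \<open>Meaningful for \<open>0 \<le> j \<le> n\<close>, with \<open>[0] = 0\<close> and \<open>[n] = (q\<^sup>n - 1) / (q - 1)\<close>.\<close>

definition qbracket :: "nat \<Rightarrow> nat \<Rightarrow> nat \<Rightarrow> nat" where
  "qbracket q n j = (\<Sum>i=1..j. q ^ (n - i))"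

end

theory Submission
  imports Defs "HOL-Library.Function_Algebras"
begin

text \<open>
  Tensoring a minimal resolution of the Stanley--Reisner ring with the Koszul complex gives a double
  complex whose rows are exact and whose columns are exact off one edge. A diagram chase shows that
  the \<open>p\<close>-th free module has a generator of degree \<open>s\<close> iff the Koszul homology of the
  Stanley--Reisner ring in homological degree \<open>p\<close> and degree \<open>s\<close> is nonzero. That homology splits
  into multigraded strands; a strand is either a cone or the cochain complex of a restriction of the
  simplicial complex (Hochster). For a matroid, deletion and link show that such a restriction has
  cohomology only in top degree, and there iff it has no cone point. For the dual of a matroid with
  rank function \<open>r\<close> the relevant restrictions are the complements of the flats \<open>A\<close> with
  \<open>r A + p = r E\<close>.

  The rank of a set of points is the codimension of the subcode on which the corresponding linear
  functionals vanish. The flats are the point sets of certain subspaces of \<open>F\<^sub>q\<^sup>n\<close>, and the complement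
  of the point set of a subspace of codimension \<open>j\<close> has \<open>[j]\<close> elements. A subcode attaining \<open>d\<^sub>r\<close>
  vanishes on the orthogonal complement of its support; enlarging that to a flat of corank \<open>r\<close>
  compares \<open>d\<^sub>r\<close> with the least codimension of such a flat.
\<close>

subsection \<open>Diagram chase in a first-quadrant double complex\<close>

text \<open>\<open>F\<close> is an arbitrary minimal resolution, so the degrees of its generators
  have to be read off from an invariant of the ring, and Koszul homology is one. Both claims only
  ask which Betti numbers are zero. Hence each comparison has the form "every cycle is a boundary";
  no homology group is formed, no dimension of one is counted, and the argument is the same over
  every coefficient field. Complements enter because restricting the dual matroid to the complement
  of \<open>A\<close> is dual to contracting \<open>A\<close>: the cone points of the restriction
  are the points outside \<open>A\<close> that do not raise its rank, so having none means that
  \<open>A\<close> is a flat, and the top degree translates into the corank of \<open>A\<close>. The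
  numbers \<open>[j]\<close> enter because vanishing on a set of points forces vanishing on its
  span. A flat therefore contains every point of its span, and the size of its complement depends on
  a codimension alone. Since \<open>q\<close> is at least 2, this size determines the codimension,
  so a minimum over Betti degrees is a minimum over codimensions of flats.\<close>

locale double_complex =
  fixes X :: "nat \<Rightarrow> nat \<Rightarrow> 'x::ab_group_add set"
    and d \<delta> :: "nat \<Rightarrow> 'x \<Rightarrow> 'x"
  assumes diff_in: "\<And>p i x y. x \<in> X p i \<Longrightarrow> y \<in> X p i \<Longrightarrow> x - y \<in> X p i"
    and d_in: "\<And>p i x. x \<in> X p (Suc i) \<Longrightarrow> d i x \<in> X p i"
    and \<delta>_in: "\<And>p i x. x \<in> X (Suc p) i \<Longrightarrow> \<delta> i x \<in> X p i"
    and d_diff: "\<And>p i x y. x \<in> X p (Suc i) \<Longrightarrow> y \<in> X p (Suc i) \<Longrightarrow> d i (x - y) = d i x - d i y"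
    and \<delta>_diff: "\<And>i x y. \<delta> i (x - y) = \<delta> i x - \<delta> i y"
    and \<delta>_0: "\<And>i x. x \<in> X 0 i \<Longrightarrow> \<delta> i x = 0"
    and commute: "\<And>p i x. x \<in> X p (Suc i) \<Longrightarrow> \<delta> i (d i x) = d i (\<delta> (Suc i) x)"
    and d_d: "\<And>p i x. x \<in> X p (Suc (Suc i)) \<Longrightarrow> d i (d (Suc i) x) = 0"
    and \<delta>_\<delta>: "\<And>p i x. x \<in> X p i \<Longrightarrow> \<delta> i (\<delta> i x) = 0"
    and row_exact: "\<And>p i x. x \<in> X p (Suc i) \<Longrightarrow> d i x = 0 \<Longrightarrow> \<exists>y\<in>X p (Suc (Suc i)). x = d (Suc i) y"
    and row_surj: "\<And>p x. x \<in> X p 0 \<Longrightarrow> \<exists>y\<in>X p 1. x = d 0 y"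
    and column_exact: "\<And>p i x. x \<in> X (Suc p) (Suc i) \<Longrightarrow> \<delta> (Suc i) x = 0 \<Longrightarrow>
           \<exists>y\<in>X (Suc (Suc p)) (Suc i). x = \<delta> (Suc i) y"
    and minimal: "\<And>i x. x \<in> X 0 (Suc (Suc i)) \<Longrightarrow> \<exists>y\<in>X 1 (Suc i). d (Suc i) x = \<delta> (Suc i) y"
begin

lemma d_0: "x \<in> X p (Suc i) \<Longrightarrow> d i 0 = 0"
  using d_diff[of x p i x] by simp

text \<open>Second index \<open>0\<close> is the resolved module, \<open>Suc i\<close> the free
  module of index \<open>i\<close>; column \<open>Suc i\<close> has homology only at first index
  \<open>0\<close>. Along \<open>a + i = p\<close>, the elements with
  \<open>d (\<delta> c) = 0\<close> modulo the images of \<open>d\<close> and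
  \<open>\<delta>\<close> measure one and the same obstruction: if \<open>\<delta> c = d c'\<close>,
  then \<open>c'\<close> carries it one place closer to the corner, where it vanishes by
  assumption.\<close>

lemma decomposes_if_corner_trivial:
  assumes triv: "\<And>x. x \<in> X 0 (Suc p) \<Longrightarrow> \<exists>y\<in>X 1 (Suc p). x = \<delta> (Suc p) y"
    and "a + i = p" "c \<in> X a (Suc i)" "d i (\<delta> (Suc i) c) = 0"
  shows "\<exists>y\<in>X a (Suc (Suc i)). \<exists>y'\<in>X (Suc a) (Suc i). c = d (Suc i) y + \<delta> (Suc i) y'"
  using assms(2-)
proof (induction a arbitrary: i c)
  case 0
  obtain y where y: "y \<in> X 1 (Suc i)" "c = \<delta> (Suc i) y"
    using triv 0 by auto
  \<comment> \<open>\<open>diff_in\<close> produces \<open>0\<close> only where some element is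
    known; exactness of the row at \<open>0\<close> supplies one.\<close>
  obtain z where z: "z \<in> X 0 (Suc (Suc i))"
  proof -
    have "0 \<in> X 0 (Suc i)"
      using diff_in[OF 0(2) 0(2)] by simp
    moreover have "d i 0 = 0"
      using d_0 0(2) by blast
    ultimately show ?thesis
      using row_exact that by blast
  qed
  have "0 \<in> X 0 (Suc (Suc i))"
    using diff_in[OF z z] by simp
  moreover have "c = d (Suc i) 0 + \<delta> (Suc i) y"
    using y d_0[OF z] by simp
  ultimately show ?case using y(1) by (metis One_nat_def)
next
  case (Suc a)
  note c = Suc.prems(2)
  have 1: "\<delta> (Suc i) c \<in> X a (Suc i)"
    using \<delta>_in c by blast
  obtain c' where c': "c' \<in> X a (Suc (Suc i))" "\<delta> (Suc i) c = d (Suc i) c'"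
    using row_exact[OF 1 Suc.prems(3)] by blast
  have "d (Suc i) (\<delta> (Suc (Suc i)) c') = \<delta> (Suc i) (\<delta> (Suc i) c)"
    using commute[OF c'(1)] c'(2) by simp
  also have "\<dots> = 0"
    using \<delta>_\<delta> c by blast
  finally obtain y y' where y: "y \<in> X a (Suc (Suc (Suc i)))" "y' \<in> X (Suc a) (Suc (Suc i))"
      "c' = d (Suc (Suc i)) y + \<delta> (Suc (Suc i)) y'"
    using Suc.IH[of "Suc i" c'] Suc.prems(1) c'(1) by auto
  have dy: "d (Suc (Suc i)) y \<in> X a (Suc (Suc i))"
    using d_in y(1) by blast
  have \<delta>y: "\<delta> (Suc (Suc i)) y' = c' - d (Suc (Suc i)) y"
    using y(3) by (simp add: algebra_simps)
  \<comment> \<open>As \<open>d\<close> kills \<open>d y\<close>, the correction \<open>d y'\<close>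
    has the same column image as \<open>c\<close>; their difference is a column cycle away from the
    corner.\<close>
  have "\<delta> (Suc i) (d (Suc i) y') = d (Suc i) (\<delta> (Suc (Suc i)) y')"
    using commute y(2) by blast
  also have "\<dots> = d (Suc i) c'"
    using d_diff[OF c'(1) dy] d_d[OF y(1)] \<delta>y by simp
  finally have "\<delta> (Suc i) (c - d (Suc i) y') = 0"
    using \<delta>_diff c'(2) by simp
  moreover have "c - d (Suc i) y' \<in> X (Suc a) (Suc i)"
    using diff_in c d_in y(2) by blast
  ultimately obtain y'' where "y'' \<in> X (Suc (Suc a)) (Suc i)" "c - d (Suc i) y' = \<delta> (Suc i) y''"
    using column_exact by blast
  moreover from this have "c = d (Suc i) y' + \<delta> (Suc i) y''"
    by (simp add: algebra_simps)
  ultimately show ?case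
    using y(2) by blast
qed

text \<open>The obstruction is carried the other way: \<open>c\<close> is replaced by
  \<open>c'\<close> with \<open>d c = \<delta> c'\<close>, one place closer to the edge, where the
  assumption applies.\<close>

lemma decomposes_if_edge_exact:
  assumes triv: "\<And>z. z \<in> X p 0 \<Longrightarrow> \<delta> 0 z = 0 \<Longrightarrow> \<exists>y\<in>X (Suc p) 0. z = \<delta> 0 y"
    and "a + i = p" "c \<in> X a (Suc i)" "d i (\<delta> (Suc i) c) = 0"
  shows "\<exists>y\<in>X a (Suc (Suc i)). \<exists>y'\<in>X (Suc a) (Suc i). c = d (Suc i) y + \<delta> (Suc i) y'"
proof -
  have lift: "\<exists>y\<in>X a (Suc (Suc i)). \<exists>y'\<in>X (Suc a) (Suc i). c = d (Suc i) y + \<delta> (Suc i) y'"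
    if c: "c \<in> X a (Suc i)" and y: "y \<in> X (Suc a) (Suc i)" "d i c = d i (\<delta> (Suc i) y)" for a i c y
  proof -
    have "\<delta> (Suc i) y \<in> X a (Suc i)"
      using \<delta>_in y by blast
    then have "c - \<delta> (Suc i) y \<in> X a (Suc i)" "d i (c - \<delta> (Suc i) y) = 0"
      using diff_in c d_diff y(2) by auto
    then obtain y'' where y'': "y'' \<in> X a (Suc (Suc i))" "c - \<delta> (Suc i) y = d (Suc i) y''"
      using row_exact by blast
    then have "c = d (Suc i) y'' + \<delta> (Suc i) y"
      by (simp add: algebra_simps)
    then show ?thesis
      using y(1) y''(1) by blast
  qed
  show ?thesis
    using assms(2-)
  proof (induction i arbitrary: a c)
    case 0
    then have "d 0 c \<in> X p 0" "\<delta> 0 (d 0 c) = 0"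
      using d_in commute by auto
    then obtain y where y: "y \<in> X (Suc p) 0" "d 0 c = \<delta> 0 y"
      using triv by blast
    then obtain y0 where y0: "y0 \<in> X (Suc p) 1" "y = d 0 y0"
      using row_surj by blast
    show ?case
      using lift[of c a 0 y0] 0 y y0 commute by auto
  next
    case (Suc i)
    note c = Suc.prems(2)
    have dc: "d (Suc i) c \<in> X a (Suc i)" "\<delta> (Suc i) (d (Suc i) c) = 0"
      using d_in c commute Suc.prems(3) by auto
    obtain c' where c': "c' \<in> X (Suc a) (Suc i)" "d (Suc i) c = \<delta> (Suc i) c'"
    \<comment> \<open>For \<open>a = 0\<close> the column has homology here, and it is minimality
      that turns \<open>d c\<close> into a boundary.\<close>
    proof (cases a)
      case 0
      then show ?thesis
        using minimal c that by auto
    next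
      case (Suc a')
      then show ?thesis
        using column_exact dc that by auto
    qed
    have "d i (\<delta> (Suc i) c') = 0"
      using d_d[OF c] c'(2) by simp
    then obtain y y' where y: "y \<in> X (Suc a) (Suc (Suc i))" "y' \<in> X (Suc (Suc a)) (Suc i)"
        "c' = d (Suc i) y + \<delta> (Suc i) y'"
      using Suc.IH[of "Suc a" c'] Suc.prems(1) c'(1) by auto
    have "\<delta> (Suc i) (c' - d (Suc i) y) = 0"
      using \<delta>_\<delta>[OF y(2)] y(3) by simp
    then have "d (Suc i) c = \<delta> (Suc i) (d (Suc i) y)"
      using \<delta>_diff c'(2) by simp
    then show ?case
      using lift[OF c, of y] y(1) commute by simp
  qed
qed

text \<open>Both sides say that the obstruction of the two preceding lemmas vanishes. Read at
  \<open>X p 1\<close> it is the edge homology, since \<open>d 0\<close> is onto; read at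
  \<open>X 0 (Suc p)\<close> it is the corner modulo boundaries, since minimality absorbs the image
  of \<open>d\<close>.\<close>

theorem edge_homology:
  "(\<forall>z\<in>X p 0. \<delta> 0 z = 0 \<longrightarrow> (\<exists>y\<in>X (Suc p) 0. z = \<delta> 0 y)) \<longleftrightarrow>
   (\<forall>x\<in>X 0 (Suc p). \<exists>y\<in>X 1 (Suc p). x = \<delta> (Suc p) y)" (is "?edge \<longleftrightarrow> ?corner")
proof
  assume ?corner
  show ?edge
  proof (intro ballI impI)
    fix z assume z: "z \<in> X p 0" "\<delta> 0 z = 0"
    obtain c where c: "c \<in> X p (Suc 0)" "z = d 0 c"
      using row_surj z by auto
    then have "d 0 (\<delta> (Suc 0) c) = 0"
      using commute z(2) by simp
    then obtain y y' where y: "y \<in> X p (Suc (Suc 0))" "y' \<in> X (Suc p) (Suc 0)"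
        "c = d (Suc 0) y + \<delta> (Suc 0) y'"
      using decomposes_if_corner_trivial[of p p 0 c] \<open>?corner\<close> c(1) by auto
    have "c - \<delta> (Suc 0) y' = d (Suc 0) y"
      using y(3) by (simp add: algebra_simps)
    then have "d 0 (c - \<delta> (Suc 0) y') = 0"
      using d_d[OF y(1)] by simp
    then have "d 0 c = \<delta> 0 (d 0 y')"
      using d_diff[OF c(1) \<delta>_in[OF y(2)]] commute[OF y(2)] by simp
    then show "\<exists>y\<in>X (Suc p) 0. z = \<delta> 0 y"
      using c(2) d_in y(2) by blast
  qed
next
  assume ?edge
  show ?corner
  proof
    fix x assume x: "x \<in> X 0 (Suc p)"
    have "\<delta> (Suc p) x = 0"
      using \<delta>_0 x by blast
    then have "d p (\<delta> (Suc p) x) = 0"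
      using d_0[OF x] by simp
    then obtain y y' where y: "y \<in> X 0 (Suc (Suc p))" "y' \<in> X 1 (Suc p)"
        "x = d (Suc p) y + \<delta> (Suc p) y'"
      using decomposes_if_edge_exact[of p 0 p x] \<open>?edge\<close> x by auto
    obtain w where w: "w \<in> X 1 (Suc p)" "d (Suc p) y = \<delta> (Suc p) w"
      using minimal y(1) by blast
    \<comment> \<open>The sum \<open>w + y'\<close> is written \<open>w - (0 - y')\<close>, because
      the sets \<open>X p i\<close> are only assumed closed under differences.\<close>
    have n: "0 - y' \<in> X 1 (Suc p)"
      using diff_in[OF diff_in[OF y(2) y(2)] y(2)] by simp
    have "\<delta> (Suc p) (0 - y') = 0 - \<delta> (Suc p) y'"
      using \<delta>_diff[of _ 0 y'] \<delta>_diff[of _ 0 0] by simp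
    then have "x = \<delta> (Suc p) (w - (0 - y'))"
      using \<delta>_diff[of "Suc p" w "0 - y'"] w(2) y(3) by simp
    then show "\<exists>y\<in>X 1 (Suc p). x = \<delta> (Suc p) y"
      using diff_in[OF w(1) n] by blast
  qed
qed

end

subsection \<open>Cochains of simplicial complexes\<close>

text \<open>The signs of an exterior algebra, abstracted from any ordering so that the same lemmas
  serve \<open>ksign\<close> and its shifted form \<open>usign\<close>. The second equation makes
  the sign independent of whether \<open>e\<close> lies in \<open>\<tau>\<close>; the last one is
  anticommutation.\<close>

definition sign_system :: "'e set \<Rightarrow> ('e \<Rightarrow> 'e set \<Rightarrow> 'k::comm_ring_1) \<Rightarrow> bool" where
  "sign_system W s \<longleftrightarrow>
     (\<forall>\<tau>\<subseteq>W. \<forall>e\<in>W. s e \<tau> * s e \<tau> = 1 \<and> s e (insert e \<tau>) = s e \<tau>) \<and>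
     (\<forall>\<tau>\<subseteq>W. \<forall>e\<in>W - \<tau>. \<forall>x\<in>\<tau>. s x (insert e \<tau>) * s e (\<tau> - {x}) = - (s x \<tau> * s e \<tau>))"

lemma sign_systemD:
  assumes "sign_system W s" "\<tau> \<subseteq> W" "e \<in> W"
  shows sign_square: "s e \<tau> * s e \<tau> = 1" and sign_insert: "s e (insert e \<tau>) = s e \<tau>"
    and sign_swap: "e \<notin> \<tau> \<Longrightarrow> x \<in> \<tau> \<Longrightarrow> s x (insert e \<tau>) * s e (\<tau> - {x}) = - (s x \<tau> * s e \<tau>)"
proof -
  note * = assms(1)[unfolded sign_system_def, THEN conjunct1, rule_format, OF assms(2,3)]
  show "s e \<tau> * s e \<tau> = 1" "s e (insert e \<tau>) = s e \<tau>"
    by (rule *[THEN conjunct1]) (rule *[THEN conjunct2])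
  show "s x (insert e \<tau>) * s e (\<tau> - {x}) = - (s x \<tau> * s e \<tau>)" if "e \<notin> \<tau>" "x \<in> \<tau>"
    by (rule assms(1)[unfolded sign_system_def, THEN conjunct2, rule_format])
      (use assms that in auto)
qed

lemma sign_cancel:
  assumes "sign_system W s" "\<tau> \<subseteq> W" "e \<in> W" "s e \<tau> * x = s e \<tau> * y"
  shows "x = y"
proof -
  have "s e \<tau> * (s e \<tau> * x) = s e \<tau> * (s e \<tau> * y)"
    using assms(4) by (rule arg_cong)
  then show ?thesis
    unfolding mult.assoc[symmetric] sign_square[OF assms(1-3)] by simp
qed

lemma sign_system_subset: "sign_system W s \<Longrightarrow> V \<subseteq> W \<Longrightarrow> sign_system V s"
  unfolding sign_system_def by (meson Diff_iff subset_iff subset_trans)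

text \<open>Cochains are reduced and graded by cardinality: the empty face has degree
  \<open>0\<close>, so the top degree of a matroid complex is its rank.\<close>

definition cob :: "('e \<Rightarrow> 'e set \<Rightarrow> 'k::comm_ring_1) \<Rightarrow> ('e set \<Rightarrow> 'k) \<Rightarrow> 'e set \<Rightarrow> 'k" where
  "cob s f \<tau> = (\<Sum>e\<in>\<tau>. s e \<tau> * f (\<tau> - {e}))"

definition contract :: "('e \<Rightarrow> 'e set \<Rightarrow> 'k::comm_ring_1) \<Rightarrow> 'e \<Rightarrow> ('e set \<Rightarrow> 'k) \<Rightarrow> 'e set \<Rightarrow> 'k" where
  "contract s e f \<tau> = s e \<tau> * f (insert e \<tau>)"

lemma cob_cong: "(\<And>e. e \<in> \<tau> \<Longrightarrow> f (\<tau> - {e}) = g (\<tau> - {e})) \<Longrightarrow> cob s f \<tau> = cob s g \<tau>"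
  by (simp add: cob_def)

lemma cob_empty [simp]: "cob s f {} = 0"
  by (simp add: cob_def)

lemma cob_add: "cob s (\<lambda>\<tau>. f \<tau> + g \<tau>) \<tau> = cob s f \<tau> + cob s g \<tau>"
  by (simp add: cob_def sum.distrib algebra_simps)

lemma cob_diff: "cob s (\<lambda>\<tau>. f \<tau> - g \<tau>) \<tau> = cob s f \<tau> - cob s g \<tau>"
  by (simp add: cob_def sum_subtractf algebra_simps)

lemma cob_uminus: "cob s (\<lambda>\<tau>. - f \<tau>) \<tau> = - cob s f \<tau>"
  by (simp add: cob_def sum_negf)

lemma cob_zero: "(\<And>e. e \<in> \<tau> \<Longrightarrow> f (\<tau> - {e}) = 0) \<Longrightarrow> cob s f \<tau> = 0"
  by (simp add: cob_def)

text \<open>Contraction with \<open>e\<close> is a homotopy between the identity and \<open>0\<close> on the sets avoiding \<open>e\<close>.\<close>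

lemma cob_insert:
  assumes s: "sign_system W s" and fin: "finite W" and \<tau>: "\<tau> \<subseteq> W" "e \<in> W" "e \<notin> \<tau>"
  shows "s e \<tau> * cob s f (insert e \<tau>) = f \<tau> - cob s (contract s e f) \<tau>"
proof -
  have [simp]: "finite \<tau>"
    using fin \<tau>(1) finite_subset by blast
  have ss: "s e \<tau> * s e \<tau> = 1" "s e (insert e \<tau>) = s e \<tau>"
    using sign_square[OF s \<tau>(1,2)] sign_insert[OF s \<tau>(1,2)] by blast+
  have "s e \<tau> * (s x (insert e \<tau>) * f (insert e \<tau> - {x})) = - (s x \<tau> * contract s e f (\<tau> - {x}))"
    if x: "x \<in> \<tau>" for x
  proof -
    have swap: "s x (insert e \<tau>) * s e (\<tau> - {x}) = - (s x \<tau> * s e \<tau>)"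
      using sign_swap[OF s \<tau>(1,2)] \<tau>(3) x by blast
    have sq: "s e (\<tau> - {x}) * s e (\<tau> - {x}) = 1"
      using \<tau> by (intro sign_square[OF s]) auto
    have "s e \<tau> * s x (insert e \<tau>)
        = s e \<tau> * s x (insert e \<tau>) * (s e (\<tau> - {x}) * s e (\<tau> - {x}))"
      by (simp only: sq mult.right_neutral)
    also have "\<dots> = s e \<tau> * (s x (insert e \<tau>) * s e (\<tau> - {x})) * s e (\<tau> - {x})"
      by (simp only: mult.assoc)
    also have "\<dots> = s e \<tau> * - (s x \<tau> * s e \<tau>) * s e (\<tau> - {x})"
      by (simp only: swap)
    also have "\<dots> = - (s x \<tau> * s e (\<tau> - {x})) * (s e \<tau> * s e \<tau>)"
      by (simp add: ac_simps)
    finally have "s e \<tau> * s x (insert e \<tau>) = - (s x \<tau> * s e (\<tau> - {x}))"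
      using ss(1) by simp
    moreover have "insert e \<tau> - {x} = insert e (\<tau> - {x})"
      using x \<tau> by auto
    ultimately show ?thesis
      by (simp add: contract_def mult.assoc[symmetric])
  qed
  then have "(\<Sum>x\<in>\<tau>. s e \<tau> * (s x (insert e \<tau>) * f (insert e \<tau> - {x}))) = - cob s (contract s e f) \<tau>"
    by (simp add: cob_def sum_negf)
  moreover have "s e \<tau> * (s e (insert e \<tau>) * f \<tau>) = f \<tau>"
    using ss by (simp add: mult.assoc[symmetric])
  ultimately show ?thesis
    using \<tau>(3) by (simp add: cob_def sum_distrib_left distrib_left)
qed

text \<open>No double sum is cancelled. The homotopy formula \<open>cob_insert\<close> at
  \<open>e\<close>, used outside and again inside, reduces the value at
  \<open>insert e \<tau>\<close> to the double coboundary of \<open>contract s e f\<close> at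
  \<open>\<tau>\<close>.\<close>

lemma cob_cob:
  assumes s: "sign_system W s" and fin: "finite W" and "\<tau> \<subseteq> W"
  shows "cob s (cob s f) \<tau> = 0"
proof -
  have "finite \<tau>"
    using assms finite_subset by blast
  then show ?thesis
    using \<open>\<tau> \<subseteq> W\<close>
  proof (induction \<tau> arbitrary: f)
    case empty
    then show ?case by simp
  next
    case (insert e \<tau>)
    then have e: "\<tau> \<subseteq> W" "e \<in> W" "e \<notin> \<tau>" by auto
    have "contract s e (cob s f) (\<tau> - {x}) = f (\<tau> - {x}) - cob s (contract s e f) (\<tau> - {x})" for x
      using cob_insert[OF s fin, of "\<tau> - {x}" e f] e by (auto simp: contract_def)
    then have "cob s (contract s e (cob s f)) \<tau> = cob s (\<lambda>\<sigma>. f \<sigma> - cob s (contract s e f) \<sigma>) \<tau>"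
      by (rule cob_cong)
    also have "\<dots> = cob s f \<tau>"
      using insert by (simp add: cob_diff)
    finally have "s e \<tau> * cob s (cob s f) (insert e \<tau>) = 0"
      using cob_insert[OF s fin e] by simp
    then show ?case
      using sign_cancel[OF s e(1,2), of _ 0] by simp
  qed
qed

text \<open>The values of cochains outside \<open>\<Gamma>\<close> play no role, \<open>\<Gamma>\<close> being closed under subsets.\<close>

definition exact_at :: "('e \<Rightarrow> 'e set \<Rightarrow> 'k::comm_ring_1) \<Rightarrow> 'e set set \<Rightarrow> nat \<Rightarrow> bool" where
  "exact_at s \<Gamma> j \<longleftrightarrow>
     (\<forall>f. (\<forall>\<tau>\<in>\<Gamma>. card \<tau> = Suc j \<longrightarrow> cob s f \<tau> = 0) \<longrightarrow>
        (\<exists>g. \<forall>\<tau>\<in>\<Gamma>. card \<tau> = j \<longrightarrow> f \<tau> = cob s g \<tau>))"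

lemma exact_atI:
  "(\<And>f. (\<And>\<tau>. \<tau> \<in> \<Gamma> \<Longrightarrow> card \<tau> = Suc j \<Longrightarrow> cob s f \<tau> = 0) \<Longrightarrow>
     \<exists>g. \<forall>\<tau>\<in>\<Gamma>. card \<tau> = j \<longrightarrow> f \<tau> = cob s g \<tau>) \<Longrightarrow> exact_at s \<Gamma> j"
  unfolding exact_at_def by blast

lemma exact_atD:
  assumes "exact_at s \<Gamma> j" "\<And>\<tau>. \<tau> \<in> \<Gamma> \<Longrightarrow> card \<tau> = Suc j \<Longrightarrow> cob s f \<tau> = 0"
  obtains g where "\<And>\<tau>. \<tau> \<in> \<Gamma> \<Longrightarrow> card \<tau> = j \<Longrightarrow> f \<tau> = cob s g \<tau>"
  using assms unfolding exact_at_def by metis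

section \<open>Matroid complexes: deletion, link, and cohomology in top degree only\<close>

definition simplicial_complex :: "'e set set \<Rightarrow> bool" where
  "simplicial_complex \<Gamma> \<longleftrightarrow> (\<forall>\<tau>\<in>\<Gamma>. \<forall>\<sigma>\<subseteq>\<tau>. \<sigma> \<in> \<Gamma>)"

definition matroid_complex :: "'e set set \<Rightarrow> bool" where
  "matroid_complex \<Gamma> \<longleftrightarrow> {} \<in> \<Gamma> \<and> simplicial_complex \<Gamma> \<and>
     (\<forall>I\<in>\<Gamma>. \<forall>J\<in>\<Gamma>. card I < card J \<longrightarrow> (\<exists>e\<in>J - I. insert e I \<in> \<Gamma>))"

lemma simplicial_complexD: "simplicial_complex \<Gamma> \<Longrightarrow> \<tau> \<in> \<Gamma> \<Longrightarrow> \<sigma> \<subseteq> \<tau> \<Longrightarrow> \<sigma> \<in> \<Gamma>"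
  unfolding simplicial_complex_def by blast

definition deletion :: "'e \<Rightarrow> 'e set set \<Rightarrow> 'e set set" where
  "deletion e \<Gamma> = {\<tau> \<in> \<Gamma>. e \<notin> \<tau>}"

definition link :: "'e \<Rightarrow> 'e set set \<Rightarrow> 'e set set" where
  "link e \<Gamma> = {\<tau>. e \<notin> \<tau> \<and> insert e \<tau> \<in> \<Gamma>}"

text \<open>In the complex of independent sets of a matroid these are the coloops.\<close>

definition cone_point :: "'e set set \<Rightarrow> 'e \<Rightarrow> bool" where
  "cone_point \<Gamma> c \<longleftrightarrow> (\<forall>\<tau>\<in>\<Gamma>. insert c \<tau> \<in> \<Gamma>)"

lemma simplicial_deletion: "simplicial_complex \<Gamma> \<Longrightarrow> simplicial_complex (deletion e \<Gamma>)"
  unfolding simplicial_complex_def deletion_def by blast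

lemma matroid_deletion: "matroid_complex \<Gamma> \<Longrightarrow> matroid_complex (deletion e \<Gamma>)"
  using simplicial_deletion[of \<Gamma> e]
  unfolding matroid_complex_def by (fastforce simp: deletion_def)

lemma link_subset_deletion: "simplicial_complex \<Gamma> \<Longrightarrow> link e \<Gamma> \<subseteq> deletion e \<Gamma>"
  unfolding simplicial_complex_def link_def deletion_def by blast

lemma matroid_link:
  assumes "matroid_complex \<Gamma>" "\<Gamma> \<subseteq> Pow W" "finite W" "{e} \<in> \<Gamma>"
  shows "matroid_complex (link e \<Gamma>)"
  unfolding matroid_complex_def
proof (intro conjI ballI impI)
  show "{} \<in> link e \<Gamma>"
    using assms by (simp add: link_def)
  show "simplicial_complex (link e \<Gamma>)"
    unfolding simplicial_complex_def link_def
  proof (intro ballI allI impI CollectI conjI)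
    fix \<tau> \<sigma> assume *: "\<tau> \<in> {\<tau>. e \<notin> \<tau> \<and> insert e \<tau> \<in> \<Gamma>}" "\<sigma> \<subseteq> \<tau>"
    then show "e \<notin> \<sigma>" by auto
    have "insert e \<sigma> \<subseteq> insert e \<tau>" using * by auto
    then show "insert e \<sigma> \<in> \<Gamma>"
      using * assms(1) unfolding matroid_complex_def simplicial_complex_def by blast
  qed
next
  fix I J assume IJ: "I \<in> link e \<Gamma>" "J \<in> link e \<Gamma>" "card I < card J"
  then have "I \<subseteq> W" "J \<subseteq> W" "e \<notin> I" "e \<notin> J" "insert e I \<in> \<Gamma>" "insert e J \<in> \<Gamma>"
    using assms(2) by (auto simp: link_def)
  moreover from this have "card (insert e I) < card (insert e J)"
    using IJ(3) assms(3) finite_subset by (metis Suc_less_eq card_insert_disjoint)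
  ultimately obtain x where "x \<in> insert e J - insert e I" "insert x (insert e I) \<in> \<Gamma>"
    using assms(1) unfolding matroid_complex_def by blast
  then show "\<exists>x\<in>J - I. insert x I \<in> link e \<Gamma>"
    using \<open>e \<notin> I\<close> by (intro bexI[of _ x]) (auto simp: link_def insert_commute)
qed

lemma augment_to_card:
  assumes \<Gamma>: "matroid_complex \<Gamma>" and "finite I" "finite J"
    and "I \<in> \<Gamma>" "J \<in> \<Gamma>" "card I \<le> card J"
  shows "\<exists>I'\<in>\<Gamma>. I \<subseteq> I' \<and> I' \<subseteq> I \<union> J \<and> card I' = card J"
  using assms(2-)
proof (induction "card J - card I" arbitrary: I)
  case 0
  then show ?case by (intro bexI[of _ I]) auto
next
  case (Suc n)
  then have "card I < card J" by linarith
  then obtain e where e: "e \<in> J - I" "insert e I \<in> \<Gamma>"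
    using \<Gamma> Suc.prems unfolding matroid_complex_def by blast
  then have "card (insert e I) = Suc (card I)"
    using Suc.prems by simp
  then have "\<exists>I'\<in>\<Gamma>. insert e I \<subseteq> I' \<and> I' \<subseteq> insert e I \<union> J \<and> card I' = card J"
    using e Suc.prems Suc.hyps(2) \<open>card I < card J\<close> by (intro Suc.hyps(1)) auto
  then show ?case
    using e(1) by (elim bexE, intro bexI) auto
qed

text \<open>For a cone point the contraction evaluates \<open>f\<close> on faces only, so the
  homotopy of \<open>cob_insert\<close> exists inside \<open>\<Gamma>\<close>.\<close>

lemma cone_exact_at:
  assumes s: "sign_system W s" and fin: "finite W" and \<Gamma>: "\<Gamma> \<subseteq> Pow W" "simplicial_complex \<Gamma>"
    and c: "c \<in> W" "cone_point \<Gamma> c"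
  shows "exact_at s \<Gamma> j"
proof (rule exact_atI)
  fix f assume f: "\<And>\<tau>. \<tau> \<in> \<Gamma> \<Longrightarrow> card \<tau> = Suc j \<Longrightarrow> cob s f \<tau> = 0"
  \<comment> \<open>The value \<open>0\<close> at faces through \<open>c\<close> makes
    \<open>contract s c g\<close> vanish, which settles those faces; the others use the cocycle
    condition at \<open>insert c \<tau>\<close>.\<close>
  define g where "g \<tau> = (if c \<in> \<tau> then 0 else contract s c f \<tau>)" for \<tau>
  have "f \<tau> = cob s g \<tau>" if \<tau>: "\<tau> \<in> \<Gamma>" "card \<tau> = j" for \<tau>
  proof -
    have sub: "\<tau> \<subseteq> W" and [simp]: "finite \<tau>"
      using \<tau>(1) \<Gamma>(1) finite_subset[OF _ fin] by blast+
    show ?thesis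
    proof (cases "c \<in> \<tau>")
      case False
      have "insert c \<tau> \<in> \<Gamma>"
        using c(2) \<tau>(1) unfolding cone_point_def by blast
      then have "cob s f (insert c \<tau>) = 0"
        using f \<tau>(2) False by simp
      then have "f \<tau> = cob s (contract s c f) \<tau>"
        using cob_insert[OF s fin sub c(1) False, of f] by simp
      also have "\<dots> = cob s g \<tau>"
        using False by (intro cob_cong) (auto simp: g_def)
      finally show ?thesis .
    next
      case True
      let ?\<rho> = "\<tau> - {c}"
      have ins: "insert c ?\<rho> = \<tau>" and \<rho>: "?\<rho> \<subseteq> W" using True sub by auto
      have "s c ?\<rho> * cob s g \<tau> = g ?\<rho> - cob s (contract s c g) ?\<rho>"
        using cob_insert[OF s fin, of ?\<rho> c g] sub c(1) ins by auto
      also have "cob s (contract s c g) ?\<rho> = 0"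
        by (intro cob_zero) (simp add: contract_def g_def)
      also have "g ?\<rho> = s c ?\<rho> * f \<tau>"
        using ins by (simp add: g_def contract_def)
      finally have "s c ?\<rho> * cob s g \<tau> = s c ?\<rho> * f \<tau>"
        by simp
      then show ?thesis
        using sign_cancel[OF s \<rho> c(1)] by metis
    qed
  qed
  then show "\<exists>g. \<forall>\<tau>\<in>\<Gamma>. card \<tau> = j \<longrightarrow> f \<tau> = cob s g \<tau>"
    by blast
qed

text \<open>This is the long exact sequence of deletion and link at a non-loop \<open>e\<close>,
  carried out on cochains. The link enters one degree lower and its faces are one smaller, so the
  bound \<open>j < card B\<close> survives there.\<close>

lemma matroid_exact_at:
  assumes "sign_system W s" "finite W" "\<Gamma> \<subseteq> Pow W" "matroid_complex \<Gamma>" "B \<in> \<Gamma>" "j < card B"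
  shows "exact_at s \<Gamma> j"
  using assms
proof (induction "card W" arbitrary: W \<Gamma> B j rule: less_induct)
  case less
  note s = less.prems(1) and fin = less.prems(2) and \<Gamma> = less.prems(3,4)
  have sc: "simplicial_complex \<Gamma>"
    using \<Gamma>(2) by (simp add: matroid_complex_def)
  obtain e where "e \<in> B"
    using less.prems(6) by (cases "B = {}") auto
  then have e: "e \<in> W" "{e} \<in> \<Gamma>"
    using \<Gamma>(1) less.prems(5) simplicial_complexD[OF sc less.prems(5), of "{e}"] by auto
  have finB: "finite \<tau>" if "\<tau> \<in> \<Gamma>" for \<tau>
    by (rule finite_subset[OF _ fin]) (use that \<Gamma>(1) in auto)
  show ?case
  proof (cases "cone_point \<Gamma> e")
    case True
    then show ?thesis
      by (rule cone_exact_at[OF s fin \<Gamma>(1) sc e(1)])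
  next
    case False
    let ?V = "W - {e}" and ?D = "deletion e \<Gamma>" and ?K = "link e \<Gamma>"
    have D: "?D \<subseteq> Pow ?V"
      using \<Gamma>(1) by (auto simp: deletion_def)
    have V: "card ?V < card W" "sign_system ?V s" "finite ?V" "?D \<subseteq> Pow ?V" "?K \<subseteq> Pow ?V"
      using card_Diff1_less[OF fin e(1)] sign_system_subset[OF s, of ?V] fin D
        subset_trans[OF link_subset_deletion[OF sc] D] by simp_all
    obtain \<tau> where \<tau>: "\<tau> \<in> \<Gamma>" "insert e \<tau> \<notin> \<Gamma>"
      using False by (auto simp: cone_point_def)
    \<comment> \<open>\<open>e\<close> cannot be added to \<open>\<tau>\<close>, so every face
      containing \<open>\<tau>\<close> avoids \<open>e\<close>: the deletion keeps a face with more
      than \<open>j\<close> elements.\<close>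
    have "\<exists>B'. B' \<in> ?D \<and> j < card B'"
    proof (cases "card \<tau> \<le> card B")
      case True
      then obtain B' where B': "B' \<in> \<Gamma>" "\<tau> \<subseteq> B'" "card B' = card B"
        using augment_to_card[OF \<Gamma>(2) finB[OF \<tau>(1)] finB[OF less.prems(5)] \<tau>(1) less.prems(5)] by blast
      have "e \<notin> B'"
        using simplicial_complexD[OF sc B'(1), of "insert e \<tau>"] B'(2) \<tau>(2) by auto
      then show ?thesis
        using B' less.prems(6) by (auto simp: deletion_def)
    next
      case False
      moreover have "e \<notin> \<tau>" using \<tau> by (metis insert_absorb)
      ultimately show ?thesis
        using \<tau>(1) less.prems(6) by (intro exI[of _ \<tau>]) (auto simp: deletion_def)
    qed
    then obtain B' where B': "B' \<in> ?D" "j < card B'"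
      by blast
    have exD: "exact_at s ?D j"
      by (rule less.hyps[OF V(1-4) matroid_deletion[OF \<Gamma>(2)] B'])
    show ?thesis
    proof (rule exact_atI)
      fix f assume f: "\<And>\<tau>. \<tau> \<in> \<Gamma> \<Longrightarrow> card \<tau> = Suc j \<Longrightarrow> cob s f \<tau> = 0"
      obtain g where g: "\<And>\<tau>. \<tau> \<in> ?D \<Longrightarrow> card \<tau> = j \<Longrightarrow> f \<tau> = cob s g \<tau>"
        using exact_atD[OF exD, of f] f by (auto simp: deletion_def)
      show "\<exists>g. \<forall>\<tau>\<in>\<Gamma>. card \<tau> = j \<longrightarrow> f \<tau> = cob s g \<tau>"
      proof (cases j)
        case 0
        have "\<tau> \<in> ?D" if "\<tau> \<in> \<Gamma>" "card \<tau> = 0" for \<tau>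
          using that finB[of \<tau>] by (auto simp: deletion_def)
        then show ?thesis using g 0 by blast
      next
        case (Suc i)
        obtain B' where B': "B' \<in> \<Gamma>" "{e} \<subseteq> B'" "card B' = card B"
          using augment_to_card[OF \<Gamma>(2) _ finB[OF less.prems(5)] e(2) less.prems(5)] less.prems(6) by auto
        have K: "B' - {e} \<in> ?K" "i < card (B' - {e})"
          using B' less.prems(6) Suc finB[OF B'(1)] by (simp_all add: link_def insert_absorb)
        have exK: "exact_at s ?K i"
          by (rule less.hyps[OF V(1-3,5) matroid_link[OF \<Gamma>(2,1) fin e(2)] K])
        \<comment> \<open>\<open>?u\<close> vanishes on the faces of size \<open>j\<close> that
          avoid \<open>e\<close>; what is left of it is its contraction, a cocycle on the
          link.\<close>
        let ?u = "\<lambda>\<tau>. f \<tau> - cob s g \<tau>"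
        have kK: "e \<notin> \<rho>" "insert e \<rho> \<in> \<Gamma>" "\<rho> \<subseteq> W" "\<rho> \<in> ?D" "finite \<rho>" if "\<rho> \<in> ?K" for \<rho>
        proof -
          show *: "e \<notin> \<rho>" "insert e \<rho> \<in> \<Gamma>"
            using that by (simp_all add: link_def)
          show "\<rho> \<in> ?D"
            using that link_subset_deletion[OF sc] by blast
          show "\<rho> \<subseteq> W" "finite \<rho>"
            using * \<Gamma>(1) finB[OF *(2)] by auto
        qed
        have "cob s (contract s e ?u) \<rho> = 0" if \<rho>: "\<rho> \<in> ?K" "card \<rho> = Suc i" for \<rho>
        proof -
          have "card (insert e \<rho>) = Suc j"
            using kK[OF \<rho>(1)] \<rho>(2) Suc by simp
          then have "cob s ?u (insert e \<rho>) = 0"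
            using f kK[OF \<rho>(1)] e(1) cob_cob[OF s fin] by (simp add: cob_diff)
          moreover have "?u \<rho> = 0"
            using g kK[OF \<rho>(1)] \<rho>(2) Suc by simp
          ultimately show ?thesis
            using cob_insert[OF s fin _ e(1), of \<rho> ?u] kK[OF \<rho>(1)] by simp
        qed
        then obtain h where h: "\<And>\<rho>. \<rho> \<in> ?K \<Longrightarrow> card \<rho> = i \<Longrightarrow> contract s e ?u \<rho> = cob s h \<rho>"
          using exact_atD[OF exK, of "contract s e ?u"] by blast
        \<comment> \<open>Extends \<open>h\<close> to the faces through \<open>e\<close>. The minus
          sign compensates the one before the contraction in \<open>cob_insert\<close>.\<close>
        define h' where "h' \<tau> = (if e \<in> \<tau> then - s e (\<tau> - {e}) * h (\<tau> - {e}) else 0)" for \<tau>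
        have "f \<tau> = cob s (\<lambda>\<tau>. g \<tau> + h' \<tau>) \<tau>" if \<tau>: "\<tau> \<in> \<Gamma>" "card \<tau> = j" for \<tau>
        proof (cases "e \<in> \<tau>")
          case False
          then have "cob s h' \<tau> = 0"
            by (intro cob_zero) (simp add: h'_def)
          then show ?thesis
            using g[of \<tau>] \<tau> False by (simp add: cob_add deletion_def)
        next
          case True
          let ?\<rho> = "\<tau> - {e}"
          have \<rho>: "?\<rho> \<in> ?K" "card ?\<rho> = i" "insert e ?\<rho> = \<tau>" "e \<notin> ?\<rho>"
            using True \<tau> Suc finB by (auto simp: link_def insert_absorb)
          have ss: "s e \<sigma> * s e \<sigma> = 1" if "\<sigma> \<subseteq> W" for \<sigma>
            using sign_square[OF s that e(1)] .
          have \<rho>W: "?\<rho> \<subseteq> W" using kK[OF \<rho>(1)] by blast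
          have "s e ?\<rho> * cob s h' \<tau> = h' ?\<rho> - cob s (contract s e h') ?\<rho>"
            using cob_insert[OF s fin \<rho>W e(1) \<rho>(4), of h'] \<rho>(3) by simp
          also have "cob s (contract s e h') ?\<rho> = cob s (\<lambda>\<sigma>. - h \<sigma>) ?\<rho>"
          proof (rule cob_cong)
            fix x assume "x \<in> ?\<rho>"
            have "s e (?\<rho> - {x}) * s e (?\<rho> - {x}) = 1"
              using ss \<rho>W by blast
            then show "contract s e h' (?\<rho> - {x}) = - h (?\<rho> - {x})"
              by (simp add: contract_def h'_def insert_Diff_if mult.assoc[symmetric])
          qed
          also have "h' ?\<rho> - cob s (\<lambda>\<sigma>. - h \<sigma>) ?\<rho> = contract s e ?u ?\<rho>"
            using h[OF \<rho>(1,2)] by (simp add: h'_def cob_uminus)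
          also have "\<dots> = s e ?\<rho> * ?u \<tau>"
            using \<rho>(3) by (simp add: contract_def)
          finally have "cob s h' \<tau> = ?u \<tau>"
            using sign_cancel[OF s \<rho>W e(1)] by blast
          then show ?thesis
            by (simp add: cob_add)
        qed
        then show ?thesis by blast
      qed
    qed
  qed
qed

text \<open>If the deletion has no cone point, a top cochain on it that is no coboundary is none on
  \<open>\<Gamma>\<close> either. If it has one, the deletion is acyclic, so exactness of
  \<open>\<Gamma>\<close> at the top would pass to the link, which has no cone point.\<close>

lemma matroid_not_exact_at_top:
  assumes "sign_system W s" "finite W" "\<Gamma> \<subseteq> Pow W" "matroid_complex \<Gamma>"
    and "\<And>B. B \<in> \<Gamma> \<Longrightarrow> card B \<le> r" "\<And>c. c \<in> W \<Longrightarrow> \<not> cone_point \<Gamma> c" "B \<in> \<Gamma>" "card B = r"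
  shows "\<not> exact_at s \<Gamma> r"
  using assms
proof (induction "card W" arbitrary: W \<Gamma> B r rule: less_induct)
  case less
  note s = less.prems(1) and fin = less.prems(2) and \<Gamma> = less.prems(3,4)
    and bound = less.prems(5) and no_cone = less.prems(6) and B = less.prems(7,8)
  have sc: "simplicial_complex \<Gamma>"
    using \<Gamma>(2) by (simp add: matroid_complex_def)
  have finB: "finite \<tau>" if "\<tau> \<in> \<Gamma>" for \<tau>
    by (rule finite_subset[OF _ fin]) (use that \<Gamma>(1) in auto)
  show ?case
  proof (cases r)
    case 0
    have "{} \<in> \<Gamma>" using \<Gamma>(2) by (simp add: matroid_complex_def)
    show ?thesis
    proof
      assume ex: "exact_at s \<Gamma> r"
      \<comment> \<open>In rank \<open>0\<close> the constant cochain \<open>1\<close> is the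
        witness: at the empty face every coboundary is \<open>0\<close>.\<close>
      have "\<tau> \<in> \<Gamma> \<Longrightarrow> card \<tau> = Suc r \<Longrightarrow> cob s (\<lambda>_. 1) \<tau> = 0" for \<tau>
        using bound[of \<tau>] by simp
      then obtain g where g: "\<And>\<tau>. \<tau> \<in> \<Gamma> \<Longrightarrow> card \<tau> = r \<Longrightarrow> 1 = cob s g \<tau>"
        using exact_atD[OF ex] by blast
      show False
        using g[OF \<open>{} \<in> \<Gamma>\<close>] 0 by simp
    qed
  next
    case (Suc i)
    then obtain e where "e \<in> B"
      using B(2) by (cases "B = {}") auto
    then have e: "e \<in> W" "{e} \<in> \<Gamma>"
      using \<Gamma>(1) B(1) simplicial_complexD[OF sc B(1), of "{e}"] by auto
    let ?V = "W - {e}" and ?D = "deletion e \<Gamma>" and ?K = "link e \<Gamma>"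
    have D: "?D \<subseteq> Pow ?V"
      using \<Gamma>(1) by (auto simp: deletion_def)
    have V: "card ?V < card W" "sign_system ?V s" "finite ?V" "?D \<subseteq> Pow ?V" "?K \<subseteq> Pow ?V"
      using card_Diff1_less[OF fin e(1)] sign_system_subset[OF s, of ?V] fin D
        subset_trans[OF link_subset_deletion[OF sc] D] by simp_all
    \<comment> \<open>Some face cannot be extended by \<open>c\<close>; a face of size
      \<open>r\<close> above it avoids \<open>c\<close>.\<close>
    have avoid: "\<exists>B'\<in>\<Gamma>. card B' = r \<and> c \<notin> B'" if c: "c \<in> W" for c
    proof -
      obtain \<tau> where \<tau>: "\<tau> \<in> \<Gamma>" "insert c \<tau> \<notin> \<Gamma>"
        using no_cone[OF c] by (auto simp: cone_point_def)
      then obtain B' where B': "B' \<in> \<Gamma>" "\<tau> \<subseteq> B'" "card B' = card B"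
        using augment_to_card[OF \<Gamma>(2) finB[OF \<tau>(1)] finB[OF B(1)] \<tau>(1) B(1)] bound[OF \<tau>(1)] B(2) by blast
      have "c \<notin> B'"
        using simplicial_complexD[OF sc B'(1), of "insert c \<tau>"] B'(2) \<tau>(2) by auto
      then show ?thesis using B' B(2) by auto
    qed
    obtain B' where B': "B' \<in> ?D" "card B' = r"
      using avoid[OF e(1)] by (auto simp: deletion_def)
    have boundD: "card \<tau> \<le> r" if "\<tau> \<in> ?D" for \<tau>
      using bound that by (simp add: deletion_def)
    show ?thesis
    proof
      assume ex: "exact_at s \<Gamma> r"
      have top: "\<exists>g. \<forall>\<tau>\<in>\<Gamma>. card \<tau> = r \<longrightarrow> f \<tau> = cob s g \<tau>" for f
      proof -
        have "cob s f \<tau> = 0" if "\<tau> \<in> \<Gamma>" "card \<tau> = Suc r" for \<tau>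
          using bound that by force
        then show ?thesis
          using exact_atD[OF ex] by metis
      qed
      show False
      proof (cases "\<exists>c\<in>?V. cone_point ?D c")
        case False
        have "exact_at s ?D r"
        proof (rule exact_atI)
          fix f
          show "\<exists>g. \<forall>\<tau>\<in>?D. card \<tau> = r \<longrightarrow> f \<tau> = cob s g \<tau>"
            using top[of f] by (auto simp: deletion_def)
        qed
        moreover have "\<not> exact_at s ?D r"
          by (rule less.hyps[OF V(1-4) matroid_deletion[OF \<Gamma>(2)] boundD _ B']) (use False in auto)
        ultimately show False by blast
      next
        case True
        then have exD: "exact_at s ?D i"
          using cone_exact_at[OF V(2-4) simplicial_deletion[OF sc]] by blast
        have kK: "e \<notin> \<rho>" "insert e \<rho> \<in> \<Gamma>" "\<rho> \<subseteq> W" "\<rho> \<in> ?D" "finite \<rho>" if "\<rho> \<in> ?K" for \<rho>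
        proof -
          show *: "e \<notin> \<rho>" "insert e \<rho> \<in> \<Gamma>"
            using that by (simp_all add: link_def)
          show "\<rho> \<in> ?D"
            using that link_subset_deletion[OF sc] by blast
          show "\<rho> \<subseteq> W" "finite \<rho>"
            using * \<Gamma>(1) finB[OF *(2)] by auto
        qed
        have boundK: "card \<rho> \<le> i" if "\<rho> \<in> ?K" for \<rho>
          using bound[OF kK(2)[OF that]] kK[OF that] Suc by simp
        have avoidK: "\<not> cone_point ?K c" if c: "c \<in> ?V" for c
        proof
          assume cone: "cone_point ?K c"
          obtain B'' where B'': "B'' \<in> \<Gamma>" "card B'' = r" "c \<notin> B''"
            using avoid c by blast
          \<comment> \<open>Exchanging \<open>e\<close> into a top face that avoids \<open>c\<close>
            gives a top face through \<open>e\<close> that still avoids \<open>c\<close>.\<close>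
          obtain A where A: "A \<in> \<Gamma>" "{e} \<subseteq> A" "A \<subseteq> {e} \<union> B''" "card A = card B''"
            using augment_to_card[OF \<Gamma>(2) _ finB[OF B''(1)] e(2) B''(1)] B''(2) Suc by auto
          have "A - {e} \<in> ?K"
            using A by (simp add: link_def insert_absorb)
          then have "insert c (A - {e}) \<in> ?K"
            using cone by (simp add: cone_point_def)
          moreover have "card (insert c (A - {e})) = Suc i"
            using A B'' c Suc finB[OF A(1)] by (subst card_insert_disjoint) auto
          ultimately show False
            using boundK by force
        qed
        have K: "B - {e} \<in> ?K" "card (B - {e}) = i"
          using B \<open>e \<in> B\<close> Suc by (simp_all add: link_def insert_absorb)
        have "\<not> exact_at s ?K i"
          by (rule less.hyps[OF V(1-3,5) matroid_link[OF \<Gamma>(2,1) fin e(2)] boundK avoidK K])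
        moreover have "exact_at s ?K i"
        proof (rule exact_atI)
          fix f
          \<comment> \<open>The cochain \<open>f\<close> of the link is moved to the faces through
            \<open>e\<close> and set to \<open>0\<close> on the others, so that \<open>g\<close>
            restricts to a cocycle of the deletion.\<close>
          obtain g where g: "\<forall>\<tau>\<in>\<Gamma>. card \<tau> = r \<longrightarrow>
              (if e \<in> \<tau> then s e (\<tau> - {e}) * f (\<tau> - {e}) else 0) = cob s g \<tau>"
            using top[of "\<lambda>\<tau>. if e \<in> \<tau> then s e (\<tau> - {e}) * f (\<tau> - {e}) else 0"] by blast
          have "cob s g \<tau> = 0" if "\<tau> \<in> ?D" "card \<tau> = Suc i" for \<tau>
            using g that Suc by (fastforce simp: deletion_def)
          then obtain h where h: "\<And>\<tau>. \<tau> \<in> ?D \<Longrightarrow> card \<tau> = i \<Longrightarrow> g \<tau> = cob s h \<tau>"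
            using exact_atD[OF exD, of g] by blast
          have "f \<rho> = cob s (\<lambda>\<tau>. h \<tau> - contract s e g \<tau>) \<rho>" if \<rho>: "\<rho> \<in> ?K" "card \<rho> = i" for \<rho>
          proof -
            have "insert e \<rho> - {e} = \<rho>" using kK[OF \<rho>(1)] by auto
            then have "s e \<rho> * f \<rho> = cob s g (insert e \<rho>)"
              using g kK[OF \<rho>(1)] \<rho>(2) Suc by (auto dest: bspec[of _ _ "insert e \<rho>"])
            then have "s e \<rho> * s e \<rho> * f \<rho> = s e \<rho> * cob s g (insert e \<rho>)"
              by (simp add: mult.assoc)
            also have "\<dots> = g \<rho> - cob s (contract s e g) \<rho>"
              using cob_insert[OF s fin _ e(1)] kK[OF \<rho>(1)] by blast
            also have "\<dots> = cob s h \<rho> - cob s (contract s e g) \<rho>"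
              using h kK[OF \<rho>(1)] \<rho>(2) by simp
            moreover have "s e \<rho> * s e \<rho> = 1"
              using sign_square[OF s _ e(1)] kK[OF \<rho>(1)] by blast
            ultimately show ?thesis
              by (simp add: cob_diff)
          qed
          then show "\<exists>g. \<forall>\<tau>\<in>?K. card \<tau> = i \<longrightarrow> f \<tau> = cob s g \<tau>"
            by blast
        qed
        ultimately show False by blast
      qed
    qed
  qed
qed

lemma card_Compl_add: "card (- A) + card A = CARD('e)" for A :: "'e::finite set"
  using card_Un_disjoint[of "- A" A] by simp

subsection \<open>Coefficients of polynomials\<close>

abbreviation lkp :: "('a \<Rightarrow>\<^sub>0 'b::zero) \<Rightarrow> 'a \<Rightarrow> 'b" where
  "lkp \<equiv> Poly_Mapping.lookup"

abbreviation supp :: "('a \<Rightarrow>\<^sub>0 'b::zero) \<Rightarrow> 'a set" where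
  "supp \<equiv> Poly_Mapping.keys"

definition ind :: "'e::finite set \<Rightarrow> 'e \<Rightarrow>\<^sub>0 nat" where
  "ind A = Poly_Mapping.Abs_poly_mapping (\<lambda>e. of_bool (e \<in> A))"

lemma lookup_ind [simp]: "lkp (ind A) e = of_bool (e \<in> A)"
  by (simp add: ind_def)

lemma keys_ind [simp]: "supp (ind A) = A"
  by (auto simp: in_keys_iff)

lemma keys_add_nat: "supp (t + u :: 'e \<Rightarrow>\<^sub>0 nat) = supp t \<union> supp u"
  by (auto simp: in_keys_iff lookup_add)

lemma mdegree_UNIV: "mdegree (t :: 'e::finite \<Rightarrow>\<^sub>0 nat) = (\<Sum>e\<in>UNIV. lkp t e)"
  unfolding mdegree_def by (rule sum.mono_neutral_left) (auto simp: in_keys_iff)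

lemma mdegree_add: "mdegree (t + u :: 'e::finite \<Rightarrow>\<^sub>0 nat) = mdegree t + mdegree u"
  by (simp add: mdegree_UNIV lookup_add sum.distrib)

lemma mdegree_ind [simp]: "mdegree (ind A) = card A"
  by (simp add: mdegree_def)

text \<open>Lets a polynomial be defined by its coefficient function as soon as the degree is
  bounded.\<close>

lemma finite_mdegree: "finite {t :: 'e::finite \<Rightarrow>\<^sub>0 nat. mdegree t \<le> n}"
proof (rule finite_imageD)
  have "lkp ` {t :: 'e \<Rightarrow>\<^sub>0 nat. mdegree t \<le> n} \<subseteq> (\<Pi>\<^sub>E e\<in>UNIV. {..n})"
  proof
    fix f assume "f \<in> lkp ` {t :: 'e \<Rightarrow>\<^sub>0 nat. mdegree t \<le> n}"
    then obtain t :: "'e \<Rightarrow>\<^sub>0 nat" where t: "f = lkp t" "mdegree t \<le> n" by auto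
    have "lkp t e \<le> mdegree t" for e
      unfolding mdegree_UNIV by (rule member_le_sum) auto
    then show "f \<in> (\<Pi>\<^sub>E e\<in>UNIV. {..n})"
      using t by (auto intro: order_trans)
  qed
  then show "finite (lkp ` {t :: 'e \<Rightarrow>\<^sub>0 nat. mdegree t \<le> n})"
    by (rule finite_subset) (auto intro: finite_PiE)
  show "inj_on lkp {t :: 'e \<Rightarrow>\<^sub>0 nat. mdegree t \<le> n}"
    by (auto simp: inj_on_def)
qed

lemma lookup_Abs_bounded:
  assumes "\<And>t. f t \<noteq> 0 \<Longrightarrow> mdegree t \<le> n"
  shows "lkp (Poly_Mapping.Abs_poly_mapping f :: ('e::finite, 'k::field) mvpoly) = f"
  by (rule lookup_Abs_poly_mapping, rule finite_subset[OF _ finite_mdegree[of n]]) (use assms in auto)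

lemma lookup_single_mult:
  fixes p :: "('e::finite, 'k::field) mvpoly"
  shows "lkp (Poly_Mapping.single u c * p) t = (if \<forall>e. lkp u e \<le> lkp t e then c * lkp p (t - u) else 0)"
proof -
  have "lkp (Poly_Mapping.single u c * p) t = (\<Sum>l. (c * (\<Sum>q. lkp p q when t = u + q)) when l = u)"
    unfolding lookup_mult by (rule arg_cong[of _ _ Sum_any]) (auto simp: lookup_single when_def)
  also have "\<dots> = c * (\<Sum>q. lkp p q when t = u + q)"
    by simp
  also have "(\<Sum>q. lkp p q when t = u + q) = (if \<forall>e. lkp u e \<le> lkp t e then lkp p (t - u) else 0)"
  proof (cases "\<forall>e. lkp u e \<le> lkp t e")
    case True
    then have "t = u + q \<longleftrightarrow> q = t - u" for q
      by (auto simp: poly_mapping_eq_iff fun_eq_iff lookup_add lookup_minus)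
    then show ?thesis using True by simp
  next
    case False
    then have "t \<noteq> u + q" for q
      by (auto simp: lookup_add)
    then show ?thesis
      by (simp add: if_not_P[OF False])
  qed
  finally show ?thesis by simp
qed

lemma lookup_mvar_mult:
  fixes p :: "('e::finite, 'k::field) mvpoly"
  shows "lkp (mvar e * p) t = (if e \<in> supp t then lkp p (t - ind {e}) else 0)"
proof -
  have "Poly_Mapping.single e 1 = ind {e}"
    by (rule poly_mapping_eqI) (auto simp: lookup_single when_def)
  moreover have "(\<forall>x. lkp (ind {e}) x \<le> lkp t x) \<longleftrightarrow> e \<in> supp t"
    by (auto simp: in_keys_iff Suc_le_eq split: if_splits)
  ultimately show ?thesis
    by (simp add: mvar_def lookup_single_mult)
qed

definition restrict_monomials :: "(('e \<Rightarrow>\<^sub>0 nat) \<Rightarrow> bool) \<Rightarrow> ('e, 'k::field) mvpoly \<Rightarrow> ('e, 'k) mvpoly" where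
  "restrict_monomials Q p = Poly_Mapping.Abs_poly_mapping (\<lambda>t. if Q t then lkp p t else 0)"

lemma lookup_restrict: "lkp (restrict_monomials Q p) t = (if Q t then lkp p t else 0)"
proof -
  have "finite {t. (if Q t then lkp p t else 0) \<noteq> 0}"
    by (rule finite_subset[OF _ finite_lookup[of p]]) auto
  then show ?thesis
    by (simp add: restrict_monomials_def)
qed

lemma restrict_True [simp]: "restrict_monomials (\<lambda>_. True) p = p"
  by (rule poly_mapping_eqI) (simp add: lookup_restrict)

lemma restrict_id: "(\<And>t. t \<in> supp p \<Longrightarrow> Q t) \<Longrightarrow> restrict_monomials Q p = p"
  by (rule poly_mapping_eqI) (auto simp: lookup_restrict in_keys_iff)

lemma restrict_null: "(\<And>t. t \<in> supp p \<Longrightarrow> \<not> Q t) \<Longrightarrow> restrict_monomials Q p = 0"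
  by (rule poly_mapping_eqI) (auto simp: lookup_restrict in_keys_iff)

lemma restrict_zero [simp]: "restrict_monomials Q 0 = 0"
  by (rule restrict_null) simp

lemma restrict_add: "restrict_monomials Q (p + q) = restrict_monomials Q p + restrict_monomials Q q"
  by (rule poly_mapping_eqI) (simp add: lookup_restrict lookup_add)

lemma restrict_diff: "restrict_monomials Q (p - q) = restrict_monomials Q p - restrict_monomials Q q"
  by (rule poly_mapping_eqI) (simp add: lookup_restrict lookup_minus)

lemma restrict_sum: "restrict_monomials Q (\<Sum>i\<in>A. p i) = (\<Sum>i\<in>A. restrict_monomials Q (p i))"
  by (rule poly_mapping_eqI) (simp add: lookup_restrict lookup_sum)

text \<open>Intended for homogeneous \<open>p\<close>: taking the part of one degree commutes with
  multiplication by \<open>p\<close>, up to a shift recorded by \<open>Q'\<close>.\<close>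

lemma restrict_mult:
  assumes "\<And>t t'. t \<in> supp p \<Longrightarrow> Q (t + t') \<longleftrightarrow> Q' t'"
  shows "restrict_monomials Q (p * q) = p * restrict_monomials Q' q"
proof -
  let ?r = "restrict_monomials Q' q" and ?n = "restrict_monomials (\<lambda>t. \<not> Q' t) q"
  have q: "q = ?r + ?n"
    by (rule poly_mapping_eqI) (simp add: lookup_restrict lookup_add)
  have "restrict_monomials Q (p * ?r) = p * ?r"
  proof (rule restrict_id)
    fix t assume "t \<in> supp (p * ?r)"
    then obtain a b where "t = a + b" "a \<in> supp p" "b \<in> supp ?r"
      using keys_mult by blast
    then show "Q t"
      using assms by (simp add: in_keys_iff lookup_restrict split: if_splits)
  qed
  moreover have "restrict_monomials Q (p * ?n) = 0"
  proof (rule restrict_null)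
    fix t assume "t \<in> supp (p * ?n)"
    then obtain a b where "t = a + b" "a \<in> supp p" "b \<in> supp ?n"
      using keys_mult by blast
    then show "\<not> Q t"
      using assms by (simp add: in_keys_iff lookup_restrict split: if_splits)
  qed
  ultimately show ?thesis
    by (subst q) (simp add: distrib_left restrict_add)
qed

lemma restrict_eq_0_iff: "restrict_monomials Q p = 0 \<longleftrightarrow> (\<forall>t\<in>supp p. \<not> Q t)"
proof
  assume "restrict_monomials Q p = 0"
  then show "\<forall>t\<in>supp p. \<not> Q t"
    by (metis in_keys_iff lookup_restrict lookup_zero)
qed (auto intro: restrict_null)

subsection \<open>The Koszul complex\<close>

definition ksign :: "'e::finite \<Rightarrow> 'e set \<Rightarrow> 'k::comm_ring_1" where
  "ksign e T = (-1) ^ card {a \<in> T. to_nat a < to_nat e}"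

lemma ksign_sign_system: "sign_system UNIV (ksign :: 'e::finite \<Rightarrow> 'e set \<Rightarrow> 'k::comm_ring_1)"
  unfolding sign_system_def
proof (intro conjI allI ballI impI)
  fix \<tau> :: "'e set" and e
  show "ksign e \<tau> * ksign e \<tau> = (1::'k)"
    by (simp add: ksign_def)
  have "{a \<in> insert e \<tau>. to_nat a < to_nat e} = {a \<in> \<tau>. to_nat a < to_nat e}"
    by auto
  then show "ksign e (insert e \<tau>) = (ksign e \<tau> :: 'k)"
    by (simp add: ksign_def)
next
  fix \<tau> :: "'e set" and e x assume e: "e \<in> UNIV - \<tau>" and x: "x \<in> \<tau>"
  define a where "a = card {y \<in> \<tau>. to_nat y < to_nat x}"
  define b where "b = card {y \<in> \<tau> - {x}. to_nat y < to_nat e}"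
  have "to_nat e \<noteq> to_nat x"
    using e x by auto
  then consider "to_nat e < to_nat x" | "to_nat x < to_nat e"
    by linarith
  then show "ksign x (insert e \<tau>) * ksign e (\<tau> - {x}) = - (ksign x \<tau> * ksign e \<tau> :: 'k)"
  proof cases
    case 1
    then have "{y \<in> insert e \<tau>. to_nat y < to_nat x} = insert e {y \<in> \<tau>. to_nat y < to_nat x}"
      "{y \<in> \<tau>. to_nat y < to_nat e} = {y \<in> \<tau> - {x}. to_nat y < to_nat e}"
      by auto
    then show ?thesis
      using e by (simp add: ksign_def)
  next
    case 2
    then have "{y \<in> insert e \<tau>. to_nat y < to_nat x} = {y \<in> \<tau>. to_nat y < to_nat x}"
      "{y \<in> \<tau>. to_nat y < to_nat e} = insert x {y \<in> \<tau> - {x}. to_nat y < to_nat e}"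
      using x by auto
    then show ?thesis
      by (simp add: ksign_def)
  qed
qed

lemma lookup_ksign_mult: "lkp (ksign e T * p :: ('e::finite, 'k::field) mvpoly) t = ksign e T * lkp p t"
proof -
  have "lkp ((-1) ^ n * p) t = (-1) ^ n * lkp p t" for n
    by (induction n) (simp_all add: mult.assoc)
  then show ?thesis by (simp add: ksign_def)
qed

text \<open>An element assigns to \<open>T\<close> and \<open>a\<close> the coefficient of the exterior monomial on the
  complement of \<open>T\<close> in the \<open>a\<close>-th coordinate. Indexing by \<open>T\<close> turns the strands of the Koszul
  complex of a Stanley--Reisner ring into cochain complexes of simplicial complexes.
  Monomials supported on non-faces are discarded.\<close>

type_synonym ('e, 'k) kelem = "'e set \<Rightarrow> nat \<Rightarrow> ('e, 'k) mvpoly"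

definition kos :: "'e::finite set set \<Rightarrow> ('e, 'k::field) kelem \<Rightarrow> ('e, 'k) kelem" where
  "kos \<Delta> c = (\<lambda>T a. restrict_monomials (\<lambda>t. supp t \<in> \<Delta>)
     (\<Sum>e\<in>T. ksign e T * (mvar e * c (T - {e}) a)))"

text \<open>The part of internal degree \<open>s\<close> of the Koszul module of index
  \<open>p\<close>, tensored with a free module on \<open>f\<close> generators of degrees
  \<open>g\<close> over the Stanley-Reisner ring of \<open>\<Delta>\<close>; for \<open>UNIV\<close>
  that ring is the polynomial ring. Exterior generators have degree one, which accounts for the
  summand \<open>p\<close>.\<close>

definition koszul_space ::
  "'e::finite set set \<Rightarrow> nat \<Rightarrow> (nat \<Rightarrow> nat) \<Rightarrow> nat \<Rightarrow> nat \<Rightarrow> ('e, 'k::field) kelem set" where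
  "koszul_space \<Delta> f g s p = {c. \<forall>T a t. lkp (c T a) t \<noteq> 0 \<longrightarrow>
     card T + p = CARD('e) \<and> a < f \<and> g a + mdegree t + p = s \<and> supp t \<in> \<Delta>}"

lemma koszul_spaceD:
  fixes c :: "('e::finite, 'k::field) kelem"
  assumes "c \<in> koszul_space \<Delta> f g s p" "lkp (c T a) t \<noteq> 0"
  shows "card T + p = CARD('e)" "a < f" "g a + mdegree t + p = s" "supp t \<in> \<Delta>"
  using assms unfolding koszul_space_def by blast+

section \<open>Multigraded strands of the Koszul complex\<close>

definition usign :: "('e::finite \<Rightarrow>\<^sub>0 nat) \<Rightarrow> 'e \<Rightarrow> 'e set \<Rightarrow> 'k::comm_ring_1" where
  "usign u e \<tau> = ksign e (\<tau> \<union> - supp u)"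

text \<open>The multidegree \<open>u\<close> is the sum of the polynomial exponent and the exterior
  exponent \<open>ind (- T)\<close>. Variables outside \<open>supp u\<close> then lie in
  \<open>T\<close>, and \<open>\<tau>\<close> is the rest of \<open>T\<close>.\<close>

definition strand ::
  "('e::finite, 'k::field) kelem \<Rightarrow> nat \<Rightarrow> ('e \<Rightarrow>\<^sub>0 nat) \<Rightarrow> 'e set \<Rightarrow> 'k" where
  "strand c a u \<tau> = lkp (c (\<tau> \<union> - supp u) a) (u - ind (supp u - \<tau>))"

text \<open>An exterior factor takes at most one unit of each exponent, so variables of exponent at
  least 2 divide the polynomial part for every \<open>\<tau>\<close>. Each of them is a cone point,
  hence only squarefree multidegrees can carry homology.\<close>

definition strand_complex :: "'e set set \<Rightarrow> ('e::finite \<Rightarrow>\<^sub>0 nat) \<Rightarrow> 'e set set" where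
  "strand_complex \<Delta> u = {\<tau>. \<tau> \<subseteq> supp u \<and> \<tau> \<union> {e. 2 \<le> lkp u e} \<in> \<Delta>}"

lemma usign_sign_system: "sign_system (supp u) (usign u)"
  unfolding sign_system_def usign_def
proof (intro conjI allI ballI impI)
  fix \<tau> :: "'a set" and e x
  show "ksign e (\<tau> \<union> - supp u) * ksign e (\<tau> \<union> - supp u) = (1::'b)"
    by (rule sign_square[OF ksign_sign_system]) auto
  show "ksign e (insert e \<tau> \<union> - supp u) = (ksign e (\<tau> \<union> - supp u) :: 'b)"
    using sign_insert[OF ksign_sign_system, of "\<tau> \<union> - supp u" e] by simp
  assume "\<tau> \<subseteq> supp u" "e \<in> supp u - \<tau>" "x \<in> \<tau>"
  moreover from this have "\<tau> - {x} \<union> - supp u = (\<tau> \<union> - supp u) - {x}"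
    by auto
  ultimately show "ksign x (insert e \<tau> \<union> - supp u) * ksign e (\<tau> - {x} \<union> - supp u)
      = - (ksign x (\<tau> \<union> - supp u) * ksign e (\<tau> \<union> - supp u) :: 'b)"
    using sign_swap[OF ksign_sign_system, of "\<tau> \<union> - supp u" e x] by auto
qed

text \<open>Together with \<open>strand_of_indices\<close> this is the bijection between positions
  \<open>(T, t)\<close> and pairs of a multidegree \<open>u\<close> with a subset
  \<open>\<tau>\<close> of its support.\<close>

lemma strand_indices:
  fixes u :: "'e::finite \<Rightarrow>\<^sub>0 nat"
  assumes "\<tau> \<subseteq> supp u"
  defines "T \<equiv> \<tau> \<union> - supp u" and "t \<equiv> u - ind (supp u - \<tau>)"
  shows "t + ind (- T) = u" "T \<inter> supp t = \<tau>" "supp t = \<tau> \<union> {e. 2 \<le> lkp u e}"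
    "card T + card (supp u) = card \<tau> + CARD('e)"
proof -
  show "t + ind (- T) = u"
    using assms(1) by (intro poly_mapping_eqI) (auto simp: t_def T_def lookup_add lookup_minus in_keys_iff)
  show supp: "supp t = \<tau> \<union> {e. 2 \<le> lkp u e}"
    using assms(1) by (auto simp: t_def in_keys_iff lookup_minus of_bool_def split: if_splits)
  show "T \<inter> supp t = \<tau>"
    unfolding supp using assms(1) by (auto simp: T_def in_keys_iff)
  have "card T = card \<tau> + card (- supp u)"
    unfolding T_def using assms(1) by (intro card_Un_disjoint) auto
  then show "card T + card (supp u) = card \<tau> + CARD('e)"
    using card_Compl_add[of "supp u"] by simp
qed

lemma strand_of_indices:
  fixes t :: "'e::finite \<Rightarrow>\<^sub>0 nat" and T :: "'e set"
  defines "u \<equiv> t + ind (- T)" and "\<tau> \<equiv> T \<inter> supp t"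
  shows "\<tau> \<subseteq> supp u" "\<tau> \<union> - supp u = T" "u - ind (supp u - \<tau>) = t"
proof -
  have u: "supp u = supp t \<union> - T"
    by (simp add: u_def keys_add_nat)
  then show 1: "\<tau> \<subseteq> supp u" "\<tau> \<union> - supp u = T"
    by (auto simp: \<tau>_def)
  have "supp u - \<tau> = - T"
    unfolding u by (auto simp: \<tau>_def)
  then show "u - ind (supp u - \<tau>) = t"
    by (simp add: u_def)
qed

text \<open>Moving \<open>e\<close> from the exterior part into the polynomial part leaves the
  multidegree unchanged, so the Koszul differential acts on each strand separately, and there as
  \<open>cob\<close>.\<close>

lemma lookup_kos:
  fixes c :: "('e::finite, 'k::field) kelem"
  shows "lkp (kos \<Delta> c T a) t = (if supp t \<in> \<Delta>
     then cob (usign (t + ind (- T))) (strand c a (t + ind (- T))) (T \<inter> supp t) else 0)"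
proof -
  let ?u = "t + ind (- T)"
  have "lkp (\<Sum>e\<in>T. ksign e T * (mvar e * c (T - {e}) a)) t
      = (\<Sum>e\<in>T. ksign e T * (if e \<in> supp t then lkp (c (T - {e}) a) (t - ind {e}) else 0))"
    by (simp add: lookup_sum lookup_ksign_mult lookup_mvar_mult)
  also have "\<dots> = (\<Sum>e\<in>T \<inter> supp t. ksign e T * lkp (c (T - {e}) a) (t - ind {e}))"
    by (subst sum.inter_restrict) (auto intro: sum.cong)
  also have "\<dots> = cob (usign ?u) (strand c a ?u) (T \<inter> supp t)"
    unfolding cob_def
  proof (rule sum.cong)
    fix e assume e: "e \<in> T \<inter> supp t"
    have "T \<inter> supp t \<union> - supp ?u = T" "T \<inter> supp t - {e} \<union> - supp ?u = T - {e}"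
      using e by (auto simp: keys_add_nat)
    moreover have "?u - ind (supp ?u - (T \<inter> supp t - {e})) = t - ind {e}"
      using e by (intro poly_mapping_eqI) (auto simp: lookup_minus lookup_add keys_add_nat)
    ultimately show "ksign e T * lkp (c (T - {e}) a) (t - ind {e})
        = usign ?u e (T \<inter> supp t) * strand c a ?u (T \<inter> supp t - {e})"
      by (simp add: usign_def strand_def)
  qed simp
  finally show ?thesis
    by (simp add: kos_def lookup_restrict)
qed

lemma strand_kos:
  assumes "\<tau> \<in> strand_complex \<Delta> u"
  shows "strand (kos \<Delta> c) a u \<tau> = cob (usign u) (strand c a u) \<tau>"
proof -
  have "\<tau> \<subseteq> supp u" "\<tau> \<union> {e. 2 \<le> lkp u e} \<in> \<Delta>"
    using assms by (auto simp: strand_complex_def)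
  then show ?thesis
    unfolding strand_def[of "kos \<Delta> c"] lookup_kos using strand_indices[of \<tau> u] by simp
qed

lemma simplicial_strand_complex:
  assumes "simplicial_complex \<Delta>"
  shows "simplicial_complex (strand_complex \<Delta> u)" "strand_complex \<Delta> u \<subseteq> Pow (supp u)"
proof -
  show "simplicial_complex (strand_complex \<Delta> u)"
    unfolding simplicial_complex_def
  proof (intro ballI allI impI)
    fix \<tau> \<sigma> assume *: "\<tau> \<in> strand_complex \<Delta> u" "\<sigma> \<subseteq> \<tau>"
    then have "\<tau> \<union> {e. 2 \<le> lkp u e} \<in> \<Delta>" "\<sigma> \<union> {e. 2 \<le> lkp u e} \<subseteq> \<tau> \<union> {e. 2 \<le> lkp u e}"
      by (auto simp: strand_complex_def)
    then have "\<sigma> \<union> {e. 2 \<le> lkp u e} \<in> \<Delta>"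
      by (rule simplicial_complexD[OF assms])
    then show "\<sigma> \<in> strand_complex \<Delta> u"
      using * by (auto simp: strand_complex_def)
  qed
qed (auto simp: strand_complex_def)

lemma face_strand_complex:
  assumes "supp t \<in> \<Delta>"
  shows "T \<inter> supp t \<in> strand_complex \<Delta> (t + ind (- T))"
proof -
  note i = strand_of_indices[where t=t and T=T]
  have "supp t = (T \<inter> supp t) \<union> {e. 2 \<le> lkp (t + ind (- T)) e}"
    using strand_indices(3)[OF i(1)] unfolding i(3) .
  then have "(T \<inter> supp t) \<union> {e. 2 \<le> lkp (t + ind (- T)) e} \<in> \<Delta>"
    using assms by (rule subst)
  then show ?thesis
    unfolding strand_complex_def using i(1) by blast
qed

lemma kos_kos:
  fixes c :: "('e::finite, 'k::field) kelem"
  assumes "simplicial_complex \<Delta>"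
  shows "kos \<Delta> (kos \<Delta> c) = 0"
proof (intro ext poly_mapping_eqI)
  fix T a and t :: "'e \<Rightarrow>\<^sub>0 nat"
  let ?u = "t + ind (- T)" and ?\<tau> = "T \<inter> supp t"
  have "lkp (kos \<Delta> (kos \<Delta> c) T a) t = 0" if t: "supp t \<in> \<Delta>"
  proof -
    have face: "?\<tau> - {e} \<in> strand_complex \<Delta> ?u" for e
      by (rule simplicial_complexD[OF simplicial_strand_complex(1)[OF assms] face_strand_complex[OF t]]) blast
    have "cob (usign ?u) (strand (kos \<Delta> c) a ?u) ?\<tau>
        = cob (usign ?u) (cob (usign ?u) (strand c a ?u)) ?\<tau>"
      by (rule cob_cong) (rule strand_kos[OF face])
    also have "\<dots> = 0"
      by (rule cob_cob[OF usign_sign_system finite strand_of_indices(1)])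
    finally show ?thesis
      using t by (simp add: lookup_kos)
  qed
  then show "lkp (kos \<Delta> (kos \<Delta> c) T a) t = lkp ((0 :: ('e, 'k) kelem) T a) t"
    by (cases "supp t \<in> \<Delta>") (auto simp: lookup_kos)
qed

lemma mdegree_strand_index:
  fixes t :: "'e::finite \<Rightarrow>\<^sub>0 nat"
  assumes "card T + p = CARD('e)"
  shows "mdegree (t + ind (- T)) = mdegree t + p" "card (T \<inter> supp t) + p = card (supp (t + ind (- T)))"
proof -
  have c: "card (- T) = p"
    using assms card_Compl_add[of T] by simp
  then show "mdegree (t + ind (- T)) = mdegree t + p"
    by (simp add: mdegree_add)
  have "supp (t + ind (- T)) = (T \<inter> supp t) \<union> - T"
    by (auto simp: keys_add_nat)
  then show "card (T \<inter> supp t) + p = card (supp (t + ind (- T)))"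
    using c by (simp add: card_Un_disjoint)
qed

text \<open>Primitives are chosen strand by strand and reassembled. The second alternative admits
  strands that may carry homology but on which \<open>c\<close> is zero in the relevant
  degree.\<close>

lemma koszul_exact:
  fixes c :: "('e::finite, 'k::field) kelem"
  assumes \<Delta>: "simplicial_complex \<Delta>" and c: "c \<in> koszul_space \<Delta> f g s p" "kos \<Delta> c = 0"
    and exact: "\<And>u a j. a < f \<Longrightarrow> g a + mdegree u = s \<Longrightarrow> j + p = card (supp u) \<Longrightarrow>
      exact_at (usign u :: _ \<Rightarrow> _ \<Rightarrow> 'k) (strand_complex \<Delta> u) j \<or>
      (\<forall>\<tau>\<in>strand_complex \<Delta> u. card \<tau> = j \<longrightarrow> strand c a u \<tau> = 0)"
  shows "\<exists>y\<in>koszul_space \<Delta> f g s (Suc p). c = kos \<Delta> y"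
proof -
  have "\<exists>h. a < f \<longrightarrow> g a + mdegree u = s \<longrightarrow>
      (\<forall>\<tau>\<in>strand_complex \<Delta> u. card \<tau> + p = card (supp u) \<longrightarrow> strand c a u \<tau> = cob (usign u) h \<tau>)" for a u
  proof (cases "a < f \<and> g a + mdegree u = s \<and> p \<le> card (supp u)")
    case True
    let ?j = "card (supp u) - p"
    show ?thesis
    proof (cases "\<forall>\<tau>\<in>strand_complex \<Delta> u. card \<tau> = ?j \<longrightarrow> strand c a u \<tau> = 0")
      case True
      then show ?thesis
        by (intro exI[of _ "\<lambda>_. 0"]) (auto simp: cob_def)
    next
      case False
      then have ex: "exact_at (usign u :: _ \<Rightarrow> _ \<Rightarrow> 'k) (strand_complex \<Delta> u) ?j"
        using exact[of a u ?j] True by auto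
      have "cob (usign u) (strand c a u) \<tau> = 0" if "\<tau> \<in> strand_complex \<Delta> u" for \<tau>
        using strand_kos[OF that, of c a] c(2) by (simp add: strand_def)
      then obtain h where "\<And>\<tau>. \<tau> \<in> strand_complex \<Delta> u \<Longrightarrow> card \<tau> = ?j \<Longrightarrow> strand c a u \<tau> = cob (usign u) h \<tau>"
        using exact_atD[OF ex, of "strand c a u"] by blast
      then show ?thesis
        by (intro exI[of _ h]) auto
    qed
  next
    case False
    then show ?thesis by auto
  qed
  then obtain h where h: "\<And>a u \<tau>. a < f \<Longrightarrow> g a + mdegree u = s \<Longrightarrow> \<tau> \<in> strand_complex \<Delta> u \<Longrightarrow>
      card \<tau> + p = card (supp u) \<Longrightarrow> strand c a u \<tau> = cob (usign u) (h a u) \<tau>"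
    by metis
  \<comment> \<open>The conditions confine \<open>h\<close> to the required degrees. They also bound
    \<open>mdegree t\<close> by \<open>s\<close>, which gives the coefficients finite
    support.\<close>
  define Y where "Y T a t = (if card T + Suc p = CARD('e) \<and> a < f \<and> g a + mdegree t + Suc p = s \<and> supp t \<in> \<Delta>
      then h a (t + ind (- T)) (T \<inter> supp t) else 0)" for T a t
  define y :: "('e, 'k) kelem" where "y T a = Poly_Mapping.Abs_poly_mapping (Y T a)" for T a
  have y: "lkp (y T a) t = Y T a t" for T a t
    unfolding y_def by (subst lookup_Abs_bounded[of _ s]) (auto simp: Y_def split: if_splits)
  have "y \<in> koszul_space \<Delta> f g s (Suc p)"
    by (auto simp: koszul_space_def y Y_def split: if_splits)
  moreover have "c = kos \<Delta> y"
  proof (intro ext poly_mapping_eqI)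
    fix T a and t :: "'e \<Rightarrow>\<^sub>0 nat"
    let ?u = "t + ind (- T)" and ?\<tau> = "T \<inter> supp t"
    note idx = strand_of_indices[where t=t and T=T]
    show "lkp (c T a) t = lkp (kos \<Delta> y T a) t"
    proof (cases "card T + p = CARD('e) \<and> a < f \<and> g a + mdegree t + p = s \<and> supp t \<in> \<Delta>")
      case True
      then have u: "mdegree ?u = mdegree t + p" "card ?\<tau> + p = card (supp ?u)"
        using mdegree_strand_index by blast+
      have "strand y a ?u (?\<tau> - {e}) = h a ?u (?\<tau> - {e})" if e: "e \<in> ?\<tau>" for e
      proof -
        have sub: "?\<tau> - {e} \<subseteq> supp ?u"
          using idx(1) by auto
        let ?T = "?\<tau> - {e} \<union> - supp ?u" and ?t = "?u - ind (supp ?u - (?\<tau> - {e}))"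
        note i = strand_indices[OF sub]
        have T: "card ?T + Suc p = CARD('e)"
          using i(4) u(2) card_Suc_Diff1[OF finite e] by linarith
        have "mdegree ?u = mdegree ?t + Suc p"
          using mdegree_strand_index(1)[OF T, of ?t] i(1) by simp
        moreover have "?\<tau> - {e} \<in> strand_complex \<Delta> ?u"
          by (rule simplicial_complexD[OF simplicial_strand_complex(1)[OF \<Delta>] face_strand_complex]) (use True in auto)
        then have "supp ?t \<in> \<Delta>"
          using i(3) by (simp add: strand_complex_def)
        ultimately have "Y ?T a ?t = h a (?t + ind (- ?T)) (?T \<inter> supp ?t)"
          using True u T by (simp add: Y_def)
        then show ?thesis
          using i(1,2) by (simp add: strand_def y)
      qed
      then have "cob (usign ?u) (strand y a ?u) ?\<tau> = cob (usign ?u) (h a ?u) ?\<tau>"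
        by (rule cob_cong)
      also have "\<dots> = strand c a ?u ?\<tau>"
        by (rule h[symmetric]) (use True u face_strand_complex in auto)
      also have "\<dots> = lkp (c T a) t"
        using idx by (simp add: strand_def)
      finally show ?thesis
        using True by (simp add: lookup_kos)
    next
      case False
      then have "lkp (c T a) t = 0"
        using koszul_spaceD[OF c(1)] by blast
      \<comment> \<open>A nonzero term would give \<open>(T, t)\<close> exactly the degrees that the
        case assumption denies.\<close>
      moreover have "cob (usign ?u) (strand y a ?u) ?\<tau> = 0" if t: "supp t \<in> \<Delta>"
      proof (rule cob_zero, rule ccontr)
        fix e assume e: "e \<in> ?\<tau>" and nz: "strand y a ?u (?\<tau> - {e}) \<noteq> 0"
        have sub: "?\<tau> - {e} \<subseteq> supp ?u"
          using idx(1) by auto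
        let ?T = "?\<tau> - {e} \<union> - supp ?u" and ?t = "?u - ind (supp ?u - (?\<tau> - {e}))"
        note i = strand_indices[OF sub]
        have *: "card ?T + Suc p = CARD('e)" "a < f" "g a + mdegree ?t + Suc p = s"
          using nz by (auto simp: strand_def y Y_def split: if_splits)
        have "T = insert e ?T" "e \<notin> ?T"
          using e by (auto simp: keys_add_nat)
        then have T: "card T + p = CARD('e)"
          using *(1) by (metis add_Suc_right add_Suc card_insert_disjoint finite)
        have "mdegree ?t + Suc p = mdegree t + p"
          using mdegree_strand_index(1)[OF T, of t] mdegree_strand_index(1)[OF *(1), of ?t] i(1) by simp
        then show False
          using False T * t by auto
      qed
      ultimately show ?thesis
        by (simp add: lookup_kos)
    qed
  qed
  ultimately show ?thesis by blast
qed

text \<open>A cocycle that is no coboundary is planted in the squarefree multidegree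
  \<open>ind W\<close>, whose strand is the cochain complex of the restriction to \<open>W\<close>.
  The conclusion excludes every \<open>y\<close>, of whatever degree.\<close>

lemma koszul_not_exact:
  fixes W :: "'e::finite set"
  assumes \<Delta>: "simplicial_complex \<Delta>" and j: "j + p = card W"
    and ne: "\<not> exact_at (usign (ind W) :: _ \<Rightarrow> _ \<Rightarrow> 'k::field) (\<Delta> \<inter> Pow W) j"
  shows "\<exists>c\<in>koszul_space \<Delta> 1 (\<lambda>_. 0) (card W) p. kos \<Delta> c = 0 \<and>
    \<not> (\<exists>y. (c :: ('e, 'k) kelem) = kos \<Delta> y)"
proof -
  have sc: "strand_complex \<Delta> (ind W) = \<Delta> \<inter> Pow W"
    by (auto simp: strand_complex_def)
  obtain f where f: "\<And>\<tau>. \<tau> \<in> \<Delta> \<inter> Pow W \<Longrightarrow> card \<tau> = Suc j \<Longrightarrow> cob (usign (ind W)) f \<tau> = (0::'k)"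
    and nf: "\<not> (\<exists>g. \<forall>\<tau>\<in>\<Delta> \<inter> Pow W. card \<tau> = j \<longrightarrow> f \<tau> = cob (usign (ind W)) g \<tau>)"
    using ne unfolding exact_at_def by blast
  \<comment> \<open>A set \<open>T\<close> containing \<open>- W\<close> and the monomial
    \<open>ind (T \<inter> W)\<close> form the position of the face \<open>T \<inter> W\<close> in
    the strand of \<open>ind W\<close>.\<close>
  define c :: "('e, 'k) kelem" where "c T a = (if a = 0 \<and> - W \<subseteq> T \<and> T \<inter> W \<in> \<Delta> \<and> card (T \<inter> W) = j
      then Poly_Mapping.single (ind (T \<inter> W)) (f (T \<inter> W)) else 0)" for T a
  have nz: "a = 0 \<and> - W \<subseteq> T \<and> T \<inter> W \<in> \<Delta> \<and> card (T \<inter> W) = j \<and> t = ind (T \<inter> W)"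
    if "lkp (c T a) t \<noteq> 0" for T a t
    using that by (auto simp: c_def lookup_single when_def split: if_splits)
  have "c \<in> koszul_space \<Delta> 1 (\<lambda>_. 0) (card W) p"
    unfolding koszul_space_def
  proof (intro CollectI allI impI)
    fix T a t assume *: "lkp (c T a) t \<noteq> 0"
    note nz = nz[OF *]
    then have "T \<inter> W \<union> - W = T"
      by blast
    moreover have "card (T \<inter> W \<union> - W) = card (T \<inter> W) + card (- W)"
      by (rule card_Un_disjoint) auto
    ultimately have "card T = card (T \<inter> W) + card (- W)"
      by simp
    moreover have "card (- W) + card W = CARD('e)"
      by (rule card_Compl_add)
    ultimately show "card T + p = CARD('e) \<and> a < 1 \<and> 0 + mdegree t + p = card W \<and> supp t \<in> \<Delta>"
      using j nz by simp
  qed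
  moreover have "kos \<Delta> c = 0"
  proof (intro ext poly_mapping_eqI)
    fix T a and t :: "'e \<Rightarrow>\<^sub>0 nat"
    let ?u = "t + ind (- T)" and ?\<tau> = "T \<inter> supp t"
    note idx = strand_of_indices[where t=t and T=T]
    have "cob (usign ?u) (strand c a ?u) ?\<tau> = 0" if t: "supp t \<in> \<Delta>"
    proof (cases "a = 0 \<and> ?u = ind W \<and> card ?\<tau> = Suc j")
      case True
      then have W: "?\<tau> \<in> \<Delta> \<inter> Pow W"
        using face_strand_complex[OF t, of T] sc by simp
      have "strand c a ?u (?\<tau> - {e}) = f (?\<tau> - {e})" if e: "e \<in> ?\<tau>" for e
      proof -
        have "(?\<tau> - {e} \<union> - W) \<inter> W = ?\<tau> - {e}" "W - (?\<tau> - {e}) \<subseteq> W"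
          using W by auto
        moreover have "?\<tau> - {e} \<in> \<Delta>"
          by (rule simplicial_complexD[OF \<Delta>, of ?\<tau>]) (use W in auto)
        moreover have "ind W - ind (W - (?\<tau> - {e})) = ind (?\<tau> - {e})"
          using W by (intro poly_mapping_eqI) (auto simp: lookup_minus)
        moreover have "card (?\<tau> - {e}) = j"
          using True e by simp
        ultimately show ?thesis
          using True by (simp add: strand_def c_def)
      qed
      then have "cob (usign ?u) (strand c a ?u) ?\<tau> = cob (usign ?u) f ?\<tau>"
        by (rule cob_cong)
      then show ?thesis
        using f[OF W] True by simp
    next
      case False
      show ?thesis
      proof (rule cob_zero, rule ccontr)
        fix e assume e: "e \<in> ?\<tau>" and "strand c a ?u (?\<tau> - {e}) \<noteq> 0"
        moreover have sub: "?\<tau> - {e} \<subseteq> supp ?u"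
          using idx(1) by auto
        let ?T = "?\<tau> - {e} \<union> - supp ?u" and ?t = "?u - ind (supp ?u - (?\<tau> - {e}))"
        note i = strand_indices[OF sub]
        ultimately have *: "a = 0" "- W \<subseteq> ?T" "card (?T \<inter> W) = j" "?t = ind (?T \<inter> W)"
          using nz[of ?T a ?t] by (auto simp: strand_def)
        have "ind (?T \<inter> W) + ind (- ?T) = ind W"
          using *(2) by (intro poly_mapping_eqI) (auto simp: lookup_add)
        then have u: "?u = ind W"
          using i(1) *(4) by simp
        then have "?T \<inter> W = ?\<tau> - {e}"
          using sub by auto
        then have "card ?\<tau> = Suc j"
          using *(3) e by (metis card_Suc_Diff1 finite)
        then show False
          using False *(1) u by blast
      qed
    qed
    then show "lkp (kos \<Delta> c T a) t = lkp ((0 :: ('e, 'k) kelem) T a) t"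
      by (auto simp: lookup_kos)
  qed
  moreover have "\<not> (\<exists>y. c = kos \<Delta> y)"
  proof
    assume "\<exists>y. c = kos \<Delta> y"
    then obtain y where y: "c = kos \<Delta> y" ..
    have "f \<tau> = cob (usign (ind W)) (strand y 0 (ind W)) \<tau>" if \<tau>: "\<tau> \<in> \<Delta> \<inter> Pow W" "card \<tau> = j" for \<tau>
    proof -
      have "(\<tau> \<union> - W) \<inter> W = \<tau>"
        using \<tau> by auto
      moreover have "ind W - ind (W - \<tau>) = ind \<tau>"
        using \<tau> by (intro poly_mapping_eqI) (auto simp: lookup_minus)
      ultimately have "strand c 0 (ind W) \<tau> = f \<tau>"
        using \<tau> by (simp add: strand_def c_def)
      then show ?thesis
        using strand_kos[of \<tau> \<Delta> "ind W" y 0] \<tau>(1) y sc by simp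
    qed
    then show False
      using nf by blast
  qed
  ultimately show ?thesis by blast
qed

subsection \<open>Betti numbers through Koszul homology\<close>

lemma ind_empty [simp]: "ind {} = 0"
  by (rule poly_mapping_eqI) simp

lemma prod_mvar: "(\<Prod>e\<in>\<sigma>. mvar e) = (Poly_Mapping.single (ind \<sigma>) 1 :: ('e::finite, 'k::field) mvpoly)"
proof -
  have "finite \<sigma>" by simp
  then show ?thesis
  proof (induction \<sigma>)
    case empty
    show ?case by simp
  next
    case (insert e \<sigma>)
    have "Poly_Mapping.single e 1 + ind \<sigma> = ind (insert e \<sigma>)"
      using insert.hyps by (intro poly_mapping_eqI) (auto simp: lookup_add lookup_single when_def)
    then show ?case
      using insert by (simp add: mvar_def mult_single)
  qed
qed

lemma sum_monomials: "(\<Sum>t\<in>supp p. Poly_Mapping.single t (lkp p t)) = p"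
  by (rule poly_mapping_eqI) (auto simp: lookup_sum lookup_single when_def in_keys_iff sum.delta)

lemma module_times: "module ((*) :: 'a::comm_ring_1 \<Rightarrow> 'a \<Rightarrow> 'a)"
  by unfold_locales (simp_all add: algebra_simps)

section \<open>Normal forms modulo the Stanley-Reisner ideal\<close>

abbreviation face_part :: "'e set set \<Rightarrow> ('e, 'k::field) mvpoly \<Rightarrow> ('e, 'k) mvpoly" where
  "face_part \<Delta> \<equiv> restrict_monomials (\<lambda>t. supp t \<in> \<Delta>)"

text \<open>Supports grow under multiplication, so a discarded monomial never returns to the
  faces.\<close>

lemma face_part_mult:
  assumes \<Delta>: "simplicial_complex \<Delta>"
  shows "face_part \<Delta> (p * face_part \<Delta> q) = face_part \<Delta> (p * q)"
proof -
  have "face_part \<Delta> (p * (q - face_part \<Delta> q)) = 0"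
  proof (rule restrict_null)
    fix t assume "t \<in> supp (p * (q - face_part \<Delta> q))"
    then obtain a b where t: "t = a + b" "b \<in> supp (q - face_part \<Delta> q)"
      using keys_mult by blast
    then have b: "supp b \<notin> \<Delta>"
      by (auto simp: in_keys_iff lookup_minus lookup_restrict)
    have "supp b \<subseteq> supp t"
      using t(1) by (simp add: keys_add_nat)
    then show "supp t \<notin> \<Delta>"
      using b simplicial_complexD[OF \<Delta>, of "supp t" "supp b"] by blast
  qed
  then show ?thesis
    by (simp add: right_diff_distrib restrict_diff)
qed

text \<open>The ideal is spanned by the monomials supported on non-faces, each a multiple of the
  generator belonging to its support. So \<open>face_part\<close> picks a normal form, and
  polynomials supported on faces represent the quotient ring.\<close>

lemma stanley_reisner_ideal_iff:
  fixes \<Delta> :: "'e::finite set set" and p :: "('e, 'k::field) mvpoly"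
  assumes \<Delta>: "simplicial_complex \<Delta>"
  shows "p \<in> stanley_reisner_ideal \<Delta> \<longleftrightarrow> face_part \<Delta> p = 0"
proof
  let ?G = "{\<Prod>e\<in>\<sigma>. mvar e | \<sigma>. \<sigma> \<notin> \<Delta>} :: ('e, 'k) mvpoly set"
  let ?K = "{p :: ('e, 'k) mvpoly. face_part \<Delta> p = 0}"
  have "?G \<subseteq> ?K"
    by (auto simp: prod_mvar intro!: restrict_null)
  moreover have "module.subspace (*) ?K"
  proof (rule module.subspaceI[OF module_times])
    fix c x :: "('e, 'k) mvpoly" assume "x \<in> ?K"
    then show "c * x \<in> ?K"
      using face_part_mult[OF \<Delta>, of c x] by simp
  qed (auto simp: restrict_add)
  ultimately have "stanley_reisner_ideal \<Delta> \<subseteq> ?K"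
    unfolding stanley_reisner_ideal_def by (rule module.span_minimal[OF module_times])
  then show "p \<in> stanley_reisner_ideal \<Delta> \<Longrightarrow> face_part \<Delta> p = 0"
    by blast
next
  assume p: "face_part \<Delta> p = 0"
  have "(\<Sum>t\<in>supp p. Poly_Mapping.single t (lkp p t)) \<in> stanley_reisner_ideal \<Delta>"
    unfolding stanley_reisner_ideal_def
  proof (rule module.span_sum[OF module_times])
    fix t assume t: "t \<in> supp p"
    have "t - ind (supp t) + ind (supp t) = t"
      by (rule poly_mapping_eqI) (auto simp: lookup_add lookup_minus in_keys_iff)
    then have "Poly_Mapping.single t (lkp p t) =
        Poly_Mapping.single (t - ind (supp t)) (lkp p t) * (\<Prod>e\<in>supp t. mvar e)"
      by (simp add: prod_mvar mult_single)
    also have "\<dots> \<in> module.span (*) {\<Prod>e\<in>\<sigma>. mvar e | \<sigma>. \<sigma> \<notin> \<Delta>}"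
      using p t by (intro module.span_scale[OF module_times] module.span_base[OF module_times])
        (auto simp: restrict_eq_0_iff)
    finally show "Poly_Mapping.single t (lkp p t) \<in> module.span (*) {\<Prod>e\<in>\<sigma>. mvar e | \<sigma>. \<sigma> \<notin> \<Delta>}" .
  qed
  then show "p \<in> stanley_reisner_ideal \<Delta>"
    by (simp add: sum_monomials)
qed

lemma lookup_mult_0:
  fixes p q :: "('e, 'k::field) mvpoly"
  assumes "lkp p 0 = 0"
  shows "lkp (p * q) 0 = 0"
proof (rule ccontr)
  assume "lkp (p * q) 0 \<noteq> 0"
  then have "0 \<in> supp (p * q)"
    by (simp add: in_keys_iff)
  then obtain a b where "0 = a + b" "a \<in> supp p"
    using keys_mult by blast
  moreover from this have "supp a = {}"
    using keys_add_nat[of a b] by simp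
  ultimately show False
    using assms by (simp add: in_keys_iff)
qed

lemma kos_diff: "kos \<Delta> (x - y) = kos \<Delta> x - kos \<Delta> y"
  by (intro ext) (simp add: kos_def restrict_diff[symmetric] right_diff_distrib sum_subtractf)

lemma koszul_space_diff:
  fixes x y :: "('e::finite, 'k::field) kelem"
  assumes "x \<in> koszul_space \<Delta> f g s p" "y \<in> koszul_space \<Delta> f g s p"
  shows "x - y \<in> koszul_space \<Delta> f g s p"
  unfolding koszul_space_def
proof (intro CollectI allI impI)
  fix T a t assume "lkp ((x - y) T a) t \<noteq> 0"
  then have "lkp (x T a) t \<noteq> 0 \<or> lkp (y T a) t \<noteq> 0"
    by (auto simp: lookup_minus)
  then show "card T + p = CARD('e) \<and> a < f \<and> g a + mdegree t + p = s \<and> supp t \<in> \<Delta>"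
    using koszul_spaceD[OF assms(1), of T a t] koszul_spaceD[OF assms(2), of T a t] by auto
qed

lemma koszul_space_outside:
  fixes c :: "('e::finite, 'k::field) kelem"
  assumes "c \<in> koszul_space \<Delta> f g s p" "card T + p \<noteq> CARD('e) \<or> \<not> a < f"
  shows "c T a = 0"
proof (rule poly_mapping_eqI, rule ccontr)
  fix t assume "lkp (c T a) t \<noteq> lkp 0 t"
  then show False
    using koszul_spaceD(1,2)[OF assms(1), of T a t] assms(2) by simp
qed

text \<open>In index \<open>0\<close> only \<open>T = UNIV\<close> occurs, and no
  \<open>T - {e}\<close> with \<open>e\<close> in \<open>T\<close> equals it.\<close>

lemma kos_corner:
  fixes c :: "('e::finite, 'k::field) kelem"
  assumes "c \<in> koszul_space \<Delta> f g s 0"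
  shows "kos \<Delta> c = 0"
proof (intro ext)
  fix T a
  have "c (T - {e}) a = 0" if "e \<in> T" for e
  proof (rule koszul_space_outside[OF assms], rule disjI1)
    have "card (T - {e}) < card T" "card T \<le> CARD('e)"
      using card_Diff1_less[OF finite that] card_mono[of UNIV T] by simp_all
    then show "card (T - {e}) + 0 \<noteq> CARD('e)" by simp
  qed
  then show "kos \<Delta> c T a = 0 T a"
    by (simp add: kos_def)
qed

lemma kos_in:
  fixes c :: "('e::finite, 'k::field) kelem"
  assumes "c \<in> koszul_space \<Delta> f g s (Suc p)"
  shows "kos \<Delta> c \<in> koszul_space \<Delta> f g s p"
  unfolding koszul_space_def
proof (intro CollectI allI impI)
  fix T a t assume *: "lkp (kos \<Delta> c T a) t \<noteq> 0"
  then have t: "supp t \<in> \<Delta>" and nz: "(\<Sum>e\<in>T. ksign e T * lkp (mvar e * c (T - {e}) a) t) \<noteq> 0"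
    by (auto simp: kos_def lookup_restrict lookup_sum lookup_ksign_mult split: if_splits)
  from nz obtain e where "e \<in> T" "ksign e T * lkp (mvar e * c (T - {e}) a) t \<noteq> 0"
    by (rule sum.not_neutral_contains_not_neutral)
  then have e: "e \<in> T" "lkp (mvar e * c (T - {e}) a) t \<noteq> 0"
    by auto
  then have et: "e \<in> supp t" "lkp (c (T - {e}) a) (t - ind {e}) \<noteq> 0"
    by (auto simp: lookup_mvar_mult split: if_splits)
  note D = koszul_spaceD[OF assms et(2)]
  have "t - ind {e} + ind {e} = t"
    using et(1) by (intro poly_mapping_eqI) (auto simp: lookup_add lookup_minus in_keys_iff)
  then have "mdegree t = mdegree (t - ind {e}) + 1"
    using mdegree_add[of "t - ind {e}" "ind {e}"] by simp
  moreover have "card T = Suc (card (T - {e}))"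
    using card_Suc_Diff1[OF finite e(1)] by simp
  ultimately show "card T + p = CARD('e) \<and> a < f \<and> g a + mdegree t + p = s \<and> supp t \<in> \<Delta>"
    using D t by simp
qed

text \<open>Over the polynomial ring a strand complex is the full power set of
  \<open>supp u\<close>, a cone unless \<open>u = 0\<close>. The only homology is that of the
  constants, which \<open>const\<close> rules out.\<close>

lemma koszul_exact_free:
  fixes c :: "('e::finite, 'k::field) kelem"
  assumes c: "c \<in> koszul_space UNIV f g s p" "kos UNIV c = 0" and const: "\<And>a. lkp (c UNIV a) 0 = 0"
  shows "\<exists>y\<in>koszul_space UNIV f g s (Suc p). c = kos UNIV y"
proof (rule koszul_exact[OF _ c])
  show sc: "simplicial_complex (UNIV :: 'e set set)"
    by (simp add: simplicial_complex_def)
  fix u :: "'e \<Rightarrow>\<^sub>0 nat" and a j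
  show "exact_at (usign u :: _ \<Rightarrow> _ \<Rightarrow> 'k) (strand_complex UNIV u) j \<or>
      (\<forall>\<tau>\<in>strand_complex UNIV u. card \<tau> = j \<longrightarrow> strand c a u \<tau> = 0)"
  proof (cases "supp u = {}")
    case True
    then have "u = 0" by simp
    then have "strand c a u \<tau> = 0" if "\<tau> \<subseteq> supp u" for \<tau>
      using that const by (simp add: strand_def)
    then show ?thesis
      by (simp add: strand_complex_def)
  next
    case False
    then obtain e where "e \<in> supp u" by blast
    then have "cone_point (strand_complex UNIV u) e"
      by (simp add: cone_point_def strand_complex_def)
    then show ?thesis
      using cone_exact_at[OF usign_sign_system finite simplicial_strand_complex(2,1)[OF sc] \<open>e \<in> supp u\<close>]
      by blast
  qed
qed

section \<open>The double complex of a minimal resolution\<close>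

definition res_space ::
  "'e::finite set set \<Rightarrow> ('e, 'k::field) free_complex \<Rightarrow> nat \<Rightarrow> nat \<Rightarrow> nat \<Rightarrow> ('e, 'k) kelem set" where
  "res_space \<Delta> F s p i = (case i of 0 \<Rightarrow> koszul_space \<Delta> 1 (\<lambda>_. 0) s p
     | Suc i \<Rightarrow> koszul_space UNIV (frank F i) (bdeg F i) s p)"

text \<open>Index \<open>0\<close> stands for the Stanley-Reisner ring and \<open>Suc i\<close> for
  the free module of index \<open>i\<close>; applying \<open>face_part\<close> after
  \<open>aug_map\<close> is passage to the quotient.\<close>

definition res_diff ::
  "'e::finite set set \<Rightarrow> ('e, 'k::field) free_complex \<Rightarrow> nat \<Rightarrow> ('e, 'k) kelem \<Rightarrow> ('e, 'k) kelem" where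
  "res_diff \<Delta> F i c = (case i of
       0 \<Rightarrow> (\<lambda>T a. if a = 0 then face_part \<Delta> (aug_map F (c T)) else 0)
     | Suc i \<Rightarrow> (\<lambda>T. diff_map F i (c T)))"

definition res_kos :: "'e::finite set set \<Rightarrow> nat \<Rightarrow> ('e, 'k::field) kelem \<Rightarrow> ('e, 'k) kelem" where
  "res_kos \<Delta> i = kos (case i of 0 \<Rightarrow> \<Delta> | Suc _ \<Rightarrow> UNIV)"

lemma res_simps [simp]:
  "res_space \<Delta> F s p 0 = koszul_space \<Delta> 1 (\<lambda>_. 0) s p"
  "res_space \<Delta> F s p (Suc i) = koszul_space UNIV (frank F i) (bdeg F i) s p"
  "res_diff \<Delta> F 0 c = (\<lambda>T a. if a = 0 then face_part \<Delta> (aug_map F (c T)) else 0)"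
  "res_diff \<Delta> F (Suc i) c = (\<lambda>T. diff_map F i (c T))"
  "res_kos \<Delta> 0 = kos \<Delta>" "res_kos \<Delta> (Suc i) = kos UNIV"
  by (simp_all add: res_space_def res_diff_def res_kos_def)

lemma aug_map_diff: "aug_map F (v - w) = aug_map F v - aug_map F w"
  by (simp add: aug_map_def right_diff_distrib sum_subtractf)

lemma diff_map_diff: "diff_map F i (v - w) = diff_map F i v - diff_map F i w"
  by (intro ext) (simp add: diff_map_def right_diff_distrib sum_subtractf)

lemma res_diff_in:
  fixes F :: "('e::finite, 'k::field) free_complex"
  assumes F: "graded_complex F" and c: "c \<in> res_space \<Delta> F s p (Suc i)"
  shows "res_diff \<Delta> F i c \<in> res_space \<Delta> F s p i"
proof -
  have deg: "card T + p = CARD('e) \<and> deg + mdegree t + p = s"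
    if "lkp (\<Sum>b<frank F i. P b * c T b) t \<noteq> 0"
      "\<And>b t. b < frank F i \<Longrightarrow> t \<in> supp (P b) \<Longrightarrow> deg + mdegree t = bdeg F i b" for P deg T t
  proof -
    have "(\<Sum>b<frank F i. lkp (P b * c T b) t) \<noteq> 0"
      using that(1) by (simp add: lookup_sum)
    then obtain b where "b \<in> {..<frank F i}" "lkp (P b * c T b) t \<noteq> 0"
      by (rule sum.not_neutral_contains_not_neutral)
    then have b: "b < frank F i" "t \<in> supp (P b * c T b)"
      by (simp_all add: in_keys_iff)
    then obtain t1 t2 where t: "t = t1 + t2" "t1 \<in> supp (P b)" "t2 \<in> supp (c T b)"
      using keys_mult by blast
    then have "lkp (c T b) t2 \<noteq> 0"
      by (simp add: in_keys_iff)
    then show ?thesis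
      using koszul_spaceD[of c UNIV "frank F i" "bdeg F i" s p T b t2] c that(2)[OF b(1) t(2)] t(1)
      by (simp add: mdegree_add)
  qed
  show ?thesis
  proof (cases i)
    case 0
    have "card T + p = CARD('e) \<and> 0 + mdegree t + p = s"
      if "lkp (\<Sum>b<frank F i. augm F b * c T b) t \<noteq> 0" for T t
      by (rule deg[OF that]) (use F 0 in \<open>simp add: graded_complex_def\<close>)
    then show ?thesis
      using 0 by (auto simp: koszul_space_def lookup_restrict aug_map_def split: if_splits)
  next
    case (Suc j)
    have "card T + p = CARD('e) \<and> bdeg F j a + mdegree t + p = s"
      if "a < frank F j" "lkp (\<Sum>b<frank F i. dmat F j a b * c T b) t \<noteq> 0" for T a t
      by (rule deg[OF that(2)]) (use F Suc that(1) in \<open>simp add: graded_complex_def\<close>)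
    then show ?thesis
      using Suc by (auto simp: koszul_space_def diff_map_def split: if_splits)
  qed
qed

lemma res_commute:
  assumes \<Delta>: "simplicial_complex \<Delta>"
  shows "res_kos \<Delta> i (res_diff \<Delta> F i c) = res_diff \<Delta> F i (res_kos \<Delta> (Suc i) c)"
proof (intro ext)
  fix T a
  have swap: "(\<Sum>e\<in>T. ksign e T * (mvar e * (\<Sum>b<n. P b * c (T - {e}) b))) =
      (\<Sum>b<n. P b * (\<Sum>e\<in>T. ksign e T * (mvar e * c (T - {e}) b)))" for P :: "nat \<Rightarrow> ('a, 'b) mvpoly" and n
    by (simp add: sum_distrib_left sum.swap[of _ T] ac_simps)
  show "res_kos \<Delta> i (res_diff \<Delta> F i c) T a = res_diff \<Delta> F i (res_kos \<Delta> (Suc i) c) T a"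
  proof (cases i)
    case 0
    have "face_part \<Delta> (ksign e T * (mvar e * face_part \<Delta> q)) = face_part \<Delta> (ksign e T * (mvar e * q))"
      for e and q :: "('a, 'b) mvpoly"
      using face_part_mult[OF \<Delta>, of "ksign e T * mvar e" q] by (simp add: mult.assoc)
    then have "face_part \<Delta> (\<Sum>e\<in>T. ksign e T * (mvar e * face_part \<Delta> (q e)))
        = face_part \<Delta> (\<Sum>e\<in>T. ksign e T * (mvar e * q e))"
      for q :: "'a \<Rightarrow> ('a, 'b) mvpoly"
      by (simp add: restrict_sum)
    then show ?thesis
      using 0 swap by (simp add: kos_def aug_map_def)
  next
    case (Suc j)
    then show ?thesis
      using swap by (simp add: kos_def diff_map_def)
  qed
qed

lemma koszul_space_free_mod:
  "c \<in> koszul_space \<Delta> (frank F i) g s p \<Longrightarrow> c T \<in> free_mod F i"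
  by (auto simp: free_mod_def intro: koszul_space_outside)

lemma diff_map_homogeneous:
  fixes F :: "('e::finite, 'k::field) free_complex"
  assumes "graded_complex F"
  shows "diff_map F i (\<lambda>b. restrict_monomials (\<lambda>t. bdeg F (Suc i) b + mdegree t + p = s) (w b)) a
    = restrict_monomials (\<lambda>t. bdeg F i a + mdegree t + p = s) (diff_map F i w a)"
proof (cases "a < frank F i")
  case True
  have "restrict_monomials (\<lambda>t. bdeg F i a + mdegree t + p = s) (dmat F i a b * w b)
      = dmat F i a b * restrict_monomials (\<lambda>t. bdeg F (Suc i) b + mdegree t + p = s) (w b)"
    if b: "b < frank F (Suc i)" for b
  proof (rule restrict_mult)
    fix t t' assume "t \<in> supp (dmat F i a b)"
    then have "bdeg F i a + mdegree t = bdeg F (Suc i) b"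
      using assms True b by (simp add: graded_complex_def)
    then show "bdeg F i a + mdegree (t + t') + p = s \<longleftrightarrow> bdeg F (Suc i) b + mdegree t' + p = s"
      by (simp add: mdegree_add add.assoc[symmetric])
  qed
  then show ?thesis
    using True by (simp add: diff_map_def restrict_sum)
qed (simp add: diff_map_def)

lemma aug_map_homogeneous:
  fixes F :: "('e::finite, 'k::field) free_complex"
  assumes "graded_complex F"
  shows "aug_map F (\<lambda>b. restrict_monomials (\<lambda>t. bdeg F 0 b + mdegree t + p = s) (w b))
    = restrict_monomials (\<lambda>t. mdegree t + p = s) (aug_map F w)"
proof -
  have "restrict_monomials (\<lambda>t. mdegree t + p = s) (augm F b * w b)
      = augm F b * restrict_monomials (\<lambda>t. bdeg F 0 b + mdegree t + p = s) (w b)"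
    if b: "b < frank F 0" for b
  proof (rule restrict_mult)
    fix t t' assume "t \<in> supp (augm F b)"
    then have "mdegree t = bdeg F 0 b"
      using assms b by (simp add: graded_complex_def)
    then show "mdegree (t + t') + p = s \<longleftrightarrow> bdeg F 0 b + mdegree t' + p = s"
      by (simp add: mdegree_add)
  qed
  then show ?thesis
    by (simp add: aug_map_def restrict_sum)
qed

text \<open>\<open>exact_complex\<close> yields preimages regardless of degree. Their homogeneous
  parts are preimages too by the two preceding lemmas, and they lie in the required space.\<close>

lemma homogeneous_lift:
  fixes F :: "('e::finite, 'k::field) free_complex"
  assumes "\<And>T. w T \<in> free_mod F i"
  shows "(\<lambda>T b. if card T + p = CARD('e)
      then restrict_monomials (\<lambda>t. bdeg F i b + mdegree t + p = s) (w T b) else 0)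
    \<in> koszul_space UNIV (frank F i) (bdeg F i) s p"
  unfolding koszul_space_def
proof (intro CollectI allI impI)
  fix T b t
  assume *: "lkp (if card T + p = CARD('e)
      then restrict_monomials (\<lambda>t. bdeg F i b + mdegree t + p = s) (w T b) else 0) t \<noteq> 0"
  then have "w T b \<noteq> 0" "card T + p = CARD('e)" "bdeg F i b + mdegree t + p = s"
    by (auto simp: lookup_restrict split: if_splits)
  moreover from this have "b < frank F i"
    using assms[of T] by (auto simp: free_mod_def not_less[symmetric])
  ultimately show "card T + p = CARD('e) \<and> b < frank F i \<and> bdeg F i b + mdegree t + p = s \<and> supp t \<in> UNIV"
    by simp
qed

context
  fixes \<Delta> :: "'e::finite set set" and F :: "('e, 'k::field) free_complex"
  assumes \<Delta>: "simplicial_complex \<Delta>"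
    and F: "minimal_graded_free_resolution (stanley_reisner_ideal \<Delta>) F"
begin

lemma res_graded: "graded_complex F"
  and res_exact: "exact_complex (stanley_reisner_ideal \<Delta>) F"
  and res_minimal: "minimal_complex F"
  using F by (simp_all add: minimal_graded_free_resolution_def)

lemma res_diff_diff: "c \<in> res_space \<Delta> F s p (Suc (Suc i)) \<Longrightarrow> res_diff \<Delta> F i (res_diff \<Delta> F (Suc i) c) = 0"
proof (cases i)
  case 0
  assume "c \<in> res_space \<Delta> F s p (Suc (Suc i))"
  then have "c T \<in> free_mod F 1" for T
    using 0 koszul_space_free_mod[of c UNIV F 1] by simp
  then have "aug_map F (diff_map F 0 (c T)) \<in> stanley_reisner_ideal \<Delta>" for T
    using res_exact unfolding exact_complex_def by blast
  then have "face_part \<Delta> (aug_map F (diff_map F 0 (c T))) = 0" for T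
    using stanley_reisner_ideal_iff[OF \<Delta>] by blast
  then show ?thesis
    using 0 by (simp add: fun_eq_iff)
next
  case (Suc j)
  assume "c \<in> res_space \<Delta> F s p (Suc (Suc i))"
  then have "c T \<in> free_mod F (Suc (Suc j))" for T
    using Suc koszul_space_free_mod[of c UNIV F "Suc (Suc j)"] by simp
  then have "diff_map F j (diff_map F (Suc j) (c T)) = (\<lambda>_. 0)" for T
    using res_exact unfolding exact_complex_def by blast
  then show ?thesis
    using Suc by (simp add: fun_eq_iff)
qed

lemma res_row_exact:
  assumes c: "c \<in> res_space \<Delta> F s p (Suc i)" and 0: "res_diff \<Delta> F i c = 0"
  shows "\<exists>y\<in>res_space \<Delta> F s p (Suc (Suc i)). c = res_diff \<Delta> F (Suc i) y"
proof -
  have c': "c \<in> koszul_space UNIV (frank F i) (bdeg F i) s p"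
    using c by simp
  have "\<exists>w\<in>free_mod F (Suc i). c T = diff_map F i w" for T
  proof (cases i)
    case i: 0
    have "res_diff \<Delta> F i c T 0 = 0"
      unfolding 0 by simp
    then have "face_part \<Delta> (aug_map F (c T)) = 0"
      using i by simp
    then have "aug_map F (c T) \<in> stanley_reisner_ideal \<Delta>"
      using stanley_reisner_ideal_iff[OF \<Delta>] by blast
    moreover have "c T \<in> free_mod F 0"
      using koszul_space_free_mod c' i by blast
    ultimately have "c T \<in> diff_map F 0 ` free_mod F 1"
      using res_exact unfolding exact_complex_def by blast
    then show ?thesis using i by auto
  next
    case (Suc j)
    have "diff_map F j (c T) = (\<lambda>_. 0)"
      using 0 Suc fun_cong[of "res_diff \<Delta> F i c" 0 T] by (simp add: fun_eq_iff)
    moreover have "c T \<in> free_mod F (Suc j)"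
      using koszul_space_free_mod c' Suc by blast
    ultimately have "c T \<in> diff_map F (Suc j) ` free_mod F (Suc (Suc j))"
      using res_exact unfolding exact_complex_def by blast
    then show ?thesis using Suc by auto
  qed
  then obtain w where w: "\<And>T. w T \<in> free_mod F (Suc i)" "\<And>T. c T = diff_map F i (w T)"
    by metis
  let ?y = "\<lambda>T b. if card T + p = CARD('e)
      then restrict_monomials (\<lambda>t. bdeg F (Suc i) b + mdegree t + p = s) (w T b) else 0"
  have "c T a = diff_map F i (?y T) a" for T a
  proof (cases "card T + p = CARD('e)")
    case True
    have "restrict_monomials (\<lambda>t. bdeg F i a + mdegree t + p = s) (c T a) = c T a"
      using koszul_spaceD(3)[OF c'] by (intro restrict_id) (simp add: in_keys_iff)
    then show ?thesis
      using True diff_map_homogeneous[OF res_graded, of i p s "w T" a] w(2)[of T] by simp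
  next
    case False
    then show ?thesis
      using koszul_space_outside[OF c', of T a] by (simp add: diff_map_def)
  qed
  then have "c = res_diff \<Delta> F (Suc i) ?y"
    by (simp add: fun_eq_iff)
  moreover have "?y \<in> res_space \<Delta> F s p (Suc (Suc i))"
    using homogeneous_lift[of w F "Suc i" p s] w(1) by simp
  ultimately show ?thesis by blast
qed

lemma res_row_surj:
  assumes c: "c \<in> res_space \<Delta> F s p 0"
  shows "\<exists>y\<in>res_space \<Delta> F s p 1. c = res_diff \<Delta> F 0 y"
proof -
  have c': "c \<in> koszul_space \<Delta> 1 (\<lambda>_. 0) s p"
    using c by simp
  have "\<exists>w\<in>free_mod F 0. c T 0 - aug_map F w \<in> stanley_reisner_ideal \<Delta>" for T
    using res_exact unfolding exact_complex_def by blast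
  then obtain w where w: "\<And>T. w T \<in> free_mod F 0"
      "\<And>T. c T 0 - aug_map F (w T) \<in> stanley_reisner_ideal \<Delta>"
    by metis
  let ?y = "\<lambda>T b. if card T + p = CARD('e)
      then restrict_monomials (\<lambda>t. bdeg F 0 b + mdegree t + p = s) (w T b) else 0"
  have "c T a = (if a = 0 then face_part \<Delta> (aug_map F (?y T)) else 0)" for T a
  proof (cases "a = 0 \<and> card T + p = CARD('e)")
    case True
    have "face_part \<Delta> (c T 0 - aug_map F (w T)) = 0"
      using w(2)[of T] stanley_reisner_ideal_iff[OF \<Delta>] by blast
    then have "face_part \<Delta> (c T 0) = face_part \<Delta> (aug_map F (w T))"
      by (simp add: restrict_diff)
    moreover have "face_part \<Delta> (c T 0) = c T 0"
      using koszul_spaceD(4)[OF c'] by (intro restrict_id) (simp add: in_keys_iff)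
    moreover have "restrict_monomials (\<lambda>t. mdegree t + p = s) (c T 0) = c T 0"
      using koszul_spaceD(3)[OF c'] by (intro restrict_id) (simp add: in_keys_iff)
    moreover have "face_part \<Delta> (restrict_monomials (\<lambda>t. mdegree t + p = s) q)
        = restrict_monomials (\<lambda>t. mdegree t + p = s) (face_part \<Delta> q)" for q :: "('e, 'k) mvpoly"
      by (rule poly_mapping_eqI) (simp add: lookup_restrict)
    ultimately show ?thesis
      using True aug_map_homogeneous[OF res_graded, of p s "w T"] by simp
  next
    case False
    then show ?thesis
      using koszul_space_outside[OF c', of T a] by (auto simp: aug_map_def)
  qed
  then have "c = res_diff \<Delta> F 0 ?y"
    by (simp add: fun_eq_iff)
  moreover have "?y \<in> res_space \<Delta> F s p 1"
    using homogeneous_lift[of w F 0 p s] w(1) by simp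
  ultimately show ?thesis by blast
qed

text \<open>Without constant terms in the matrices the image has no constant coefficient, and such
  elements are Koszul boundaries over the polynomial ring.\<close>

lemma res_minimal_diff:
  assumes c: "c \<in> res_space \<Delta> F s 0 (Suc (Suc i))"
  shows "\<exists>y\<in>res_space \<Delta> F s 1 (Suc i). res_diff \<Delta> F (Suc i) c = res_kos \<Delta> (Suc i) y"
proof -
  let ?d = "res_diff \<Delta> F (Suc i) c"
  have d: "?d \<in> koszul_space UNIV (frank F i) (bdeg F i) s 0"
    using res_diff_in[OF res_graded c] by simp
  have "lkp (?d UNIV a) 0 = 0" for a
    using res_minimal by (auto simp: diff_map_def lookup_sum minimal_complex_def intro!: sum.neutral lookup_mult_0)
  then show ?thesis
    using koszul_exact_free[OF d kos_corner[OF d]] by simp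
qed

lemma res_double_complex: "double_complex (res_space \<Delta> F s) (res_diff \<Delta> F) (res_kos \<Delta>)"
proof
  fix p i and x y :: "('e, 'k) kelem"
  show "x - y \<in> res_space \<Delta> F s p i" if "x \<in> res_space \<Delta> F s p i" "y \<in> res_space \<Delta> F s p i"
    using that by (cases i) (simp_all add: koszul_space_diff)
  show "res_diff \<Delta> F i x \<in> res_space \<Delta> F s p i" if "x \<in> res_space \<Delta> F s p (Suc i)"
    using res_diff_in[OF res_graded that] .
  show "res_kos \<Delta> i x \<in> res_space \<Delta> F s p i" if "x \<in> res_space \<Delta> F s (Suc p) i"
    using that by (cases i) (simp_all add: kos_in)
  show "res_diff \<Delta> F i (x - y) = res_diff \<Delta> F i x - res_diff \<Delta> F i y"
    by (cases i) (simp_all add: fun_eq_iff aug_map_diff diff_map_diff restrict_diff)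
  show "res_kos \<Delta> i (x - y) = res_kos \<Delta> i x - res_kos \<Delta> i y"
    by (simp add: res_kos_def kos_diff)
  show "res_kos \<Delta> i x = 0" if "x \<in> res_space \<Delta> F s 0 i"
    using that by (cases i) (simp_all add: kos_corner)
  show "res_kos \<Delta> i (res_diff \<Delta> F i x) = res_diff \<Delta> F i (res_kos \<Delta> (Suc i) x)"
    by (rule res_commute[OF \<Delta>])
  show "res_diff \<Delta> F i (res_diff \<Delta> F (Suc i) x) = 0" if "x \<in> res_space \<Delta> F s p (Suc (Suc i))"
    by (rule res_diff_diff[OF that])
  show "res_kos \<Delta> i (res_kos \<Delta> i x) = 0"
    by (cases i) (simp_all add: kos_kos \<Delta>, simp add: kos_kos simplicial_complex_def)
  show "\<exists>y\<in>res_space \<Delta> F s p (Suc (Suc i)). x = res_diff \<Delta> F (Suc i) y"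
    if "x \<in> res_space \<Delta> F s p (Suc i)" "res_diff \<Delta> F i x = 0"
    by (rule res_row_exact[OF that])
  show "\<exists>y\<in>res_space \<Delta> F s p 1. x = res_diff \<Delta> F 0 y" if "x \<in> res_space \<Delta> F s p 0"
    by (rule res_row_surj[OF that])
  show "\<exists>y\<in>res_space \<Delta> F s 1 (Suc i). res_diff \<Delta> F (Suc i) x = res_kos \<Delta> (Suc i) y"
    if "x \<in> res_space \<Delta> F s 0 (Suc (Suc i))"
    by (rule res_minimal_diff[OF that])
  show "\<exists>y\<in>res_space \<Delta> F s (Suc (Suc p)) (Suc i). x = res_kos \<Delta> (Suc i) y"
    if "x \<in> res_space \<Delta> F s (Suc p) (Suc i)" "res_kos \<Delta> (Suc i) x = 0"
  proof -
    have x: "x \<in> koszul_space UNIV (frank F i) (bdeg F i) s (Suc p)" "kos UNIV x = 0"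
      using that by simp_all
    have "lkp (x UNIV a) 0 = 0" for a
      using koszul_space_outside[OF x(1), of UNIV a] by simp
    then show ?thesis
      using koszul_exact_free[OF x] by simp
  qed
qed

text \<open>The corner modulo boundaries is the degree \<open>s\<close> part of the
  \<open>p\<close>-th free module modulo the ideal of the variables: only \<open>T = UNIV\<close>
  occurs there, and a nonzero constant coefficient belongs to a generator of degree
  \<open>s\<close>.\<close>

lemma betti_corner:
  "betti F p s = 0 \<longleftrightarrow>
    (\<forall>x\<in>res_space \<Delta> F s 0 (Suc p). \<exists>y\<in>res_space \<Delta> F s 1 (Suc p). x = res_kos \<Delta> (Suc p) y)"
proof
  assume b: "betti F p s = 0"
  show "\<forall>x\<in>res_space \<Delta> F s 0 (Suc p). \<exists>y\<in>res_space \<Delta> F s 1 (Suc p). x = res_kos \<Delta> (Suc p) y"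
  proof
    fix x :: "('e, 'k) kelem" assume "x \<in> res_space \<Delta> F s 0 (Suc p)"
    then have x: "x \<in> koszul_space UNIV (frank F p) (bdeg F p) s 0"
      by simp
    have "finite {a. a < frank F p \<and> bdeg F p a = s}"
      by simp
    then have none: "\<not> (a < frank F p \<and> bdeg F p a = s)" for a
      using b unfolding betti_def by (metis (mono_tags, lifting) card_0_eq empty_Collect_eq)
    have "lkp (x UNIV a) 0 = 0" for a
    proof (rule ccontr)
      assume "lkp (x UNIV a) 0 \<noteq> 0"
      from koszul_spaceD[OF x this] show False
        using none[of a] by (simp add: mdegree_def)
    qed
    then show "\<exists>y\<in>res_space \<Delta> F s 1 (Suc p). x = res_kos \<Delta> (Suc p) y"
      using koszul_exact_free[OF x kos_corner[OF x]] by simp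
  qed
next
  assume triv: "\<forall>x\<in>res_space \<Delta> F s 0 (Suc p). \<exists>y\<in>res_space \<Delta> F s 1 (Suc p). x = res_kos \<Delta> (Suc p) y"
  have False if a: "a < frank F p" "bdeg F p a = s" for a
  proof -
    \<comment> \<open>The basis vector of index \<open>a\<close>; its constant coefficient
      \<open>1\<close> cannot occur in a boundary.\<close>
    define x :: "('e, 'k) kelem" where "x T b = (if T = UNIV \<and> b = a then 1 else 0)" for T b
    have "x \<in> res_space \<Delta> F s 0 (Suc p)"
      using a by (auto simp: koszul_space_def x_def lookup_one when_def mdegree_def split: if_splits)
    then obtain y where y: "x = kos UNIV y"
      using triv by auto
    have "lkp (x UNIV a) 0 = 0"
      unfolding y by (simp add: lookup_kos)
    then show False
      by (simp add: x_def)
  qed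
  then have "{a. a < frank F p \<and> bdeg F p a = s} = {}"
    by blast
  then show "betti F p s = 0"
    by (simp add: betti_def)
qed

lemma betti_koszul_homology:
  "betti F p s = 0 \<longleftrightarrow>
    (\<forall>z\<in>koszul_space \<Delta> 1 (\<lambda>_. 0) s p. kos \<Delta> z = 0 \<longrightarrow>
       (\<exists>y\<in>koszul_space \<Delta> 1 (\<lambda>_. 0) s (Suc p). z = kos \<Delta> (y :: ('e, 'k) kelem)))"
  unfolding betti_corner
  using double_complex.edge_homology[OF res_double_complex, of s p] by simp

end

section \<open>Hochster's criterion for matroid complexes\<close>

lemma matroid_complex_Int_Pow:
  assumes "matroid_complex \<Delta>"
  shows "matroid_complex (\<Delta> \<inter> Pow W)"
  unfolding matroid_complex_def
proof (intro conjI ballI impI)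
  show "{} \<in> \<Delta> \<inter> Pow W"
    using assms by (simp add: matroid_complex_def)
  show "simplicial_complex (\<Delta> \<inter> Pow W)"
    using assms unfolding matroid_complex_def simplicial_complex_def by blast
  fix I J assume IJ: "I \<in> \<Delta> \<inter> Pow W" "J \<in> \<Delta> \<inter> Pow W" "card I < card J"
  then obtain e where "e \<in> J - I" "insert e I \<in> \<Delta>"
    using assms unfolding matroid_complex_def by blast
  then show "\<exists>e\<in>J - I. insert e I \<in> \<Delta> \<inter> Pow W"
    using IJ by blast
qed

text \<open>A face \<open>B\<close> in the strand of \<open>ind W\<close> sits at Koszul index
  \<open>card W - card B\<close>. So the last two conditions say that the top degree of the
  restriction to \<open>W\<close> is the one seen at index \<open>p\<close>.\<close>

theorem betti_matroid_complex:
  fixes \<Delta> :: "'e::finite set set" and F :: "('e, 'k::field) free_complex"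
  assumes \<Delta>: "matroid_complex \<Delta>"
    and F: "minimal_graded_free_resolution (stanley_reisner_ideal \<Delta>) F"
  shows "betti F p s \<noteq> 0 \<longleftrightarrow> (\<exists>W. card W = s \<and> (\<forall>c\<in>W. \<not> cone_point (\<Delta> \<inter> Pow W) c) \<and>
      (\<exists>B\<in>\<Delta> \<inter> Pow W. card B + p = card W) \<and> (\<forall>B\<in>\<Delta> \<inter> Pow W. card B + p \<le> card W))"
    (is "_ \<longleftrightarrow> (\<exists>W. ?crit W)")
proof
  have sc: "simplicial_complex \<Delta>"
    using \<Delta> by (simp add: matroid_complex_def)
  {
    assume "\<exists>W. ?crit W"
    then obtain W B where W: "card W = s" "\<And>c. c \<in> W \<Longrightarrow> \<not> cone_point (\<Delta> \<inter> Pow W) c"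
        "B \<in> \<Delta> \<inter> Pow W" "card B + p = card W" "\<And>B. B \<in> \<Delta> \<inter> Pow W \<Longrightarrow> card B + p \<le> card W"
      by blast
    have sign: "sign_system W (usign (ind W) :: _ \<Rightarrow> _ \<Rightarrow> 'k)"
      using usign_sign_system[of "ind W"] by simp
    have bound: "card B' \<le> card B" if "B' \<in> \<Delta> \<inter> Pow W" for B'
      using W(4) W(5)[OF that] by linarith
    have "\<not> exact_at (usign (ind W) :: _ \<Rightarrow> _ \<Rightarrow> 'k) (\<Delta> \<inter> Pow W) (card B)"
      by (rule matroid_not_exact_at_top[OF sign finite Int_lower2 matroid_complex_Int_Pow[OF \<Delta>] bound W(2,3) refl])
    then obtain c where "(c :: ('e, 'k) kelem) \<in> koszul_space \<Delta> 1 (\<lambda>_. 0) (card W) p" "kos \<Delta> c = 0"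
        "\<not> (\<exists>y. c = kos \<Delta> y)"
      using koszul_not_exact[OF sc W(4)] by blast
    then show "betti F p s \<noteq> 0"
      using betti_koszul_homology[OF sc F, of p s] W(1) by blast
  }
  assume "betti F p s \<noteq> 0"
  then have "\<not> (\<forall>z\<in>koszul_space \<Delta> 1 (\<lambda>_. 0) s p. kos \<Delta> z = 0 \<longrightarrow>
      (\<exists>y\<in>koszul_space \<Delta> 1 (\<lambda>_. 0) s (Suc p). z = kos \<Delta> (y :: ('e, 'k) kelem)))"
    unfolding betti_koszul_homology[OF sc F] .
  then obtain z where z: "(z :: ('e, 'k) kelem) \<in> koszul_space \<Delta> 1 (\<lambda>_. 0) s p" "kos \<Delta> z = 0"
      "\<not> (\<exists>y\<in>koszul_space \<Delta> 1 (\<lambda>_. 0) s (Suc p). z = kos \<Delta> y)"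
    by blast
  show "\<exists>W. ?crit W"
  proof (rule ccontr)
    assume no: "\<not> (\<exists>W. ?crit W)"
    have "\<exists>y\<in>koszul_space \<Delta> 1 (\<lambda>_. 0) s (Suc p). z = kos \<Delta> y"
    proof (rule koszul_exact[OF sc z(1,2)])
      fix u :: "'e \<Rightarrow>\<^sub>0 nat" and a j
      assume a: "a < (1::nat)" and u: "0 + mdegree u = s" and j: "j + p = card (supp u)"
      let ?\<Gamma> = "strand_complex \<Delta> u"
      note cone = cone_exact_at[OF usign_sign_system finite simplicial_strand_complex(2,1)[OF sc]]
      show "exact_at (usign u :: _ \<Rightarrow> _ \<Rightarrow> 'k) ?\<Gamma> j \<or> (\<forall>\<tau>\<in>?\<Gamma>. card \<tau> = j \<longrightarrow> strand z a u \<tau> = 0)"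
      proof (cases "\<exists>c\<in>supp u. cone_point ?\<Gamma> c")
        case True
        then show ?thesis
          using cone by blast
      next
        case False
        have le1: "lkp u e \<le> 1" for e
        proof (rule ccontr)
          assume "\<not> lkp u e \<le> 1"
          then have "e \<in> supp u" "2 \<le> lkp u e"
            by (auto simp: in_keys_iff)
          then have "cone_point ?\<Gamma> e"
            by (auto simp: cone_point_def strand_complex_def insert_absorb)
          then show False
            using False \<open>e \<in> supp u\<close> by blast
        qed
        have u1: "u = ind (supp u)"
        proof (rule poly_mapping_eqI)
          fix e show "lkp u e = lkp (ind (supp u)) e"
            using le1[of e] by (auto simp: in_keys_iff)
        qed
        have "lkp u e < 2" for e
          using le1[of e] by simp
        then have \<Gamma>: "?\<Gamma> = \<Delta> \<inter> Pow (supp u)"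
          by (auto simp: strand_complex_def not_le[symmetric])
        have s: "card (supp u) = s"
          using u arg_cong[OF u1, of mdegree] by simp
        show ?thesis
        proof (cases "\<exists>B\<in>?\<Gamma>. j < card B")
          case True
          then show ?thesis
            using matroid_exact_at[OF usign_sign_system finite, of "?\<Gamma>"]
              matroid_complex_Int_Pow[OF \<Delta>] \<Gamma> by auto
        next
          \<comment> \<open>No face has more than \<open>j\<close> elements, so one with exactly
            \<open>j\<close> would make \<open>supp u\<close> meet the criterion; there is none, and
            the strand is zero in degree \<open>j\<close>.\<close>
          case bound: False
          have "\<not> (\<exists>B\<in>?\<Gamma>. card B = j)"
          proof
            assume "\<exists>B\<in>?\<Gamma>. card B = j"
            then have "\<exists>B\<in>\<Delta> \<inter> Pow (supp u). card B + p = card (supp u)"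
              using j \<Gamma> by auto
            moreover have "card B + p \<le> card (supp u)" if "B \<in> \<Delta> \<inter> Pow (supp u)" for B
            proof -
              have "card B \<le> j"
                using bound that unfolding \<Gamma> by (meson not_le)
              then show ?thesis using j by linarith
            qed
            ultimately have "?crit (supp u)"
              using s False unfolding \<Gamma> by blast
            then show False
              using no by blast
          qed
          then show ?thesis by blast
        qed
      qed
    qed
    then show False
      using z(3) by blast
  qed
qed

subsection \<open>Matroids given by rank functions\<close>

text \<open>With unit increase, \<open>rank_closure\<close> is local submodularity, in the form in
  which spaces of vanishing codewords deliver it.\<close>

locale rank_function =
  fixes r :: "'e::finite set \<Rightarrow> nat"
  assumes rank_insert: "r S \<le> r (insert e S)" "r (insert e S) \<le> Suc (r S)"
    and rank_closure: "S \<subseteq> S' \<Longrightarrow> r (insert e S) = r S \<Longrightarrow> r (insert e S') = r S'"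
begin

definition flat :: "'e set \<Rightarrow> bool" where
  "flat A \<longleftrightarrow> (\<forall>c. c \<notin> A \<longrightarrow> r (insert c A) \<noteq> r A)"

lemma rank_Un: "r S \<le> r (S \<union> T)" "r (S \<union> T) \<le> r S + card T"
proof -
  have "r S \<le> r (S \<union> T) \<and> r (S \<union> T) \<le> r S + card T"
  proof (induction T rule: finite_induct[OF finite])
    case (2 e T)
    then show ?case
      using rank_insert[where S="S \<union> T" and e=e] by simp
  qed simp
  then show "r S \<le> r (S \<union> T)" "r (S \<union> T) \<le> r S + card T" by simp_all
qed

lemma rank_mono: "S \<subseteq> T \<Longrightarrow> r S \<le> r T"
  using rank_Un(1)[of S T] by (simp add: Un_absorb1)

lemma rank_le_card_Diff: "S \<subseteq> T \<Longrightarrow> r T \<le> r S + card (T - S)"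
  using rank_Un(2)[of S "T - S"] by (simp add: Un_absorb1)

lemma rank_Un_eq:
  assumes "\<And>e. e \<in> G \<Longrightarrow> r (insert e A) = r A"
  shows "r (A \<union> G) = r A"
proof -
  have "finite G" by simp
  then show ?thesis
    using assms
  proof (induction G)
    case (insert e G)
    have "r (insert e (A \<union> G)) = r (A \<union> G)"
      by (rule rank_closure[of A]) (use insert in auto)
    then show ?case
      using insert by simp
  qed simp
qed

text \<open>\<open>G - A\<close> plays the part of a basis of \<open>U\<close> in the contraction by
  \<open>A\<close>. For \<open>U = UNIV\<close> the complement of \<open>G\<close> is a largest face
  of the dual inside \<open>- A\<close>.\<close>

lemma spanning_extension:
  assumes "A \<subseteq> U"
  shows "\<exists>G. A \<subseteq> G \<and> G \<subseteq> U \<and> r G = r U \<and> card (G - A) = r U - r A"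
  using assms
proof (induction "r U - r A" arbitrary: A)
  case 0
  then show ?case
    using rank_mono[of A U] by (intro exI[of _ A]) simp
next
  case (Suc n)
  have "A \<union> U = U"
    using Suc.prems by auto
  have "\<exists>e\<in>U. r (insert e A) \<noteq> r A"
  proof (rule ccontr)
    assume "\<not> (\<exists>e\<in>U. r (insert e A) \<noteq> r A)"
    then have "r (A \<union> U) = r A"
      by (intro rank_Un_eq) blast
    then show False
      using \<open>A \<union> U = U\<close> Suc.hyps(2) by simp
  qed
  then obtain e where e: "e \<in> U" "r (insert e A) \<noteq> r A"
    by blast
  then have re: "r (insert e A) = Suc (r A)" and "e \<notin> A"
    using rank_insert[where S=A and e=e] by (auto simp: le_Suc_eq insert_absorb)
  obtain G where G: "insert e A \<subseteq> G" "G \<subseteq> U" "r G = r U" "card (G - insert e A) = r U - r (insert e A)"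
  proof -
    have "n = r U - r (insert e A)" "insert e A \<subseteq> U"
      using Suc.hyps(2) Suc.prems e(1) re by auto
    then show ?thesis
      using Suc.hyps(1) that by blast
  qed
  have "G - A = insert e (G - insert e A)"
    using G(1) \<open>e \<notin> A\<close> by auto
  then have "card (G - A) = Suc (card (G - insert e A))"
    by simp
  then have "card (G - A) = r U - r A"
    using G(4) re Suc.hyps(2) by simp
  then show ?case
    using G by blast
qed

text \<open>A largest superset of \<open>A\<close> of rank at most \<open>m\<close> works: one more
  element pushes the rank above \<open>m\<close>, which makes it a flat, and unit increase then
  leaves only the value \<open>m\<close>.\<close>

lemma flat_extension:
  assumes "r A \<le> m" "m \<le> r UNIV"
  shows "\<exists>B. A \<subseteq> B \<and> r B = m \<and> flat B"
proof -
  let ?P = "\<lambda>B. A \<subseteq> B \<and> r B \<le> m"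
  have "card B < Suc (CARD('e))" for B :: "'e set"
    using card_mono[of UNIV B] by simp
  then have "\<exists>B. ?P B \<and> (\<forall>B'. ?P B' \<longrightarrow> card B' \<le> card B)"
    using assms by (intro ex_has_greatest_nat[of ?P A card "Suc (CARD('e))"]) auto
  then obtain B where B: "?P B" "\<And>B'. ?P B' \<Longrightarrow> card B' \<le> card B"
    by blast
  have grow: "m < r (insert c B)" if "c \<notin> B" for c
  proof (rule ccontr)
    assume "\<not> m < r (insert c B)"
    then have "card (insert c B) \<le> card B"
      using B(1) by (intro B(2)) auto
    then show False
      using that by simp
  qed
  have "flat B"
    unfolding flat_def
  proof (intro allI impI notI)
    fix c assume "c \<notin> B" "r (insert c B) = r B"
    then show False
      using grow[of c] B(1) by simp
  qed
  moreover have "r B = m"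
  proof (cases "B = UNIV")
    case True
    then show ?thesis using B(1) assms(2) by simp
  next
    case False
    then obtain c where "c \<notin> B" by blast
    then show ?thesis
      using grow[of c] rank_insert(2)[where S=B and e=c] B(1) by linarith
  qed
  ultimately show ?thesis
    using B(1) by blast
qed

section \<open>The dual of a matroid given by its rank\<close>

lemma dual_indep_iff: "\<sigma> \<in> indep_complex (dual_rank r) \<longleftrightarrow> r (- \<sigma>) = r UNIV"
proof -
  \<comment> \<open>The second inequality keeps the subtraction in \<open>dual_rank\<close> from
    being truncated.\<close>
  have "r (- \<sigma>) \<le> r UNIV" "r UNIV \<le> r (- \<sigma>) + card \<sigma>"
    using rank_mono[of "- \<sigma>" UNIV] rank_le_card_Diff[of "- \<sigma>" UNIV] by simp_all
  then show ?thesis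
    by (auto simp: indep_complex_def dual_rank_def Compl_eq_Diff_UNIV)
qed

lemma dual_matroid_complex: "matroid_complex (indep_complex (dual_rank r))"
  unfolding matroid_complex_def
proof (intro conjI ballI impI)
  let ?\<Delta> = "indep_complex (dual_rank r)"
  show "{} \<in> ?\<Delta>"
    by (simp add: dual_indep_iff)
  show "simplicial_complex ?\<Delta>"
    unfolding simplicial_complex_def
  proof (intro ballI allI impI)
    fix \<tau> \<sigma> assume "\<tau> \<in> ?\<Delta>" "\<sigma> \<subseteq> \<tau>"
    then show "\<sigma> \<in> ?\<Delta>"
      using rank_mono[of "- \<tau>" "- \<sigma>"] rank_mono[of "- \<sigma>" UNIV] by (simp add: dual_indep_iff)
  qed
  fix I J assume I: "I \<in> ?\<Delta>" and J: "J \<in> ?\<Delta>" and lt: "card I < card J"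
  let ?A = "- (I \<union> J)"
  \<comment> \<open>\<open>G\<close> arises from \<open>?A\<close> by adding elements of
    \<open>J - I\<close>, at most \<open>card (I - J)\<close> of them. So one element of
    \<open>J - I\<close> is left over, and the complement of \<open>I\<close> stays spanning without
    it.\<close>
  obtain G where G: "?A \<subseteq> G" "G \<subseteq> - I" "r G = r (- I)" "card (G - ?A) = r (- I) - r ?A"
    using spanning_extension[of ?A "- I"] by auto
  have "r (- J) \<le> r ?A + card (- J - ?A)"
    by (rule rank_le_card_Diff) auto
  also have "- J - ?A = I - J"
    by auto
  finally have "card (G - ?A) \<le> card (I - J)"
    using G(4) I J by (simp add: dual_indep_iff)
  also have "\<dots> < card (J - I)"
    using lt card_Int_Diff[of I J] card_Int_Diff[of J I] by (simp add: Int_commute)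
  finally have "\<not> J - I \<subseteq> G - ?A"
    using card_mono[of "G - ?A" "J - I"] by auto
  then obtain e where e: "e \<in> J - I" "e \<notin> G"
    by blast
  then have "r G \<le> r (- insert e I)"
    using G(2) by (intro rank_mono) auto
  then have "r (- insert e I) = r UNIV"
    using G(3) I rank_mono[of "- insert e I" UNIV] by (simp add: dual_indep_iff)
  then show "\<exists>e\<in>J - I. insert e I \<in> ?\<Delta>"
    using e(1) by (auto simp: dual_indep_iff)
qed

text \<open>The dual restricted to \<open>- A\<close> is dual to the contraction by
  \<open>A\<close>, and coloops of a dual are loops.\<close>

lemma dual_cone_point_iff:
  assumes c: "c \<notin> A"
  shows "cone_point (indep_complex (dual_rank r) \<inter> Pow (- A)) c \<longleftrightarrow> r (insert c A) = r A"
    (is "cone_point (?\<Delta> \<inter> _) c \<longleftrightarrow> _")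
proof
  assume cone: "cone_point (?\<Delta> \<inter> Pow (- A)) c"
  show "r (insert c A) = r A"
  proof (rule ccontr)
    assume "r (insert c A) \<noteq> r A"
    then have rc: "r (insert c A) = Suc (r A)"
      using rank_insert[where S=A and e=c] by (simp add: le_Suc_eq)
    \<comment> \<open>Beyond \<open>insert c A\<close> this \<open>G\<close> has just as many
      elements as the missing rank, so without \<open>c\<close> it falls one short of
      spanning.\<close>
    obtain G where G: "insert c A \<subseteq> G" "r G = r UNIV" "card (G - insert c A) = r UNIV - r (insert c A)"
      using spanning_extension[of "insert c A" UNIV] by auto
    then have "- G \<in> ?\<Delta> \<inter> Pow (- A)"
      by (auto simp: dual_indep_iff)
    then have "insert c (- G) \<in> ?\<Delta>"
      using cone by (auto simp: cone_point_def)
    moreover have "- insert c (- G) = G - {c}"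
      by auto
    ultimately have "r (G - {c}) = r UNIV"
      by (simp add: dual_indep_iff)
    moreover have "r (G - {c}) \<le> r A + card (G - {c} - A)"
      using G(1) c by (intro rank_le_card_Diff) auto
    moreover have "G - {c} - A = G - insert c A"
      by auto
    moreover have "r (insert c A) \<le> r UNIV"
      by (rule rank_mono) auto
    ultimately show False
      using G(3) rc by simp
  qed
next
  assume eq: "r (insert c A) = r A"
  show "cone_point (?\<Delta> \<inter> Pow (- A)) c"
    unfolding cone_point_def
  proof
    fix \<tau> assume \<tau>: "\<tau> \<in> ?\<Delta> \<inter> Pow (- A)"
    have "A \<subseteq> - \<tau> - {c}"
      using \<tau> c by auto
    then have "r (insert c (- \<tau> - {c})) = r (- \<tau> - {c})"
      using eq by (rule rank_closure)
    moreover have "r (- \<tau>) \<le> r (insert c (- \<tau> - {c}))"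
      by (rule rank_mono) auto
    moreover have "- \<tau> - {c} = - insert c \<tau>"
      by auto
    ultimately have "r UNIV \<le> r (- insert c \<tau>)"
      using \<tau> by (simp add: dual_indep_iff)
    then have "insert c \<tau> \<in> ?\<Delta>"
      using rank_mono[of "- insert c \<tau>" UNIV] by (simp add: dual_indep_iff)
    then show "insert c \<tau> \<in> ?\<Delta> \<inter> Pow (- A)"
      using \<tau> c by auto
  qed
qed

text \<open>On \<open>- A\<close> the dual has rank \<open>card (- A) - (r UNIV - r A)\<close>, so
  the criterion for \<open>W = - A\<close> asks for corank \<open>p\<close>.\<close>

theorem betti_dual_iff_flat:
  fixes F :: "('e, 'k::field) free_complex"
  assumes F: "minimal_graded_free_resolution (stanley_reisner_ideal (indep_complex (dual_rank r))) F"
  shows "betti F p s \<noteq> 0 \<longleftrightarrow> (\<exists>A. flat A \<and> r A + p = r UNIV \<and> card (- A) = s)"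
proof -
  let ?\<Delta> = "indep_complex (dual_rank r)"
  have crit: "(\<exists>B\<in>?\<Delta> \<inter> Pow (- A). card B + p = card (- A)) \<and>
      (\<forall>B\<in>?\<Delta> \<inter> Pow (- A). card B + p \<le> card (- A)) \<longleftrightarrow> r A + p = r UNIV" for A
  proof -
    have bound: "r UNIV \<le> r A + (card (- A) - card B)" "card B \<le> card (- A)"
      if B: "B \<in> ?\<Delta> \<inter> Pow (- A)" for B
    proof -
      have "r (- B) \<le> r A + card (- B - A)"
        using B by (intro rank_le_card_Diff) auto
      moreover have "- B - A = - A - B"
        by auto
      ultimately show "r UNIV \<le> r A + (card (- A) - card B)"
        using B card_Diff_subset[of B "- A"] by (simp add: dual_indep_iff)
      show "card B \<le> card (- A)"
        using B by (intro card_mono) auto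
    qed
    obtain G where G: "A \<subseteq> G" "r G = r UNIV" "card (G - A) = r UNIV - r A"
      using spanning_extension[of A UNIV] by auto
    have G\<Delta>: "- G \<in> ?\<Delta> \<inter> Pow (- A)"
      using G by (auto simp: dual_indep_iff)
    have "- A = - G \<union> (G - A)"
      using G(1) by auto
    then have "card (- A) = card (- G) + (r UNIV - r A)"
      using card_Un_disjoint[of "- G" "G - A"] G(3) by auto
    moreover have "r A \<le> r UNIV"
      by (rule rank_mono) simp
    ultimately have cG: "card (- G) + r UNIV = card (- A) + r A"
      by simp
    show ?thesis
    proof
      assume "(\<exists>B\<in>?\<Delta> \<inter> Pow (- A). card B + p = card (- A)) \<and>
        (\<forall>B\<in>?\<Delta> \<inter> Pow (- A). card B + p \<le> card (- A))"
      then obtain B where B: "B \<in> ?\<Delta> \<inter> Pow (- A)" "card B + p = card (- A)" "card (- G) + p \<le> card (- A)"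
        using G\<Delta> by blast
      then show "r A + p = r UNIV"
        using bound[OF B(1)] cG by linarith
    next
      assume p: "r A + p = r UNIV"
      have "card (- G) + p = card (- A)"
        using cG p by linarith
      moreover have "card B + p \<le> card (- A)" if "B \<in> ?\<Delta> \<inter> Pow (- A)" for B
        using bound[OF that] p by linarith
      ultimately show "(\<exists>B\<in>?\<Delta> \<inter> Pow (- A). card B + p = card (- A)) \<and>
        (\<forall>B\<in>?\<Delta> \<inter> Pow (- A). card B + p \<le> card (- A))"
        using G\<Delta> by blast
    qed
  qed
  have flat: "(\<forall>c\<in>- A. \<not> cone_point (?\<Delta> \<inter> Pow (- A)) c) \<longleftrightarrow> flat A" for A
    using dual_cone_point_iff[of _ A] by (auto simp: flat_def)
  have ex_Compl: "(\<exists>W. P W) \<longleftrightarrow> (\<exists>A. P (- A))" for P :: "'e set \<Rightarrow> bool"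
    by (metis double_compl)
  have "betti F p s \<noteq> 0 \<longleftrightarrow> (\<exists>A. card (- A) = s \<and> (\<forall>c\<in>- A. \<not> cone_point (?\<Delta> \<inter> Pow (- A)) c) \<and>
      (\<exists>B\<in>?\<Delta> \<inter> Pow (- A). card B + p = card (- A)) \<and> (\<forall>B\<in>?\<Delta> \<inter> Pow (- A). card B + p \<le> card (- A)))"
    by (rule trans[OF betti_matroid_complex[OF dual_matroid_complex F] ex_Compl])
  then show ?thesis
    unfolding crit flat by blast
qed

end

subsection \<open>Subspaces over a finite field\<close>

lemma card_span_independent:
  fixes B :: "('q::{field,finite} ^ 'n::finite) set"
  assumes "vec.independent B"
  shows "card (vec.span B) = CARD('q) ^ card B"
proof -
  have "finite B"
    using assms by (rule vec.finiteI_independent)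
  then show ?thesis
    using assms
  proof (induction B)
    case empty
    then show ?case by simp
  next
    case (insert a B)
    have a: "vec.independent B" "a \<notin> vec.span B"
      using insert.prems insert.hyps by (auto simp: vec.independent_insert)
    let ?f = "\<lambda>(k, w). k *s a + w"
    have "inj_on ?f (UNIV \<times> vec.span B)"
    proof (rule inj_onI, clarify)
      fix k w k' w'
      assume w: "w \<in> vec.span B" "w' \<in> vec.span B" and eq: "k *s a + w = k' *s a + w'"
      have "k = k'"
      proof (rule ccontr)
        assume "k \<noteq> k'"
        have "(k - k') *s a = w' - w"
          using eq by (simp add: vec.scale_left_diff_distrib algebra_simps)
        then have "(k - k') *s a \<in> vec.span B"
          using w by (simp add: vec.span_diff)
        then have "inverse (k - k') *s ((k - k') *s a) \<in> vec.span B"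
          by (rule vec.span_scale)
        moreover have "inverse (k - k') * (k - k') = 1"
          using \<open>k \<noteq> k'\<close> by simp
        ultimately show False
          using a(2) unfolding vec.scale_scale by simp
      qed
      then show "k = k' \<and> w = w'"
        using eq by simp
    qed
    moreover have "?f ` (UNIV \<times> vec.span B) = vec.span (insert a B)"
    proof
      show "?f ` (UNIV \<times> vec.span B) \<subseteq> vec.span (insert a B)"
      proof clarify
        fix k w assume "w \<in> vec.span B"
        then have "w \<in> vec.span (insert a B)"
          using vec.span_mono[of B "insert a B"] by blast
        then show "k *s a + w \<in> vec.span (insert a B)"
          by (intro vec.span_add vec.span_scale) (simp_all add: vec.span_base)
      qed
      show "vec.span (insert a B) \<subseteq> ?f ` (UNIV \<times> vec.span B)"
      proof
        fix x assume "x \<in> vec.span (insert a B)"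
        then obtain k where "x - k *s a \<in> vec.span B"
          by (auto simp: vec.span_insert)
        then show "x \<in> ?f ` (UNIV \<times> vec.span B)"
          by (intro image_eqI[of _ _ "(k, x - k *s a)"]) auto
      qed
    qed
    ultimately have "card (vec.span (insert a B)) = CARD('q) * card (vec.span B)"
      by (metis card_image card_cartesian_product)
    then show ?case
      using insert a(1) by simp
  qed
qed

lemma card_subspace:
  fixes X :: "('q::{field,finite} ^ 'n::finite) set"
  assumes "vec.subspace X"
  shows "card X = CARD('q) ^ vec.dim X"
proof -
  obtain B where B: "B \<subseteq> X" "vec.independent B" "X \<subseteq> vec.span B" "card B = vec.dim X"
    by (rule vec.basis_exists)
  have "vec.span B = X"
    using B(1,3) assms by (simp add: subset_antisym vec.span_minimal)
  then show ?thesis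
    using card_span_independent[OF B(2)] B(4) by simp
qed

section \<open>Projective points and their number\<close>

lemma proj_point_span:
  fixes p :: "('q::field, 'n::finite) proj_point"
  obtains v where "v \<noteq> 0" "Rep_proj_point p = vec.span {v}"
proof -
  have p: "vec.subspace (Rep_proj_point p)" "vec.dim (Rep_proj_point p) = 1"
    using Rep_proj_point[of p] by auto
  obtain B where B: "B \<subseteq> Rep_proj_point p" "vec.independent B" "Rep_proj_point p \<subseteq> vec.span B"
      "card B = vec.dim (Rep_proj_point p)"
    by (rule vec.basis_exists)
  obtain v where v: "B = {v}"
    using B(4) p(2) by (auto simp: card_1_singleton_iff)
  have "v \<noteq> 0"
    using B(2) v vec.dependent_zero by blast
  moreover have "Rep_proj_point p = vec.span {v}"
    using B(1,3) v p(1) by (simp add: subset_antisym vec.span_minimal)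
  ultimately show ?thesis
    using that by blast
qed

lemma ex_proj_point:
  fixes v :: "'q::field ^ 'n::finite"
  assumes "v \<noteq> 0"
  obtains p where "Rep_proj_point p = vec.span {v}"
proof -
  have "vec.dim {v} = 1"
    using assms by (subst vec.dim_eq_card_independent) (auto simp: vec.independent_insert)
  then have "vec.span {v} \<in> {U. vec.subspace U \<and> vec.dim U = 1}"
    by (simp add: vec.dim_span)
  then show ?thesis
    using that[of "Abs_proj_point (vec.span {v})"] Abs_proj_point_inverse by blast
qed

lemma proj_point_determined:
  fixes p :: "('q::field, 'n::finite) proj_point"
  assumes "v \<in> Rep_proj_point p" "v \<noteq> 0"
  shows "Rep_proj_point p = vec.span {v}"
proof -
  obtain w where w: "w \<noteq> 0" "Rep_proj_point p = vec.span {w}"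
    by (rule proj_point_span)
  then obtain k where k: "v = k *s w"
    using assms(1) by (auto simp: vec.span_singleton)
  then have "k \<noteq> 0"
    using assms(2) by auto
  then have "w = inverse k *s v"
    using k by (simp add: vec.scale_scale)
  then have "w \<in> vec.span {v}" "v \<in> vec.span {w}"
    using k by (auto simp: vec.span_singleton)
  then show ?thesis
    using w(2) by (simp add: subset_antisym vec.span_minimal)
qed

text \<open>The vectors outside \<open>X\<close> fall into punctured lines, one for each point not
  contained in \<open>X\<close>, with \<open>CARD('q) - 1\<close> vectors each.\<close>

lemma card_points_outside:
  fixes X :: "('q::{field,finite} ^ 'n::finite) set"
  assumes X: "vec.subspace X"
  defines "P \<equiv> {p :: ('q, 'n) proj_point. \<not> Rep_proj_point p \<subseteq> X}"
  shows "(CARD('q) - 1) * card P + CARD('q) ^ vec.dim X = CARD('q) ^ CARD('n)"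
proof -
  have "- X = (\<Union>p\<in>P. Rep_proj_point p - {0})"
  proof
    show "- X \<subseteq> (\<Union>p\<in>P. Rep_proj_point p - {0})"
    proof
      fix v assume v: "v \<in> - X"
      then have "v \<noteq> 0"
        using X vec.subspace_0 by auto
      moreover from this obtain p :: "('q, 'n) proj_point" where "Rep_proj_point p = vec.span {v}"
        by (rule ex_proj_point)
      moreover have "v \<in> vec.span {v}"
        by (simp add: vec.span_base)
      ultimately show "v \<in> (\<Union>p\<in>P. Rep_proj_point p - {0})"
        using v by (auto simp: P_def)
    qed
    show "(\<Union>p\<in>P. Rep_proj_point p - {0}) \<subseteq> - X"
    proof
      fix v assume "v \<in> (\<Union>p\<in>P. Rep_proj_point p - {0})"
      then obtain p where p: "p \<in> P" "v \<in> Rep_proj_point p" "v \<noteq> 0"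
        by blast
      then have "\<not> vec.span {v} \<subseteq> X"
        using proj_point_determined by (auto simp: P_def)
      then show "v \<in> - X"
        using vec.span_minimal[OF _ X, of "{v}"] by auto
    qed
  qed
  moreover have "card (\<Union>p\<in>P. Rep_proj_point p - {0}) = (\<Sum>p\<in>P. card (Rep_proj_point p - {0}))"
  proof (rule card_UN_disjoint)
    show "\<forall>i\<in>P. \<forall>j\<in>P. i \<noteq> j \<longrightarrow> (Rep_proj_point i - {0}) \<inter> (Rep_proj_point j - {0}) = {}"
    proof (intro ballI impI equals0I)
      fix i j v assume "i \<noteq> j" "v \<in> (Rep_proj_point i - {0}) \<inter> (Rep_proj_point j - {0})"
      then show False
        using proj_point_determined[of v i] proj_point_determined[of v j] Rep_proj_point_inject[of i j] by simp
    qed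
  qed auto
  moreover have "card (Rep_proj_point p - {0}) = CARD('q) - 1" for p :: "('q, 'n) proj_point"
  proof -
    have p: "vec.subspace (Rep_proj_point p)" "vec.dim (Rep_proj_point p) = 1"
      using Rep_proj_point[of p] by auto
    then show ?thesis
      using card_subspace[OF p(1)] card_Diff_singleton[OF vec.subspace_0[OF p(1)]] by simp
  qed
  ultimately have "card (- X) = (CARD('q) - 1) * card P"
    by simp
  then show ?thesis
    using card_Compl_add[of X] card_subspace[OF X] by simp
qed

lemma card_field_ge_2: "2 \<le> CARD('q::{field,finite})"
  using card_mono[of UNIV "{0, 1 :: 'q}"] by simp

text \<open>This is \<open>[j] = (q^n - q^(n-j)) / (q - 1)\<close> without the division, the form of
  \<open>card_points_outside\<close> for codimension \<open>j\<close>.\<close>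

lemma qbracket_eq:
  assumes "j \<le> n" "1 \<le> q"
  shows "(q - 1) * qbracket q n j + q ^ (n - j) = q ^ n"
  using assms(1)
proof (induction j)
  case 0
  then show ?case by (simp add: qbracket_def)
next
  case (Suc j)
  have "(q - 1) * q ^ (n - Suc j) + q ^ (n - Suc j) = q * q ^ (n - Suc j)"
    using assms(2) by (simp add: diff_mult_distrib)
  also have "\<dots> = q ^ (n - j)"
    using Suc.prems by (simp add: Suc_diff_Suc flip: power_Suc)
  finally show ?case
    using Suc by (simp add: qbracket_def distrib_left)
qed

text \<open>Lets a codimension be recovered from a Betti degree.\<close>

lemma qbracket_inject:
  assumes "j \<le> n" "j' \<le> n" "2 \<le> q" "qbracket q n j = qbracket q n j'"
  shows "j = j'"
proof -
  have "q ^ (n - j) = q ^ (n - j')"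
    using qbracket_eq[of j n q] qbracket_eq[of j' n q] assms(1-3) unfolding assms(4) by linarith
  then show ?thesis
    using assms by (simp add: power_inject_exp)
qed

lemma card_points_outside_qbracket:
  fixes X :: "('q::{field,finite} ^ 'n::finite) set"
  assumes "vec.subspace X"
  shows "card {p :: ('q, 'n) proj_point. \<not> Rep_proj_point p \<subseteq> X}
    = qbracket CARD('q) CARD('n) (CARD('n) - vec.dim X)"
proof -
  have d: "vec.dim X \<le> CARD('n)"
    by (rule dim_subset_UNIV_cart_gen)
  have n: "CARD('n) - (CARD('n) - vec.dim X) = vec.dim X"
    using d by simp
  have "(CARD('q) - 1) * card {p :: ('q, 'n) proj_point. \<not> Rep_proj_point p \<subseteq> X}
      = (CARD('q) - 1) * qbracket CARD('q) CARD('n) (CARD('n) - vec.dim X)"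
    using card_points_outside[OF assms] qbracket_eq[of "CARD('n) - vec.dim X" "CARD('n)" "CARD('q)"]
      card_field_ge_2[where 'q='q] unfolding n by linarith
  then show ?thesis
    using card_field_ge_2[where 'q='q] by simp
qed

subsection \<open>Vanishing subcodes\<close>

text \<open>A vector over the small field acts as a linear functional on vectors over the large one;
  subcodes cut out by such functionals stand in for conditions on supports.\<close>

definition ext_product ::
  "('q::field \<Rightarrow> 'l::field) \<Rightarrow> 'q ^ 'n::finite \<Rightarrow> 'l ^ 'n \<Rightarrow> 'l" where
  "ext_product h v c = (\<Sum>j\<in>UNIV. h (v $ j) * c $ j)"

definition vanish ::
  "('q::field \<Rightarrow> 'l::field) \<Rightarrow> ('l ^ 'n::finite) set \<Rightarrow> ('q ^ 'n) set \<Rightarrow> ('l ^ 'n) set" where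
  "vanish h C V = {c \<in> C. \<forall>v\<in>V. ext_product h v c = 0}"

lemma ext_product_right:
  "ext_product h v (c + c') = ext_product h v c + ext_product h v c'"
  "ext_product h v (a *s c) = a * ext_product h v c"
  "ext_product h v 0 = 0"
  by (simp_all add: ext_product_def distrib_left sum.distrib sum_distrib_left mult.left_commute)

lemma field_embedding_simps:
  assumes "field_embedding h"
  shows "h 0 = 0" "h 1 = 1" "h (x + y) = h x + h y" "h (x * y) = h x * h y"
proof -
  have "h (0 + 0) = h 0 + h 0"
    using assms unfolding field_embedding_def by blast
  then have "h 0 = h 0 + h 0"
    by (simp only: add_0_right)
  then show "h 0 = 0"
    by (metis add_cancel_right_right)
qed (use assms in \<open>auto simp: field_embedding_def\<close>)

lemma field_embedding_sum: "field_embedding h \<Longrightarrow> h (\<Sum>i\<in>A. f i) = (\<Sum>i\<in>A. h (f i))"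
  by (induction A rule: infinite_finite_induct) (simp_all add: field_embedding_simps)

lemma ext_product_left:
  assumes "field_embedding h"
  shows "ext_product h (v + v') c = ext_product h v c + ext_product h v' c"
    "ext_product h (a *s v) c = h a * ext_product h v c" "ext_product h 0 c = 0"
  by (simp_all add: ext_product_def field_embedding_simps[OF assms] distrib_right sum.distrib
      sum_distrib_left mult.assoc)

lemma vanish_subspace: "vec.subspace C \<Longrightarrow> vec.subspace (vanish h C V)"
  by (auto simp: vanish_def vec.subspace_def ext_product_right)

lemma vanish_Un: "vanish h C (V \<union> W) = vanish h C V \<inter> vanish h C W"
  by (auto simp: vanish_def)

lemma vanish_mono: "V \<subseteq> W \<Longrightarrow> vanish h C W \<subseteq> vanish h C V"
  by (auto simp: vanish_def)

lemma vanish_span: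
  assumes "field_embedding h"
  shows "vanish h C (vec.span V) = vanish h C V"
proof
  show "vanish h C (vec.span V) \<subseteq> vanish h C V"
    by (intro vanish_mono) (auto intro: vec.span_base)
  show "vanish h C V \<subseteq> vanish h C (vec.span V)"
  proof
    fix c assume c: "c \<in> vanish h C V"
    have "ext_product h v c = 0" if "v \<in> vec.span V" for v
      using that c by (induction rule: vec.span_induct_alt) (auto simp: vanish_def ext_product_left[OF assms])
    then show "c \<in> vanish h C (vec.span V)"
      using c by (auto simp: vanish_def)
  qed
qed

lemma vanish_UNIV:
  assumes "field_embedding h"
  shows "vanish h C UNIV \<subseteq> {0}"
proof
  fix c assume c: "c \<in> vanish h C UNIV"
  have "c $ j = 0" for j
  proof -
    have "ext_product h (axis j 1) c = 0"
      using c by (simp add: vanish_def)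
    moreover have "ext_product h (axis j 1) c = (\<Sum>i\<in>UNIV. if i = j then c $ i else 0)"
      unfolding ext_product_def
      by (rule sum.cong) (auto simp: axis_def field_embedding_simps[OF assms])
    ultimately show ?thesis by simp
  qed
  then show "c \<in> {0}"
    by (simp add: vec_eq_iff)
qed

text \<open>The kernel of one further functional has codimension at most one: a vector
  \<open>c0\<close> with nonzero value spans a complement.\<close>

lemma dim_vanish_insert:
  assumes C: "vec.subspace C"
  shows "vec.dim (vanish h C V) \<le> Suc (vec.dim (vanish h C (insert v V)))"
proof (cases "\<exists>c0\<in>vanish h C V. ext_product h v c0 \<noteq> 0")
  case True
  then obtain c0 where c0: "c0 \<in> vanish h C V" "ext_product h v c0 \<noteq> 0"
    by blast
  let ?D = "vanish h C (insert v V)"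
  have "vanish h C V \<subseteq> vec.span (insert c0 ?D)"
  proof
    fix c assume c: "c \<in> vanish h C V"
    let ?k = "ext_product h v c / ext_product h v c0"
    have d: "c + (- ?k) *s c0 \<in> vanish h C V"
      using c c0(1) vanish_subspace[OF C, of h V] by (simp only: vec.subspace_def)
    moreover have "ext_product h v (c + (- ?k) *s c0) = 0"
      using c0(2) unfolding ext_product_right by simp
    ultimately have "c + (- ?k) *s c0 \<in> ?D"
      by (auto simp: vanish_def)
    then have "c - ?k *s c0 \<in> vec.span ?D"
      by (simp add: vec.span_base vec.scale_minus_left)
    then show "c \<in> vec.span (insert c0 ?D)"
      unfolding vec.span_insert by blast
  qed
  then have "vec.dim (vanish h C V) \<le> vec.dim (insert c0 ?D)"
    by (rule vec.dim_mono)
  also have "\<dots> \<le> Suc (vec.dim ?D)"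
    by (simp add: vec.dim_insert)
  finally show ?thesis .
next
  case False
  then have "vanish h C (insert v V) = vanish h C V"
    by (auto simp: vanish_def)
  then show ?thesis by simp
qed

lemma dim_vanish_Un:
  assumes "vec.subspace C" "finite B"
  shows "vec.dim (vanish h C V) \<le> vec.dim (vanish h C (V \<union> B)) + card B"
  using assms(2)
proof (induction B)
  case (insert v B)
  then show ?case
    using dim_vanish_insert[OF assms(1), of h "V \<union> B" v] by simp
qed simp

section \<open>Orthogonal complements\<close>

lemma field_embedding_id: "field_embedding (\<lambda>x. x)"
  by (simp add: field_embedding_def)

text \<open>With the identity as embedding, orthogonal complements inherit the span and dimension
  lemmas of vanishing spaces.\<close>

lemma orth_compl_eq_vanish: "orth_compl X = vanish (\<lambda>x. x) UNIV X"
  by (simp add: orth_compl_def vanish_def ext_product_def scalar_product_def)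

lemma orth_compl_span: "orth_compl (vec.span V) = orth_compl V"
  unfolding orth_compl_eq_vanish by (rule vanish_span[OF field_embedding_id])

lemma orth_compl_subspace: "vec.subspace (orth_compl X)"
  unfolding orth_compl_eq_vanish by (rule vanish_subspace) simp

lemma subset_orth_compl_iff: "Y \<subseteq> orth_compl X \<longleftrightarrow> X \<subseteq> orth_compl Y"
proof -
  have "scalar_product v w = scalar_product w v" for v w :: "'a ^ 'b"
    by (simp add: scalar_product_def mult.commute)
  moreover have "Y \<subseteq> orth_compl X \<longleftrightarrow> (\<forall>y\<in>Y. \<forall>x\<in>X. scalar_product x y = 0)"
    for X Y :: "('a ^ 'b) set"
    by (auto simp: orth_compl_def)
  ultimately show ?thesis
    by metis
qed

text \<open>Over a general field a subspace may meet its orthogonal complement nontrivially, so no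
  direct sum is at hand. Instead a basis of \<open>X\<close> is extended to the whole space: its
  \<open>n\<close> functionals cut the dimension from \<open>n\<close> to \<open>0\<close>, at most
  one each, so those in \<open>X\<close> cut exactly \<open>vec.dim X\<close>.\<close>

lemma dim_orth_compl:
  fixes X :: "('q::field ^ 'n::finite) set"
  shows "vec.dim (orth_compl X) + vec.dim X = CARD('n)"
proof -
  obtain B0 where B0: "B0 \<subseteq> X" "vec.independent B0" "X \<subseteq> vec.span B0" "card B0 = vec.dim X"
    by (rule vec.basis_exists)
  obtain B where B: "B0 \<subseteq> B" "vec.independent B" "UNIV \<subseteq> vec.span B"
    by (rule vec.maximal_independent_subset_extend[OF subset_UNIV B0(2)])
  have fin: "finite B"
    using B(2) by (rule vec.finiteI_independent)
  have sB: "vec.span B = UNIV"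
    using B(3) by blast
  then have "vec.dim (UNIV :: ('q ^ 'n) set) = card B"
    using B(2) by (intro vec.dim_eq_card) simp_all
  then have cB: "card B = CARD('n)"
    by (simp only: vec_dim_card)
  have X: "orth_compl X = orth_compl B0"
  proof
    show "orth_compl X \<subseteq> orth_compl B0"
      using B0(1) by (auto simp: orth_compl_def)
    have "orth_compl (vec.span B0) \<subseteq> orth_compl X"
      using B0(3) by (auto simp: orth_compl_def)
    then show "orth_compl B0 \<subseteq> orth_compl X"
      by (simp add: orth_compl_span)
  qed
  let ?v = "vanish (\<lambda>x :: 'q. x) UNIV :: ('q ^ 'n) set \<Rightarrow> _"
  have "?v {} = UNIV"
    by (simp add: vanish_def)
  then have "CARD('n) \<le> vec.dim (?v B0) + card B0"
    using dim_vanish_Un[OF vec.subspace_UNIV finite_subset[OF B(1) fin], of "\<lambda>x. x" "{}"]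
    by (simp only: vec_dim_card Un_empty_left)
  moreover have "vec.dim (?v B0) \<le> card (B - B0)"
  proof -
    have "?v B \<subseteq> {0}"
      using vanish_UNIV[OF field_embedding_id] unfolding vanish_span[OF field_embedding_id, of _ B, symmetric] sB .
    then have "vec.dim (?v B) = 0"
      by (simp only: vec.dim_eq_0)
    moreover have "B0 \<union> (B - B0) = B"
      using B(1) by blast
    ultimately show ?thesis
      using dim_vanish_Un[OF vec.subspace_UNIV finite_Diff[OF fin], of "\<lambda>x. x" B0 B0] by (simp only: add_0)
  qed
  moreover have "card (B - B0) + card B0 = card B"
    using card_Diff_subset[OF finite_subset[OF B(1) fin] B(1)] card_mono[OF fin B(1)] by simp
  ultimately have "vec.dim (?v B0) + card B0 = CARD('n)"
    using cB by linarith
  then show ?thesis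
    using X B0(4) by (simp add: orth_compl_eq_vanish)
qed

subsection \<open>The matroid of a rank-metric code\<close>

lemma vector_space_ext_scale:
  assumes "field_embedding h"
  shows "vector_space (ext_scale h)"
  by unfold_locales (simp_all add: ext_scale_def field_embedding_simps[OF assms] algebra_simps)

text \<open>Expanding the entries of \<open>c\<close> in the basis turns the functional into a
  combination of the \<open>b i\<close> whose coefficients are the products of \<open>v\<close> with
  the rows; independence makes each of them vanish.\<close>

lemma ext_product_eq_0_iff:
  fixes h :: "'q::field \<Rightarrow> 'l::field" and b :: "'m::finite \<Rightarrow> 'l"
  assumes h: "field_embedding h" and b: "ext_basis h b"
  shows "ext_product h v c = 0 \<longleftrightarrow> (\<forall>i. scalar_product (row i (code_matrix h b c)) v = 0)"
proof -
  interpret E: vector_space "ext_scale h"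
    by (rule vector_space_ext_scale[OF h])
  have inj: "inj b" and indep: "\<not> E.dependent (range b)" and span: "E.span (range b) = UNIV"
    using b by (simp_all add: ext_basis_def)
  let ?M = "code_matrix h b c"
  let ?x = "\<lambda>i. scalar_product (row i ?M) v"
  have c: "c $ j = (\<Sum>i\<in>UNIV. h (?M $ i $ j) * b i)" for j
  proof -
    have "c $ j = (\<Sum>x\<in>range b. ext_scale h (E.representation (range b) (c $ j) x) x)"
      using indep span by (subst E.sum_representation_eq) auto
    also have "\<dots> = (\<Sum>i\<in>UNIV. h (?M $ i $ j) * b i)"
      using inj by (simp add: sum.reindex ext_scale_def code_matrix_def)
    finally show ?thesis .
  qed
  have "ext_product h v c = (\<Sum>j\<in>UNIV. \<Sum>i\<in>UNIV. h (v $ j) * (h (?M $ i $ j) * b i))"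
    unfolding ext_product_def by (subst c) (simp add: sum_distrib_left)
  also have "\<dots> = (\<Sum>i\<in>UNIV. \<Sum>j\<in>UNIV. h (v $ j) * (h (?M $ i $ j) * b i))"
    by (rule sum.swap)
  also have "\<dots> = (\<Sum>i\<in>UNIV. h (?x i) * b i)"
    by (simp add: scalar_product_def row_def field_embedding_sum[OF h] field_embedding_simps[OF h]
        sum_distrib_right mult.assoc mult.left_commute)
  finally have eq: "ext_product h v c = (\<Sum>i\<in>UNIV. h (?x i) * b i)" .
  show ?thesis
  proof
    assume 0: "ext_product h v c = 0"
    have "(\<Sum>y\<in>range b. ext_scale h (?x (inv b y)) y) = (\<Sum>i\<in>UNIV. h (?x i) * b i)"
      using inj by (simp add: sum.reindex ext_scale_def inv_f_f)
    then have "(\<Sum>y\<in>range b. ext_scale h (?x (inv b y)) y) = 0"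
      using eq 0 by simp
    then have "?x (inv b (b i)) = 0" for i
      using E.independentD[OF indep _ subset_refl, of "\<lambda>y. ?x (inv b y)" "b i"] by simp
    then show "\<forall>i. ?x i = 0"
      using inj by (simp add: inv_f_f)
  next
    assume "\<forall>i. ?x i = 0"
    then show "ext_product h v c = 0"
      using eq field_embedding_simps(1)[OF h] by simp
  qed
qed

text \<open>Turns containment of supports into vanishing of functionals, which does not depend on
  the basis \<open>b\<close>.\<close>

lemma Rsupp_subset_orth_compl_iff:
  fixes h :: "'q::field \<Rightarrow> 'l::field" and b :: "'m::finite \<Rightarrow> 'l"
  assumes "field_embedding h" "ext_basis h b"
  shows "Rsupp h b c \<subseteq> orth_compl V \<longleftrightarrow> (\<forall>v\<in>V. ext_product h v c = 0)"
proof -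
  have "Rsupp h b c \<subseteq> orth_compl V \<longleftrightarrow> rows (code_matrix h b c) \<subseteq> orth_compl V"
    unfolding Rsupp_def using vec.span_superset vec.span_minimal[OF _ orth_compl_subspace] by blast
  also have "\<dots> \<longleftrightarrow> V \<subseteq> orth_compl (rows (code_matrix h b c))"
    by (rule subset_orth_compl_iff)
  also have "\<dots> \<longleftrightarrow> (\<forall>v\<in>V. \<forall>i. scalar_product (row i (code_matrix h b c)) v = 0)"
    by (auto simp: orth_compl_def rows_def)
  finally show ?thesis
    using ext_product_eq_0_iff[OF assms] by metis
qed

definition points_span :: "('q::field, 'n::finite) proj_point set \<Rightarrow> ('q ^ 'n) set" where
  "points_span A = vec.span (\<Union>p\<in>A. Rep_proj_point p)"

context
  fixes h :: "'q::{field,finite} \<Rightarrow> 'l::{field,finite}" and b :: "'m::finite \<Rightarrow> 'l"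
    and C :: "('l ^ 'n::finite) set"
  assumes h: "field_embedding h" and b: "ext_basis h b" and C: "vec.subspace C"
begin

lemma code_rank_eq:
  "Cl_rank (qmatroid_rank h b C) S = vec.dim C - vec.dim (vanish h C (\<Union>p\<in>S. Rep_proj_point p))"
proof -
  have "supported_subcode h b C (orth_compl V) = vanish h C V" for V
    using Rsupp_subset_orth_compl_iff[OF h b] by (auto simp: supported_subcode_def vanish_def)
  then show ?thesis
    by (simp add: Cl_rank_def qmatroid_rank_def vanish_span[OF h])
qed

lemma code_rank_add:
  "Cl_rank (qmatroid_rank h b C) S + vec.dim (vanish h C (\<Union>p\<in>S. Rep_proj_point p)) = vec.dim C"
proof -
  have "vanish h C V \<subseteq> C" for V
    by (auto simp: vanish_def)
  then have "vec.dim (vanish h C (\<Union>p\<in>S. Rep_proj_point p)) \<le> vec.dim C"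
    by (rule vec.dim_subset)
  then show ?thesis
    by (simp add: code_rank_eq)
qed

text \<open>A point imposes a single functional, and the same \<open>v\<close> has to serve every
  \<open>S\<close>, since \<open>rank_closure\<close> compares two sets.\<close>

lemma vanish_points_insert:
  "\<exists>v. \<forall>S. vanish h C (\<Union>p\<in>insert p S. Rep_proj_point p)
      = vanish h C (insert v (\<Union>p\<in>S. Rep_proj_point p))"
proof -
  obtain v where v: "Rep_proj_point p = vec.span {v}"
    using proj_point_span by blast
  have "vanish h C (\<Union>p\<in>insert p S. Rep_proj_point p)
      = vanish h C (insert v (\<Union>p\<in>S. Rep_proj_point p))" for S
  proof -
    have "vanish h C (\<Union>p\<in>insert p S. Rep_proj_point p)
        = vanish h C {v} \<inter> vanish h C (\<Union>p\<in>S. Rep_proj_point p)"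
      using vanish_span[OF h, of C "{v}"] v by (simp add: vanish_Un)
    then show ?thesis
      using vanish_Un[of h C "{v}" "\<Union>p\<in>S. Rep_proj_point p"] by simp
  qed
  then show ?thesis
    by blast
qed

lemma code_rank_function: "rank_function (Cl_rank (qmatroid_rank h b C))"
proof
  let ?r = "Cl_rank (qmatroid_rank h b C)" and ?V = "\<lambda>S. vanish h C (\<Union>p\<in>S. Rep_proj_point p)"
  fix S S' p
  obtain v where v: "\<And>S. ?V (insert p S) = vanish h C (insert v (\<Union>p\<in>S. Rep_proj_point p))"
    using vanish_points_insert[of p] by blast
  have sub: "?V (insert p S) \<subseteq> ?V S" for S
    by (rule vanish_mono) auto
  have "vec.dim (?V (insert p S)) \<le> vec.dim (?V S)"
    by (rule vec.dim_subset[OF sub])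
  then show "?r S \<le> ?r (insert p S)"
    using code_rank_add[of S] code_rank_add[of "insert p S"] by linarith
  have "vec.dim (?V S) \<le> Suc (vec.dim (?V (insert p S)))"
    unfolding v by (rule dim_vanish_insert[OF C])
  then show "?r (insert p S) \<le> Suc (?r S)"
    using code_rank_add[of S] code_rank_add[of "insert p S"] by linarith
  assume SS': "S \<subseteq> S'" and eq: "?r (insert p S) = ?r S"
  \<comment> \<open>Equal ranks make the smaller space the whole one, so the functional
    \<open>v\<close> already vanishes on \<open>?V S\<close>, and hence on the subspace
    \<open>?V S'\<close>.\<close>
  have "?V (insert p S) = ?V S"
    using code_rank_add[of S] code_rank_add[of "insert p S"] eq sub
    by (intro vec.subspace_dim_equal vanish_subspace[OF C]) auto
  moreover have "?V S' \<subseteq> ?V S"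
    using SS' by (intro vanish_mono) auto
  ultimately have "?V S' \<subseteq> ?V (insert p S)"
    by blast
  then have "?V (insert p S') = ?V S'"
    unfolding v by (auto simp: vanish_def)
  then show "?r (insert p S') = ?r S'"
    by (simp add: code_rank_eq)
qed

section \<open>Flats of the code matroid and supports of subcodes\<close>

interpretation R: rank_function "Cl_rank (qmatroid_rank h b C)"
  by (rule code_rank_function)

text \<open>The zero vector is added for \<open>X = {0}\<close>, which contains no point.\<close>

lemma points_Union_span:
  assumes "vec.subspace X"
  shows "(\<Union>p\<in>{p. Rep_proj_point p \<subseteq> X}. Rep_proj_point p) \<union> {0} = X"
proof
  show "(\<Union>p\<in>{p. Rep_proj_point p \<subseteq> X}. Rep_proj_point p) \<union> {0} \<subseteq> X"
    using assms vec.subspace_0 by auto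
  show "X \<subseteq> (\<Union>p\<in>{p. Rep_proj_point p \<subseteq> X}. Rep_proj_point p) \<union> {0}"
  proof
    fix v assume v: "v \<in> X"
    show "v \<in> (\<Union>p\<in>{p. Rep_proj_point p \<subseteq> X}. Rep_proj_point p) \<union> {0}"
    proof (cases "v = 0")
      case False
      then obtain p where p: "Rep_proj_point p = vec.span {v}"
        by (rule ex_proj_point)
      then have "Rep_proj_point p \<subseteq> X" "v \<in> Rep_proj_point p"
        using v assms by (simp_all add: vec.span_minimal vec.span_base)
      then show ?thesis by blast
    qed simp
  qed
qed

lemma code_rank_UNIV: "Cl_rank (qmatroid_rank h b C) UNIV = vec.dim C"
proof -
  have "(\<Union>p\<in>UNIV. Rep_proj_point (p :: ('q, 'n) proj_point)) \<union> {0} = UNIV"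
    using points_Union_span[of "UNIV :: ('q ^ 'n) set"] by simp
  moreover have "vanish h C (V \<union> {0}) = vanish h C V" for V
    by (auto simp: vanish_def ext_product_left[OF h])
  ultimately have "vanish h C (\<Union>p\<in>UNIV. Rep_proj_point (p :: ('q, 'n) proj_point)) = vanish h C UNIV"
    by metis
  then have "vec.dim (vanish h C (\<Union>p\<in>UNIV. Rep_proj_point (p :: ('q, 'n) proj_point))) = 0"
    using vanish_UNIV[OF h, of C] by (simp only: vec.dim_eq_0)
  then show ?thesis
    using code_rank_add[of UNIV] by linarith
qed

text \<open>Codewords vanishing on \<open>A\<close> vanish on its span, so a point of the span
  leaves the rank unchanged and belongs to the flat.\<close>

lemma flat_eq_points:
  assumes "R.flat A"
  shows "A = {p. Rep_proj_point p \<subseteq> points_span A}"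
proof
  show "A \<subseteq> {p. Rep_proj_point p \<subseteq> points_span A}"
    unfolding points_span_def using vec.span_superset by blast
  show "{p. Rep_proj_point p \<subseteq> points_span A} \<subseteq> A"
  proof
    fix p assume p: "p \<in> {p. Rep_proj_point p \<subseteq> points_span A}"
    let ?U = "\<Union>p\<in>A. Rep_proj_point p"
    have "vanish h C ?U = vanish h C (points_span A)"
      by (simp add: points_span_def vanish_span[OF h])
    also have "\<dots> \<subseteq> vanish h C (Rep_proj_point p)"
      using p by (intro vanish_mono) simp
    finally have "vanish h C (\<Union>p\<in>insert p A. Rep_proj_point p) = vanish h C ?U"
      by (auto simp: vanish_Un)
    then have "Cl_rank (qmatroid_rank h b C) (insert p A) = Cl_rank (qmatroid_rank h b C) A"
      by (simp add: code_rank_eq)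
    then show "p \<in> A"
      using assms by (auto simp: R.flat_def)
  qed
qed

lemma card_Compl_flat:
  assumes "R.flat A"
  shows "card (- A) = qbracket CARD('q) CARD('n) (CARD('n) - vec.dim (points_span A))"
proof -
  have "- A = {p. \<not> Rep_proj_point p \<subseteq> points_span A}"
    using flat_eq_points[OF assms] by blast
  then show ?thesis
    using card_points_outside_qbracket[of "points_span A"] by (simp add: points_span_def)
qed

text \<open>A codeword vanishing on the points has its support in the orthogonal complement of their
  span; this bounds the weight by the codimension of a flat.\<close>

lemma dim_Rsupp_code_vanish:
  "vec.dim (Rsupp_code h b (vanish h C (\<Union>p\<in>A. Rep_proj_point p))) \<le> CARD('n) - vec.dim (points_span A)"
proof -
  let ?U = "\<Union>p\<in>A. Rep_proj_point p"
  have "Rsupp h b d \<subseteq> orth_compl ?U" if "d \<in> vanish h C ?U" for d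
    unfolding Rsupp_subset_orth_compl_iff[OF h b] using that by (simp add: vanish_def)
  then have "(\<Union>d\<in>vanish h C ?U. Rsupp h b d) \<subseteq> orth_compl ?U"
    by blast
  then have "Rsupp_code h b (vanish h C ?U) \<subseteq> orth_compl (points_span A)"
    unfolding Rsupp_code_def points_span_def orth_compl_span
    by (rule vec.span_minimal[OF _ orth_compl_subspace])
  then have "vec.dim (Rsupp_code h b (vanish h C ?U)) \<le> vec.dim (orth_compl (points_span A))"
    by (rule vec.dim_subset)
  then show ?thesis
    using dim_orth_compl[of "points_span A"] by linarith
qed

lemma flat_of_subcode:
  assumes D: "D \<subseteq> C" "vec.dim D = r"
  shows "\<exists>A. R.flat A \<and> Cl_rank (qmatroid_rank h b C) A + r = vec.dim C \<and>
    CARD('n) - vec.dim (points_span A) \<le> vec.dim (Rsupp_code h b D)"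
proof -
  let ?r = "Cl_rank (qmatroid_rank h b C)"
  let ?Y = "Rsupp_code h b D" and ?X = "orth_compl (Rsupp_code h b D)"
  let ?A = "{p. Rep_proj_point p \<subseteq> ?X}"
  have X: "(\<Union>p\<in>?A. Rep_proj_point p) \<subseteq> ?X"
    by blast
  have "D \<subseteq> vanish h C (\<Union>p\<in>?A. Rep_proj_point p)"
  proof
    fix c assume c: "c \<in> D"
    then have "Rsupp h b c \<subseteq> ?Y"
      unfolding Rsupp_code_def using vec.span_superset by blast
    moreover have "?Y \<subseteq> orth_compl (\<Union>p\<in>?A. Rep_proj_point p)"
      using X subset_orth_compl_iff by blast
    ultimately have "Rsupp h b c \<subseteq> orth_compl (\<Union>p\<in>?A. Rep_proj_point p)"
      by (rule subset_trans)
    then show "c \<in> vanish h C (\<Union>p\<in>?A. Rep_proj_point p)"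
      using c D(1) unfolding Rsupp_subset_orth_compl_iff[OF h b] by (auto simp: vanish_def)
  qed
  then have "r \<le> vec.dim (vanish h C (\<Union>p\<in>?A. Rep_proj_point p))"
    unfolding D(2)[symmetric] by (rule vec.dim_subset)
  \<comment> \<open>The codewords vanishing on these points may form more than \<open>D\<close>, so
    the rank can be too small. Enlarging to a flat of the exact rank only enlarges the span.\<close>
  then have "?r ?A \<le> vec.dim C - r"
    using code_rank_add[of ?A] by linarith
  moreover have "vec.dim C - r \<le> ?r UNIV"
    by (simp add: code_rank_UNIV)
  ultimately obtain A where A: "?A \<subseteq> A" "?r A = vec.dim C - r" "R.flat A"
    using R.flat_extension by blast
  have "?X \<subseteq> points_span A"
  proof
    fix v assume "v \<in> ?X"
    then have "v \<in> (\<Union>p\<in>?A. Rep_proj_point p) \<union> {0}"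
      using points_Union_span[OF orth_compl_subspace] by blast
    then show "v \<in> points_span A"
      using A(1) by (auto simp: points_span_def intro: vec.span_base vec.span_zero)
  qed
  then have "vec.dim ?X \<le> vec.dim (points_span A)"
    by (rule vec.dim_subset)
  then have "CARD('n) - vec.dim (points_span A) \<le> vec.dim ?Y"
    using dim_orth_compl[of ?Y] by linarith
  moreover have "r \<le> vec.dim C"
    using vec.dim_subset[OF D(1)] D(2) by simp
  ultimately show ?thesis
    using A(2,3) by (intro exI[of _ A]) simp
qed

section \<open>Generalized rank weights as least Betti degrees\<close>

lemma gen_rank_weight_attained:
  assumes "r \<le> vec.dim C"
  shows "\<exists>D. vec.subspace D \<and> D \<subseteq> C \<and> vec.dim D = r \<and> gen_rank_weight h b C r = vec.dim (Rsupp_code h b D)"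
proof -
  let ?S = "{vec.dim (Rsupp_code h b D) | D. vec.subspace D \<and> D \<subseteq> C \<and> vec.dim D = r}"
  obtain D where D: "vec.subspace D" "D \<subseteq> vec.span C" "vec.dim D = r"
    by (rule vec.choose_subspace_of_subspace[OF assms])
  moreover have "vec.span C = C"
    using C by (simp only: vec.span_eq_iff)
  ultimately have "?S \<noteq> {}"
    by auto
  then have "Min ?S \<in> ?S"
    by (intro Min_in) auto
  then show ?thesis
    unfolding gen_rank_weight_def by blast
qed

lemma gen_rank_weight_le:
  assumes "vec.subspace D" "D \<subseteq> C" "vec.dim D = r"
  shows "gen_rank_weight h b C r \<le> vec.dim (Rsupp_code h b D)"
  unfolding gen_rank_weight_def using assms by (intro Min_le) auto

lemma betti_code_iff:
  fixes F :: "(('q, 'n) proj_point, 'k::field) free_complex"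
  assumes F: "minimal_graded_free_resolution
      (stanley_reisner_ideal (indep_complex (dual_rank (Cl_rank (qmatroid_rank h b C))))) F"
  shows "betti F r s \<noteq> 0 \<longleftrightarrow> (\<exists>A. R.flat A \<and> Cl_rank (qmatroid_rank h b C) A + r = vec.dim C \<and>
      s = qbracket CARD('q) CARD('n) (CARD('n) - vec.dim (points_span A)))"
  unfolding R.betti_dual_iff_flat[OF F] code_rank_UNIV using card_Compl_flat by metis

lemma gen_rank_weight_betti:
  fixes F :: "(('q, 'n) proj_point, 'k::field) free_complex"
  assumes F: "minimal_graded_free_resolution
      (stanley_reisner_ideal (indep_complex (dual_rank (Cl_rank (qmatroid_rank h b C))))) F"
    and r: "r \<le> vec.dim C"
  defines "J \<equiv> {j. j \<le> CARD('n) \<and> betti F r (qbracket CARD('q) CARD('n) j) \<noteq> 0}"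
  shows "J \<noteq> {}" "gen_rank_weight h b C r = Min J"
proof -
  let ?d = "gen_rank_weight h b C r"
  have le: "?d \<le> j" if j: "j \<in> J" for j
  proof -
    obtain A where A: "R.flat A" "Cl_rank (qmatroid_rank h b C) A + r = vec.dim C"
        "qbracket CARD('q) CARD('n) j = qbracket CARD('q) CARD('n) (CARD('n) - vec.dim (points_span A))"
      using j unfolding J_def betti_code_iff[OF F] by blast
    have "j = CARD('n) - vec.dim (points_span A)"
      by (rule qbracket_inject[OF _ _ card_field_ge_2 A(3)]) (use j in \<open>auto simp: J_def\<close>)
    \<comment> \<open>A flat of corank \<open>r\<close> cuts out a subcode of dimension exactly
      \<open>r\<close>, which competes in the minimum defining the weight.\<close>
    moreover have "vec.dim (vanish h C (\<Union>p\<in>A. Rep_proj_point p)) = r"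
      using code_rank_add[of A] A(2) by linarith
    then have "?d \<le> vec.dim (Rsupp_code h b (vanish h C (\<Union>p\<in>A. Rep_proj_point p)))"
      by (intro gen_rank_weight_le vanish_subspace[OF C]) (auto simp: vanish_def)
    ultimately show ?thesis
      using dim_Rsupp_code_vanish[of A] by linarith
  qed
  obtain D where D: "D \<subseteq> C" "vec.dim D = r" "?d = vec.dim (Rsupp_code h b D)"
    using gen_rank_weight_attained[OF r] by blast
  obtain A where A: "R.flat A" "Cl_rank (qmatroid_rank h b C) A + r = vec.dim C"
      "CARD('n) - vec.dim (points_span A) \<le> ?d"
    using flat_of_subcode[OF D(1,2)] unfolding D(3) by blast
  have J: "CARD('n) - vec.dim (points_span A) \<in> J"
    unfolding J_def betti_code_iff[OF F] using A by auto
  then show "J \<noteq> {}"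
    by blast
  \<comment> \<open>The codimension of the flat found lies in \<open>J\<close>, so it is at least
    \<open>?d\<close>; being at most \<open>?d\<close> as well, it equals the weight.\<close>
  have "?d \<in> J"
    using J le[OF J] A(3) by (simp add: le_antisym)
  moreover have "finite J"
    by (rule finite_subset[of _ "{..CARD('n)}"]) (auto simp: J_def)
  ultimately show "?d = Min J"
    using le by (intro Min_eqI[symmetric]) auto
qed

end

theorem theorem3p15:
  fixes h :: "'q::{field,finite} \<Rightarrow> 'l::{field,finite}"
    and b :: "'m::finite \<Rightarrow> 'l"
    and C :: "('l ^ 'n::finite) set"
    and k :: nat
    and F :: "(('q, 'n) proj_point, 'k::field) free_complex"
  assumes "field_embedding h"
    and "ext_basis h b"
    and "vec.subspace C"
    and "vec.dim C = k"
    and "minimal_graded_free_resolution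
           (stanley_reisner_ideal (indep_complex (dual_rank (Cl_rank (qmatroid_rank h b C))))) F"
  shows "(\<forall>r. 1 \<le> r \<and> r \<le> k \<longrightarrow>
            {j. j \<le> CARD('n) \<and> betti F r (qbracket CARD('q) CARD('n) j) \<noteq> 0} \<noteq> {} \<and>
            gen_rank_weight h b C r
              = Min {j. j \<le> CARD('n) \<and> betti F r (qbracket CARD('q) CARD('n) j) \<noteq> 0}) \<and>
         (\<forall>r s. s \<le> (CARD('q) ^ CARD('n) - 1) div (CARD('q) - 1) \<and>
            \<not> (\<exists>j\<le>CARD('n). s = qbracket CARD('q) CARD('n) j) \<longrightarrow>
            betti F r s = 0)"
proof (intro conjI allI impI)
  fix r assume "1 \<le> r \<and> r \<le> k"
  then have "r \<le> vec.dim C"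
    using assms(4) by simp
  note w = gen_rank_weight_betti[OF assms(1-3,5) this]
  show "{j. j \<le> CARD('n) \<and> betti F r (qbracket CARD('q) CARD('n) j) \<noteq> 0} \<noteq> {}"
    "gen_rank_weight h b C r = Min {j. j \<le> CARD('n) \<and> betti F r (qbracket CARD('q) CARD('n) j) \<noteq> 0}"
    by (rule w(1)) (rule w(2))
next
  fix r s
  assume s: "s \<le> (CARD('q) ^ CARD('n) - 1) div (CARD('q) - 1) \<and>
    \<not> (\<exists>j\<le>CARD('n). s = qbracket CARD('q) CARD('n) j)"
  show "betti F r s = 0"
  proof (rule ccontr)
    assume "betti F r s \<noteq> 0"
    then obtain A where "s = qbracket CARD('q) CARD('n) (CARD('n) - vec.dim (points_span A :: ('q ^ 'n) set))"
      using betti_code_iff[OF assms(1-3,5), of r s] by blast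
    then show False
      using s diff_le_self by blast
  qed
qed

end
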